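(* The twisted arrow category $\mathrm{Tw}(\mathrm{sOp})$ is equivalent to the Moerdijk–Weiss dendroidal category $\Omega$.
   Context: **$\mathrm{sOp}$** is the $\mathbb N$-coloured symmetric set-operad whose algebras are single-coloured symmetric operads. For $m\ge1$ the elements of $\mathrm{sOp}(n_1,\dots,n_m;n_0)$ are (isomorphism classes of) planar rooted trees with $m$ vertices numbered $1,\dots,m$, the $j$-th vertex having $n_j\ge0$ inputs, and with $n_0$ leaves numbered arbitrarily by $1,\dots,n_0$. In addition $\mathrm{sOp}(;1)$ consists of the edge without vertices, and there are no other operations of arity $0$. The composition $T\circ_i S$ substitutes the tree $S$ into the $i$-th vertex of $T$, identifying the $k$-th leaf of $S$ with the $k$-th input of this vertex and the root of $S$ with its output; substitution of the edge without vertices erases a vertex with one input. Symmetric groups permute the numbers of vertices. Identities are corollas with leaves numbered in planar order. **Twisted arrow category $\mathrm{Tw}(P)$** of a $C$-coloured symmetric set-operad $P$. Objects: operations of $P$. A morphism with source $p\in P(c_1,\dots,c_n;c_0)$ is (uniquely) a tuple $f=(q_0;q_1,\dots,q_n;\lambda)$, where $q_0\in P$ has arity $m_0\ge 1$ and first input colour $c_0$, $q_i\in P$ ($1\le i\le n$) has arity $m_i\ge 0$ and output colour $c_i$, and $\lambda$ is a bijection from the set of leaves $\{(i,k):1\le i\le n,1\le k\le m_i\}\cup\{(0,k):2\le k\le m_0\}$ onto $\{1,\dots,N\}$ with $k\mapsto\lambda(i,k)$ increasing for each fixed $i$. The target is the operation $t$ with $t(x_1,\dots,x_N)=q_0\bigl(p(q_1(x_{\lambda(1,1)},\dots,x_{\lambda(1,m_1)}),\dots,q_n(x_{\lambda(n,1)},\dots)),x_{\lambda(0,2)},\dots,x_{\lambda(0,m_0)}\bigr)$.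 The composite of $f:p\to t$ with $g=(r_0;r_1,\dots,r_N;\mu):t\to u$ has upper vertices $q_i(r_{\lambda(i,1)},\dots,r_{\lambda(i,m_i)})$ and lower vertex $r_0\circ_1 q_0(\mathrm{id},r_{\lambda(0,2)},\dots,r_{\lambda(0,m_0)})$, with leaves numbered by $\mu$, and with inputs of each vertex (other than the first input of the lower one) then permuted so that the numbers increase. **$\Omega$** is the full subcategory of the category of coloured symmetric operads in sets on the free operads $\Omega(T)$ generated by finite rooted trees $T$ (colours: edges of $T$; generators: vertices of $T$). *)

theory Defs
  imports "HOL-Library.FuncSet" "HOL-Combinatorics.Permutations"
    "HOL-Library.Infinite_Typeclass"
begin

section \<open>Categories and equivalences\<close>

record ('o, 'a) category =
  Ob :: "'o set"
  Ar :: "'a set"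
  Dom :: "'a \<Rightarrow> 'o"
  Cod :: "'a \<Rightarrow> 'o"
  Ide :: "'o \<Rightarrow> 'a"
  Cmp :: "'a \<Rightarrow> 'a \<Rightarrow> 'a"  \<comment> \<open>\<open>Cmp C g f\<close> is \<open>g\<close> after \<open>f\<close>\<close>

definition is_category :: "('o, 'a) category \<Rightarrow> bool" where
  "is_category C \<longleftrightarrow>
     (\<forall>f\<in>Ar C. Dom C f \<in> Ob C \<and> Cod C f \<in> Ob C) \<and>
     (\<forall>x\<in>Ob C. Ide C x \<in> Ar C \<and> Dom C (Ide C x) = x \<and> Cod C (Ide C x) = x) \<and>
     (\<forall>f\<in>Ar C. \<forall>g\<in>Ar C. Cod C f = Dom C g \<longrightarrow>
        Cmp C g f \<in> Ar C \<and> Dom C (Cmp C g f) = Dom C f \<and> Cod C (Cmp C g f) = Cod C g) \<and>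
     (\<forall>f\<in>Ar C. Cmp C f (Ide C (Dom C f)) = f \<and> Cmp C (Ide C (Cod C f)) f = f) \<and>
     (\<forall>f\<in>Ar C. \<forall>g\<in>Ar C. \<forall>h\<in>Ar C. Cod C f = Dom C g \<and> Cod C g = Dom C h \<longrightarrow>
        Cmp C h (Cmp C g f) = Cmp C (Cmp C h g) f)"

definition is_functor ::
  "('o, 'a) category \<Rightarrow> ('p, 'b) category \<Rightarrow> ('o \<Rightarrow> 'p) \<Rightarrow> ('a \<Rightarrow> 'b) \<Rightarrow> bool" where
  "is_functor C D Fo Fa \<longleftrightarrow>
     (\<forall>x\<in>Ob C. Fo x \<in> Ob D \<and> Fa (Ide C x) = Ide D (Fo x)) \<and>
     (\<forall>f\<in>Ar C. Fa f \<in> Ar D \<and> Dom D (Fa f) = Fo (Dom C f) \<and> Cod D (Fa f) = Fo (Cod C f)) \<and>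
     (\<forall>f\<in>Ar C. \<forall>g\<in>Ar C. Cod C f = Dom C g \<longrightarrow> Fa (Cmp C g f) = Cmp D (Fa g) (Fa f))"

definition is_iso :: "('o, 'a) category \<Rightarrow> 'a \<Rightarrow> bool" where
  "is_iso C f \<longleftrightarrow> f \<in> Ar C \<and>
     (\<exists>g\<in>Ar C. Dom C g = Cod C f \<and> Cod C g = Dom C f \<and>
        Cmp C g f = Ide C (Dom C f) \<and> Cmp C f g = Ide C (Cod C f))"

definition is_natural_iso ::
  "('o, 'a) category \<Rightarrow> ('p, 'b) category \<Rightarrow> ('o \<Rightarrow> 'p) \<Rightarrow> ('a \<Rightarrow> 'b) \<Rightarrow>
   ('o \<Rightarrow> 'p) \<Rightarrow> ('a \<Rightarrow> 'b) \<Rightarrow> ('o \<Rightarrow> 'b) \<Rightarrow> bool" where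
  "is_natural_iso C D Fo Fa Go Ga \<eta> \<longleftrightarrow>
     (\<forall>x\<in>Ob C. is_iso D (\<eta> x) \<and> Dom D (\<eta> x) = Fo x \<and> Cod D (\<eta> x) = Go x) \<and>
     (\<forall>f\<in>Ar C. Cmp D (Ga f) (\<eta> (Dom C f)) = Cmp D (\<eta> (Cod C f)) (Fa f))"

definition equivalent_categories :: "('o, 'a) category \<Rightarrow> ('p, 'b) category \<Rightarrow> bool" where
  "equivalent_categories C D \<longleftrightarrow> is_category C \<and> is_category D \<and>
     (\<exists>Fo Fa Go Ga \<eta> \<epsilon>.
        is_functor C D Fo Fa \<and> is_functor D C Go Ga \<and>
        is_natural_iso C C id id (Go \<circ> Fo) (Ga \<circ> Fa) \<eta> \<and>
        is_natural_iso D D (Fo \<circ> Go) (Fa \<circ> Ga) id id \<epsilon>)"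

definition full_subcategory :: "('o, 'a) category \<Rightarrow> 'o set \<Rightarrow> ('o, 'a) category" where
  "full_subcategory C S =
     C\<lparr>Ob := S, Ar := {f \<in> Ar C. Dom C f \<in> S \<and> Cod C f \<in> S}\<rparr>"


section \<open>Coloured symmetric operads in sets\<close>

text \<open>
  Inputs of an operation \<open>p\<close> are numbered from \<open>1\<close>; the colour of input \<open>i\<close> is
  \<open>Inp P p ! (i - 1)\<close>.  \<open>Comp P p i q\<close> is the partial composition \<open>p \<circ>\<^sub>i q\<close>.
  The action is written as renumbering of the inputs: input \<open>k\<close> of \<open>p\<close> becomes input \<open>\<sigma> k\<close>
  of \<open>Perm P \<sigma> p\<close>, that is, \<open>(Perm P \<sigma> p)(x\<^sub>1, \<dots>, x\<^sub>n) = p(x\<^bsub>\<sigma> 1\<^esub>, \<dots>, x\<^bsub>\<sigma> n\<^esub>)\<close>.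
  This is a left action; the usual right action of \<open>\<sigma>\<close> is \<open>Perm P (inv \<sigma>)\<close>.
\<close>

record ('c, 'o) operad =
  Col :: "'c set"
  Ops :: "'o set"
  Inp :: "'o \<Rightarrow> 'c list"
  Out :: "'o \<Rightarrow> 'c"
  Unit :: "'c \<Rightarrow> 'o"
  Comp :: "'o \<Rightarrow> nat \<Rightarrow> 'o \<Rightarrow> 'o"
  Perm :: "(nat \<Rightarrow> nat) \<Rightarrow> 'o \<Rightarrow> 'o"

abbreviation arity :: "('c, 'o) operad \<Rightarrow> 'o \<Rightarrow> nat" where
  "arity P p \<equiv> length (Inp P p)"

definition composable :: "('c, 'o) operad \<Rightarrow> 'o \<Rightarrow> nat \<Rightarrow> 'o \<Rightarrow> bool" where
  "composable P p i q \<longleftrightarrow>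
     p \<in> Ops P \<and> q \<in> Ops P \<and> i \<in> {1..arity P p} \<and> Inp P p ! (i - 1) = Out P q"

text \<open>
  In \<open>p \<circ>\<^sub>i q\<close> with \<open>q\<close> of arity \<open>m\<close>, input \<open>k \<noteq> i\<close> of \<open>p\<close> becomes input \<open>shift i m k\<close> and
  input \<open>l\<close> of \<open>q\<close> becomes input \<open>i - 1 + l\<close>.  Consequently permuting the inputs of \<open>p\<close> by
  \<open>\<sigma>\<close>, or those of \<open>q\<close> by \<open>\<tau>\<close>, permutes the inputs of the composite by \<open>outer_perm i m \<sigma>\<close>,
  respectively \<open>inner_perm i m \<tau>\<close>.
\<close>

definition shift :: "nat \<Rightarrow> nat \<Rightarrow> nat \<Rightarrow> nat" where
  "shift i m k = (if k < i then k else k + m - 1)"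

definition outer_perm :: "nat \<Rightarrow> nat \<Rightarrow> (nat \<Rightarrow> nat) \<Rightarrow> nat \<Rightarrow> nat" where
  "outer_perm i m \<sigma> l =
     (if l < i then shift (\<sigma> i) m (\<sigma> l)
      else if l < i + m then \<sigma> i + (l - i)
      else shift (\<sigma> i) m (\<sigma> (l + 1 - m)))"

definition inner_perm :: "nat \<Rightarrow> nat \<Rightarrow> (nat \<Rightarrow> nat) \<Rightarrow> nat \<Rightarrow> nat" where
  "inner_perm i m \<tau> l = (if i \<le> l \<and> l < i + m then i - 1 + \<tau> (l + 1 - i) else l)"

definition symmetric_operad :: "('c, 'o) operad \<Rightarrow> bool" where
  "symmetric_operad P \<longleftrightarrow>
     (\<forall>p\<in>Ops P. set (Inp P p) \<subseteq> Col P \<and> Out P p \<in> Col P) \<and>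
     (\<forall>c\<in>Col P. Unit P c \<in> Ops P \<and> Inp P (Unit P c) = [c] \<and> Out P (Unit P c) = c) \<and>
     (\<forall>p i q. composable P p i q \<longrightarrow>
        Comp P p i q \<in> Ops P \<and> Out P (Comp P p i q) = Out P p \<and>
        Inp P (Comp P p i q) = take (i - 1) (Inp P p) @ Inp P q @ drop i (Inp P p)) \<and>
     (\<forall>p\<in>Ops P. \<forall>\<sigma>. \<sigma> permutes {1..arity P p} \<longrightarrow>
        Perm P \<sigma> p \<in> Ops P \<and> Out P (Perm P \<sigma> p) = Out P p \<and>
        arity P (Perm P \<sigma> p) = arity P p \<and>
        (\<forall>k\<in>{1..arity P p}. Inp P (Perm P \<sigma> p) ! (\<sigma> k - 1) = Inp P p ! (k - 1))) \<and>
     \<comment> \<open>units\<close>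
     (\<forall>p\<in>Ops P. Comp P (Unit P (Out P p)) 1 p = p) \<and>
     (\<forall>p\<in>Ops P. \<forall>i\<in>{1..arity P p}. Comp P p i (Unit P (Inp P p ! (i - 1))) = p) \<and>
     \<comment> \<open>associativity\<close>
     (\<forall>p i q j r. composable P p i q \<and> composable P q j r \<longrightarrow>
        Comp P (Comp P p i q) (i - 1 + j) r = Comp P p i (Comp P q j r)) \<and>
     (\<forall>p i q k r. composable P p i q \<and> composable P p k r \<and> i < k \<longrightarrow>
        Comp P (Comp P p i q) (shift i (arity P q) k) r = Comp P (Comp P p k r) i q) \<and>
     \<comment> \<open>symmetric group actions and equivariance\<close>
     (\<forall>p\<in>Ops P. Perm P id p = p) \<and>
     (\<forall>p\<in>Ops P. \<forall>\<sigma> \<tau>. \<sigma> permutes {1..arity P p} \<and> \<tau> permutes {1..arity P p} \<longrightarrow>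
        Perm P \<sigma> (Perm P \<tau> p) = Perm P (\<sigma> \<circ> \<tau>) p) \<and>
     (\<forall>p i q \<sigma>. composable P p i q \<and> \<sigma> permutes {1..arity P p} \<longrightarrow>
        Comp P (Perm P \<sigma> p) (\<sigma> i) q = Perm P (outer_perm i (arity P q) \<sigma>) (Comp P p i q)) \<and>
     (\<forall>p i q \<tau>. composable P p i q \<and> \<tau> permutes {1..arity P q} \<longrightarrow>
        Comp P p i (Perm P \<tau> q) = Perm P (inner_perm i (arity P q) \<tau>) (Comp P p i q))"

text \<open>The composite \<open>p(q\<^sub>1, \<dots>, q\<^sub>n) = (\<cdots>(p \<circ>\<^sub>n q\<^sub>n) \<cdots>) \<circ>\<^sub>1 q\<^sub>1\<close>.\<close>

definition full_comp :: "('c, 'o) operad \<Rightarrow> 'o \<Rightarrow> 'o list \<Rightarrow> 'o" where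
  "full_comp P p qs =
     foldr (\<lambda>(i, q) r. Comp P r i q) (zip [1..<Suc (length qs)] qs) p"

text \<open>A morphism of operads is a pair of maps, on colours and on operations, kept
  \<open>undefined\<close> outside the carriers so that equal morphisms are equal pairs.\<close>

definition operad_morphisms ::
  "('c, 'o) operad \<Rightarrow> ('d, 'u) operad \<Rightarrow> (('c \<Rightarrow> 'd) \<times> ('o \<Rightarrow> 'u)) set" where
  "operad_morphisms P Q = {(f, g).
     f \<in> Col P \<rightarrow>\<^sub>E Col Q \<and> g \<in> Ops P \<rightarrow>\<^sub>E Ops Q \<and>
     (\<forall>p\<in>Ops P. Inp Q (g p) = map f (Inp P p) \<and> Out Q (g p) = f (Out P p)) \<and>
     (\<forall>c\<in>Col P. g (Unit P c) = Unit Q (f c)) \<and>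
     (\<forall>p i q. composable P p i q \<longrightarrow> g (Comp P p i q) = Comp Q (g p) i (g q)) \<and>
     (\<forall>p\<in>Ops P. \<forall>\<sigma>. \<sigma> permutes {1..arity P p} \<longrightarrow> g (Perm P \<sigma> p) = Perm Q \<sigma> (g p))}"

type_synonym ('c, 'o) operad_arrow =
  "('c, 'o) operad \<times> (('c \<Rightarrow> 'c) \<times> ('o \<Rightarrow> 'o)) \<times> ('c, 'o) operad"

definition Operads :: "(('c, 'o) operad, ('c, 'o) operad_arrow) category" where
  "Operads = \<lparr>
     Ob = {P. symmetric_operad P},
     Ar = {(P, h, Q). symmetric_operad P \<and> symmetric_operad Q \<and> h \<in> operad_morphisms P Q},
     Dom = (\<lambda>(P, h, Q). P),
     Cod = (\<lambda>(P, h, Q). Q),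
     Ide = (\<lambda>P. (P, (restrict id (Col P), restrict id (Ops P)), P)),
     Cmp = (\<lambda>(P', (f', g'), Q') (P, (f, g), Q).
              (P, (compose (Col P) f' f, compose (Ops P) g' g), Q'))\<rparr>"


section \<open>Twisted arrow categories\<close>

text \<open>
  A morphism with source \<open>p\<close> of arity \<open>n\<close> is a triple \<open>(p, vs, \<lambda>)\<close> with
  \<open>vs = [q\<^sub>0, q\<^sub>1, \<dots>, q\<^sub>n]\<close>, so that \<open>vs ! i = q\<^sub>i\<close>.  The list \<open>tw_leaves P vs\<close>
  enumerates the leaves \<open>(i, k)\<close> in the order of the inputs of
  \<open>q\<^sub>0 \<circ>\<^sub>1 p(q\<^sub>1, \<dots>, q\<^sub>n)\<close>.
\<close>

type_synonym 'o tw_arrow = "'o \<times> 'o list \<times> (nat \<times> nat \<Rightarrow> nat)"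

definition tw_leaves :: "('c, 'o) operad \<Rightarrow> 'o list \<Rightarrow> (nat \<times> nat) list" where
  "tw_leaves P vs =
     [(i, k). i \<leftarrow> [1..<length vs], k \<leftarrow> [1..<Suc (arity P (vs ! i))]] @
     [(0, k). k \<leftarrow> [2..<Suc (arity P (vs ! 0))]]"

definition tw_arrows :: "('c, 'o) operad \<Rightarrow> 'o tw_arrow set" where
  "tw_arrows P = {(p, vs, lam).
     p \<in> Ops P \<and> length vs = Suc (arity P p) \<and> set vs \<subseteq> Ops P \<and>
     Inp P (vs ! 0) \<noteq> [] \<and> Inp P (vs ! 0) ! 0 = Out P p \<and>
     (\<forall>i\<in>{1..arity P p}. Out P (vs ! i) = Inp P p ! (i - 1)) \<and>
     lam \<in> extensional (set (tw_leaves P vs)) \<and>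
     bij_betw lam (set (tw_leaves P vs)) {1..length (tw_leaves P vs)} \<and>
     (\<forall>i k l. (i, k) \<in> set (tw_leaves P vs) \<and> (i, l) \<in> set (tw_leaves P vs) \<and> k < l \<longrightarrow>
        lam (i, k) < lam (i, l))}"

text \<open>The \<open>l\<close>-th input of \<open>q\<^sub>0 \<circ>\<^sub>1 p(q\<^sub>1, \<dots>, q\<^sub>n)\<close> receives the variable numbered by \<open>\<lambda>\<close> of
  the \<open>l\<close>-th leaf.\<close>

definition tw_target :: "('c, 'o) operad \<Rightarrow> 'o tw_arrow \<Rightarrow> 'o" where
  "tw_target P = (\<lambda>(p, vs, lam).
     let ls = tw_leaves P vs
     in Perm P (\<lambda>l. if l \<in> {1..length ls} then lam (ls ! (l - 1)) else l)
          (Comp P (vs ! 0) 1 (full_comp P p (tl vs))))"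

definition tw_identity :: "('c, 'o) operad \<Rightarrow> 'o \<Rightarrow> 'o tw_arrow" where
  "tw_identity P p =
     (p, Unit P (Out P p) # map (Unit P) (Inp P p),
      \<lambda>(i, k)\<in>{1..arity P p} \<times> {1}. i)"

text \<open>
  If the inputs of \<open>q\<close> carry the distinct numbers listed in \<open>ns\<close>, then \<open>sort_inputs P ns q\<close>
  is \<open>q\<close> with its inputs permuted so that the numbers increase: an input goes to the place given
  by the rank of its number.
\<close>

definition sort_inputs :: "('c, 'o) operad \<Rightarrow> nat list \<Rightarrow> 'o \<Rightarrow> 'o" where
  "sort_inputs P ns q =
     Perm P (\<lambda>l. if l \<in> {1..length ns} then card {x \<in> set ns. x \<le> ns ! (l - 1)} else l) q"

text \<open>
  Composition of \<open>f = (p, vs, \<lambda>)\<close> with \<open>g = (t, ws, \<mu>)\<close>.  The vertex \<open>tw_vertex P vs lam ws i\<close>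
  is the \<open>i\<close>-th vertex of the composite before sorting, and \<open>tw_numbers P vs lam ws mu i\<close> lists
  the numbers of its inputs.  The first input of the lower vertex is not a leaf; it is given the
  number \<open>0\<close>, so that it stays first when the inputs are sorted.
\<close>

definition tw_vertex ::
  "('c, 'o) operad \<Rightarrow> 'o list \<Rightarrow> (nat \<times> nat \<Rightarrow> nat) \<Rightarrow> 'o list \<Rightarrow> nat \<Rightarrow> 'o" where
  "tw_vertex P vs lam ws i =
     (if i = 0
      then Comp P (ws ! 0) 1
             (full_comp P (vs ! 0)
                (Unit P (Inp P (vs ! 0) ! 0) #
                 [ws ! lam (0, k). k \<leftarrow> [2..<Suc (arity P (vs ! 0))]]))
      else full_comp P (vs ! i) [ws ! lam (i, k). k \<leftarrow> [1..<Suc (arity P (vs ! i))]])"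

definition tw_numbers ::
  "('c, 'o) operad \<Rightarrow> 'o list \<Rightarrow> (nat \<times> nat \<Rightarrow> nat) \<Rightarrow> 'o list \<Rightarrow> (nat \<times> nat \<Rightarrow> nat) \<Rightarrow>
   nat \<Rightarrow> nat list" where
  "tw_numbers P vs lam ws mu i =
     (if i = 0
      then 0 #
           [mu (lam (0, k), l). k \<leftarrow> [2..<Suc (arity P (vs ! 0))],
                                l \<leftarrow> [1..<Suc (arity P (ws ! lam (0, k)))]] @
           [mu (0, l). l \<leftarrow> [2..<Suc (arity P (ws ! 0))]]
      else [mu (lam (i, k), l). k \<leftarrow> [1..<Suc (arity P (vs ! i))],
                                l \<leftarrow> [1..<Suc (arity P (ws ! lam (i, k)))]])"

definition tw_composite ::
  "('c, 'o) operad \<Rightarrow> 'o tw_arrow \<Rightarrow> 'o tw_arrow \<Rightarrow> 'o tw_arrow" where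
  "tw_composite P = (\<lambda>(t, ws, mu) (p, vs, lam).
     let num = tw_numbers P vs lam ws mu;
         us = [sort_inputs P (num i) (tw_vertex P vs lam ws i). i \<leftarrow> [0..<length vs]]
     in (p, us, \<lambda>(i, k)\<in>set (tw_leaves P us). sort (num i) ! (k - 1)))"

definition Tw :: "('c, 'o) operad \<Rightarrow> ('o, 'o tw_arrow) category" where
  "Tw P = \<lparr>
     Ob = Ops P,
     Ar = tw_arrows P,
     Dom = fst,
     Cod = tw_target P,
     Ide = tw_identity P,
     Cmp = tw_composite P\<rparr>"


section \<open>Planar rooted trees with numbered leaves\<close>

text \<open>
  A value of this type is a planar rooted tree whose vertices have names in \<open>'v\<close> and whose leaves
  carry numbers.  Planar rooted trees have no non-trivial automorphisms, so values of the type are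
  the isomorphism classes.  \<open>Leaf k\<close> is an edge without vertices.
\<close>

datatype 'v ptree = Leaf nat | Node 'v "'v ptree list"

primrec leaf_numbers :: "'v ptree \<Rightarrow> nat list" where
  "leaf_numbers (Leaf k) = [k]"
| "leaf_numbers (Node v ts) = concat (map leaf_numbers ts)"

text \<open>The vertices, in preorder, each with its number of inputs.\<close>

primrec vertices :: "'v ptree \<Rightarrow> ('v \<times> nat) list" where
  "vertices (Leaf k) = []"
| "vertices (Node v ts) = (v, length ts) # concat (map vertices ts)"

primrec graft :: "(nat \<Rightarrow> 'v ptree) \<Rightarrow> 'v ptree \<Rightarrow> 'v ptree" where
  "graft h (Leaf k) = h k"
| "graft h (Node v ts) = Node v (map (graft h) ts)"


section \<open>The operad of symmetric operads\<close>

text \<open>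
  \<open>insert_tree i S T\<close> substitutes \<open>S\<close> into the vertex \<open>i\<close> of \<open>T\<close> and renumbers the vertices as
  in a partial composition.
\<close>

definition shift_vertices :: "nat \<Rightarrow> nat ptree \<Rightarrow> nat ptree" where
  "shift_vertices i = map_ptree (\<lambda>j. i - 1 + j)"

primrec insert_tree :: "nat \<Rightarrow> nat ptree \<Rightarrow> nat ptree \<Rightarrow> nat ptree" where
  "insert_tree i S (Leaf k) = Leaf k"
| "insert_tree i S (Node j ts) =
     (let us = map (insert_tree i S) ts
      in if j = i then graft (\<lambda>k. us ! (k - 1)) (shift_vertices i S)
         else Node (shift i (length (vertices S)) j) us)"

definition sOp :: "(nat, nat ptree) operad" where
  "sOp = \<lparr>
     Col = UNIV,
     Ops = {T. distinct (map fst (vertices T)) \<and>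
               set (map fst (vertices T)) = {1..length (vertices T)} \<and>
               distinct (leaf_numbers T) \<and>
               set (leaf_numbers T) = {1..length (leaf_numbers T)}},
     Inp = (\<lambda>T. [the (map_of (vertices T) j). j \<leftarrow> [1..<Suc (length (vertices T))]]),
     Out = (\<lambda>T. length (leaf_numbers T)),
     Unit = (\<lambda>n. Node 1 (map Leaf [1..<Suc n])),
     Comp = (\<lambda>T i S. insert_tree i S T),
     Perm = map_ptree\<rparr>"


section \<open>Free operads and the dendroidal category\<close>

text \<open>A coloured signature: generators with a list of input colours and an output colour.\<close>

record ('c, 'v) signature =
  Colours :: "'c set"
  Gens :: "'v set"
  Ins :: "'v \<Rightarrow> 'c list"
  Outp :: "'v \<Rightarrow> 'c"

text \<open>
  The operations of the free symmetric operad with inputs of colours \<open>cs\<close> are the well-coloured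
  formal composites of generators in which each variable \<open>1, \<dots>, length cs\<close> occurs exactly
  once; a variable is a numbered leaf.
\<close>

primrec root_colour :: "('c, 'v) signature \<Rightarrow> 'c list \<Rightarrow> 'v ptree \<Rightarrow> 'c" where
  "root_colour \<Sigma> cs (Leaf k) = cs ! (k - 1)"
| "root_colour \<Sigma> cs (Node v ts) = Outp \<Sigma> v"

fun well_coloured :: "('c, 'v) signature \<Rightarrow> 'c list \<Rightarrow> 'v ptree \<Rightarrow> bool" where
  "well_coloured \<Sigma> cs (Leaf k) \<longleftrightarrow> True"
| "well_coloured \<Sigma> cs (Node v ts) \<longleftrightarrow>
     v \<in> Gens \<Sigma> \<and> map (root_colour \<Sigma> cs) ts = Ins \<Sigma> v \<and> (\<forall>t\<in>set ts. well_coloured \<Sigma> cs t)"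

definition free_operad :: "('c, 'v) signature \<Rightarrow> ('c, 'c list \<times> 'v ptree) operad" where
  "free_operad \<Sigma> = \<lparr>
     Col = Colours \<Sigma>,
     Ops = {(cs, t). set cs \<subseteq> Colours \<Sigma> \<and> well_coloured \<Sigma> cs t \<and>
                     distinct (leaf_numbers t) \<and> set (leaf_numbers t) = {1..length cs}},
     Inp = fst,
     Out = (\<lambda>(cs, t). root_colour \<Sigma> cs t),
     Unit = (\<lambda>c. ([c], Leaf 1)),
     Comp = (\<lambda>(cs, t) i (ds, s).
       (take (i - 1) cs @ ds @ drop i cs,
        graft (\<lambda>k. if k = i then graft (\<lambda>l. Leaf (i - 1 + l)) s
                   else Leaf (shift i (length ds) k)) t)),
     Perm = (\<lambda>\<sigma> (cs, t).
       ([cs ! (inv \<sigma> k - 1). k \<leftarrow> [1..<Suc (length cs)]], graft (\<lambda>k. Leaf (\<sigma> k)) t))\<rparr>"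

text \<open>
  Finite rooted trees, not planar and with open edges: each vertex has one output edge and a set
  of input edges, leaves are edges that are not the output of a vertex, and the root is the only
  edge that is not an input of a vertex.
\<close>

record ('e, 'v) tree =
  Edges :: "'e set"
  Verts :: "'v set"
  In :: "'v \<Rightarrow> 'e set"
  Outedge :: "'v \<Rightarrow> 'e"
  Root :: 'e

definition finite_rooted_tree :: "('e, 'v) tree \<Rightarrow> bool" where
  "finite_rooted_tree T \<longleftrightarrow>
     finite (Edges T) \<and> finite (Verts T) \<and> Root T \<in> Edges T \<and>
     (\<forall>v\<in>Verts T. In T v \<subseteq> Edges T \<and> Outedge T v \<in> Edges T) \<and>
     inj_on (Outedge T) (Verts T) \<and>
     (\<forall>v\<in>Verts T. Root T \<notin> In T v) \<and>
     (\<forall>e\<in>Edges T. e \<noteq> Root T \<longrightarrow> (\<exists>!v. v \<in> Verts T \<and> e \<in> In T v)) \<and>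
     (\<forall>e\<in>Edges T. (e, Root T) \<in> {(d, Outedge T v) | d v. v \<in> Verts T \<and> d \<in> In T v}\<^sup>*)"

text \<open>
  Each vertex of \<open>T\<close> gives one generator, for which some order of its inputs has to be chosen;
  the other orders are obtained from it by the symmetric groups, so the choice affects the free
  operad only up to isomorphism.
\<close>

definition tree_signature :: "('e, 'v) tree \<Rightarrow> ('e, 'v) signature" where
  "tree_signature T = \<lparr>
     Colours = Edges T,
     Gens = Verts T,
     Ins = (\<lambda>v. SOME es. distinct es \<and> set es = In T v),
     Outp = Outedge T\<rparr>"

definition Omega_operad :: "('e, 'v) tree \<Rightarrow> ('e, 'e list \<times> 'v ptree) operad" where
  "Omega_operad T = free_operad (tree_signature T)"

text \<open>The names of edges and vertices may be taken from any infinite types.\<close>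

type_synonym ('e, 'v) dendroidal_category =
  "(('e, 'e list \<times> 'v ptree) operad, ('e, 'e list \<times> 'v ptree) operad_arrow) category"

definition Omega :: "('e::infinite, 'v::infinite) dendroidal_category" where
  "Omega = full_subcategory Operads {Omega_operad T | T. finite_rooted_tree T}"

end

theory Submission
  imports Defs "HOL-Library.Countable" "HOL-Library.Multiset"
begin

text \<open>
  A twisted arrow with source \<open>p\<close> is a tree \<open>A 0\<close> with one distinguished vertex, labelled \<open>0\<close>, and for
  each vertex \<open>j\<close> of \<open>p\<close> a tree \<open>A j\<close>; the numbers given by \<open>\<lambda>\<close> become vertex labels.  In these terms
  targets and composites are iterated substitutions of trees into vertices, which satisfy the laws
  of a monad, and all renumbering disappears.

  The edges of a tree \<open>p\<close> are its subtrees.  An arrow \<open>p \<rightarrow> t\<close> sends the subtree \<open>s\<close> to the subtree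
  of \<open>t\<close> that the substitution makes of \<open>s\<close>.  The trees \<open>A j\<close> are then cut out of \<open>t\<close> by the images
  of the edges around \<open>j\<close>, so that arrows correspond to the maps of edges that send the input edges
  of every vertex injectively onto the leaves of a subtree of \<open>t\<close> above the image of its output edge.

  In the free operad on a tree an operation is determined by its inputs and its output, and it
  exists exactly if the inputs are the leaves of a subtree with the output as root.  Hence a
  morphism of dendrices is determined by its map of colours, which is a map of edges of the same
  kind.  This gives a fully faithful functor; it is essentially surjective because every rooted
  tree has a planar structure.
\<close>

text \<open>Three obstacles shape the details. First, a full composite in \<open>sOp\<close> is an
  iterated partial composition that shifts vertex numbers at each insertion, and composites in
  \<open>Tw\<close> are sorted afterwards; relabelling by the values of \<open>\<lambda>\<close>
  undoes both, so families of labelled trees and twisted arrows are compared through ranks. The mark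
  \<open>0\<close> is free because vertices are numbered from \<open>1\<close>, and being least it
  stays first under sorting. Second, a subtree is a value and not a position; it names an edge only
  because vertices and leaves carry distinct numbers. Unary vertices can be erased and vertices
  without inputs exist, so edge maps are injective only among the inputs of one vertex, and cuts can
  be empty. Third, the lower tree \<open>A 0\<close> is not cut out by the edges around a vertex of
  \<open>p\<close>: it is recovered from the place in \<open>t\<close> of the image of the root of
  \<open>p\<close>, together with the images of the leaves of \<open>p\<close>, which are the inputs
  of the marked vertex. The category laws of \<open>Tw sOp\<close> are never computed; they are
  inherited from \<open>Omega\<close> by faithfulness.\<close>

section \<open>Equivalences from fully faithful, essentially surjective functors\<close>

text \<open>The unit and associativity laws of \<open>C\<close> hold after applying
  \<open>Fa\<close>, hence in \<open>C\<close> by faithfulness; so only \<open>D\<close> is assumed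
  to be a category.\<close>

lemma equivalent_categoriesI:
  fixes C :: "('o, 'a) category" and D :: "('p, 'b) category"
  assumes D: "is_category D"
    and ob: "\<And>x. x \<in> Ob C \<Longrightarrow> Fo x \<in> Ob D \<and> Ide C x \<in> Ar C \<and> Dom C (Ide C x) = x \<and>
      Cod C (Ide C x) = x \<and> Fa (Ide C x) = Ide D (Fo x)"
    and ar: "\<And>f. f \<in> Ar C \<Longrightarrow> Dom C f \<in> Ob C \<and> Cod C f \<in> Ob C \<and> Fa f \<in> Ar D \<and>
      Dom D (Fa f) = Fo (Dom C f) \<and> Cod D (Fa f) = Fo (Cod C f)"
    and cmp: "\<And>f g. f \<in> Ar C \<Longrightarrow> g \<in> Ar C \<Longrightarrow> Cod C f = Dom C g \<Longrightarrow>
      Cmp C g f \<in> Ar C \<and> Dom C (Cmp C g f) = Dom C f \<and> Cod C (Cmp C g f) = Cod C g \<and>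
      Fa (Cmp C g f) = Cmp D (Fa g) (Fa f)"
    and faithful: "\<And>f g. f \<in> Ar C \<Longrightarrow> g \<in> Ar C \<Longrightarrow> Dom C f = Dom C g \<Longrightarrow>
      Cod C f = Cod C g \<Longrightarrow> Fa f = Fa g \<Longrightarrow> f = g"
    and full: "\<And>x y h. x \<in> Ob C \<Longrightarrow> y \<in> Ob C \<Longrightarrow> h \<in> Ar D \<Longrightarrow> Dom D h = Fo x \<Longrightarrow>
      Cod D h = Fo y \<Longrightarrow> \<exists>f\<in>Ar C. Dom C f = x \<and> Cod C f = y \<and> Fa f = h"
    and ess: "\<And>y. y \<in> Ob D \<Longrightarrow> \<exists>x\<in>Ob C. \<exists>i. is_iso D i \<and> Dom D i = Fo x \<and> Cod D i = y"
  shows "equivalent_categories C D"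
proof -
  have D_ob: "\<And>f. f \<in> Ar D \<Longrightarrow> Dom D f \<in> Ob D \<and> Cod D f \<in> Ob D"
    and D_id: "\<And>x. x \<in> Ob D \<Longrightarrow> Ide D x \<in> Ar D \<and> Dom D (Ide D x) = x \<and> Cod D (Ide D x) = x"
    and D_cmp: "\<And>f g. f \<in> Ar D \<Longrightarrow> g \<in> Ar D \<Longrightarrow> Cod D f = Dom D g \<Longrightarrow>
        Cmp D g f \<in> Ar D \<and> Dom D (Cmp D g f) = Dom D f \<and> Cod D (Cmp D g f) = Cod D g"
    and D_unit: "\<And>f. f \<in> Ar D \<Longrightarrow> Cmp D f (Ide D (Dom D f)) = f \<and> Cmp D (Ide D (Cod D f)) f = f"
    and D_assoc: "\<And>f g h. f \<in> Ar D \<Longrightarrow> g \<in> Ar D \<Longrightarrow> h \<in> Ar D \<Longrightarrow> Cod D f = Dom D g \<Longrightarrow>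
        Cod D g = Dom D h \<Longrightarrow> Cmp D h (Cmp D g f) = Cmp D (Cmp D h g) f"
    using D unfolding is_category_def by blast+
  have C: "is_category C"
    unfolding is_category_def
  proof (intro conjI ballI impI)
    fix f assume f: "f \<in> Ar C"
    show "Cmp C f (Ide C (Dom C f)) = f"
      by (rule faithful) (use f ar[OF f] ob cmp D_unit[of "Fa f"] in auto)
    show "Cmp C (Ide C (Cod C f)) f = f"
      by (rule faithful) (use f ar[OF f] ob cmp D_unit[of "Fa f"] in auto)
  next
    fix f g h assume fgh: "f \<in> Ar C" "g \<in> Ar C" "h \<in> Ar C" "Cod C f = Dom C g \<and> Cod C g = Dom C h"
    show "Cmp C h (Cmp C g f) = Cmp C (Cmp C h g) f"
      by (rule faithful) (use fgh ar ob cmp D_assoc in auto)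
  qed (use ob ar cmp in auto)
  have F: "is_functor C D Fo Fa"
    unfolding is_functor_def using ob ar cmp by auto
  obtain Go \<epsilon> where Go: "\<And>y. y \<in> Ob D \<Longrightarrow> Go y \<in> Ob C \<and> is_iso D (\<epsilon> y) \<and>
      Dom D (\<epsilon> y) = Fo (Go y) \<and> Cod D (\<epsilon> y) = y"
    using ess by metis
  have "\<exists>g\<in>Ar D. Dom D g = y \<and> Cod D g = Fo (Go y) \<and>
      Cmp D g (\<epsilon> y) = Ide D (Fo (Go y)) \<and> Cmp D (\<epsilon> y) g = Ide D y" if "y \<in> Ob D" for y
    using Go[OF that] unfolding is_iso_def by auto
  then obtain \<delta> where \<delta>: "\<And>y. y \<in> Ob D \<Longrightarrow> \<delta> y \<in> Ar D \<and> Dom D (\<delta> y) = y \<and> Cod D (\<delta> y) = Fo (Go y) \<and>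
      Cmp D (\<delta> y) (\<epsilon> y) = Ide D (Fo (Go y)) \<and> Cmp D (\<epsilon> y) (\<delta> y) = Ide D y"
    by metis
  have \<epsilon>: "\<epsilon> y \<in> Ar D" if "y \<in> Ob D" for y
    using Go[OF that] by (auto simp: is_iso_def)
  \<comment> \<open>By faithfulness a preimage is unique within its hom-set, so choosing one arrow
    at a time still yields a functor.\<close>
  define lift where "lift x y h = (SOME f. f \<in> Ar C \<and> Dom C f = x \<and> Cod C f = y \<and> Fa f = h)" for x y h
  have lift: "lift x y h \<in> Ar C \<and> Dom C (lift x y h) = x \<and> Cod C (lift x y h) = y \<and> Fa (lift x y h) = h"
    if "x \<in> Ob C" "y \<in> Ob C" "h \<in> Ar D" "Dom D h = Fo x" "Cod D h = Fo y" for x y h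
    unfolding lift_def by (rule someI_ex) (use full[OF that] in blast)
  \<comment> \<open>The isomorphisms \<open>\<epsilon>\<close> conjugate \<open>h\<close> into an
    arrow between objects in the image of \<open>Fo\<close>, where fullness applies;
    \<open>mid h\<close> will be the image of \<open>Ga h\<close>.\<close>
  define mid where "mid h = Cmp D (\<delta> (Cod D h)) (Cmp D h (\<epsilon> (Dom D h)))" for h
  have mid: "mid h \<in> Ar D \<and> Dom D (mid h) = Fo (Go (Dom D h)) \<and> Cod D (mid h) = Fo (Go (Cod D h))"
    if "h \<in> Ar D" for h
    using D_ob[OF that] that D_cmp \<epsilon> Go \<delta> unfolding mid_def by simp
  define Ga where "Ga h = lift (Go (Dom D h)) (Go (Cod D h)) (mid h)" for h
  have Ga: "Ga h \<in> Ar C \<and> Dom C (Ga h) = Go (Dom D h) \<and> Cod C (Ga h) = Go (Cod D h) \<and> Fa (Ga h) = mid h"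
    if "h \<in> Ar D" for h
    unfolding Ga_def by (rule lift) (use D_ob[OF that] mid[OF that] Go in auto)
  have mid_id: "mid (Ide D y) = Ide D (Fo (Go y))" if y: "y \<in> Ob D" for y
    using y D_id[OF y] \<delta>[OF y] D_unit[OF \<epsilon>[OF y]] Go[OF y] unfolding mid_def by simp
  have mid_cmp: "mid (Cmp D k h) = Cmp D (mid k) (mid h)"
    if h: "h \<in> Ar D" and k: "k \<in> Ar D" and hk: "Cod D h = Dom D k" for h k
  proof -
    note obs = D_ob[OF h] D_ob[OF k]
    let ?x = "Dom D h" and ?y = "Dom D k" and ?z = "Cod D k"
    have eps: "\<epsilon> ?x \<in> Ar D" "\<epsilon> ?y \<in> Ar D" "Cod D (\<epsilon> ?x) = ?x" "Cod D (\<epsilon> ?y) = ?y"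
       "Dom D (\<epsilon> ?y) = Fo (Go ?y)" "Dom D (\<epsilon> ?x) = Fo (Go ?x)"
      and del: "\<delta> ?y \<in> Ar D" "\<delta> ?z \<in> Ar D" "Dom D (\<delta> ?y) = ?y" "Cod D (\<delta> ?y) = Fo (Go ?y)"
       "Dom D (\<delta> ?z) = ?z" "Cod D (\<delta> ?z) = Fo (Go ?z)" "Cmp D (\<epsilon> ?y) (\<delta> ?y) = Ide D ?y"
      using obs \<epsilon> \<delta> Go by auto
    \<comment> \<open>The inner factors \<open>\<epsilon> ?y\<close> and \<open>\<delta> ?y\<close>
      cancel after reassociation.\<close>
    have "Cmp D (mid k) (mid h) =
        Cmp D (\<delta> ?z) (Cmp D (Cmp D k (\<epsilon> ?y)) (Cmp D (\<delta> ?y) (Cmp D h (\<epsilon> ?x))))"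
      unfolding mid_def hk by (simp add: D_assoc D_cmp eps del h k hk)
    also have "Cmp D (Cmp D k (\<epsilon> ?y)) (Cmp D (\<delta> ?y) (Cmp D h (\<epsilon> ?x)))
        = Cmp D (Cmp D (Cmp D k (\<epsilon> ?y)) (\<delta> ?y)) (Cmp D h (\<epsilon> ?x))"
      by (rule D_assoc) (simp_all add: D_cmp eps del h k hk)
    also have "Cmp D (Cmp D k (\<epsilon> ?y)) (\<delta> ?y) = Cmp D k (Cmp D (\<epsilon> ?y) (\<delta> ?y))"
      by (rule D_assoc[symmetric]) (simp_all add: D_cmp eps del h k hk)
    also have "\<dots> = k"
      using D_unit[OF k] by (simp add: del)
    also have "Cmp D k (Cmp D h (\<epsilon> ?x)) = Cmp D (Cmp D k h) (\<epsilon> ?x)"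
      by (rule D_assoc) (simp_all add: D_cmp eps del h k hk)
    finally show ?thesis
      by (simp add: mid_def D_cmp h k hk)
  qed
  have G: "is_functor D C Go Ga"
    unfolding is_functor_def
  proof (intro conjI ballI impI)
    fix y assume y: "y \<in> Ob D"
    show "Ga (Ide D y) = Ide C (Go y)"
      by (rule faithful) (use y Ga D_id[OF y] Go[OF y] ob[of "Go y"] mid_id in auto)
  next
    fix h k assume hk: "h \<in> Ar D" "k \<in> Ar D" "Cod D h = Dom D k"
    show "Ga (Cmp D k h) = Cmp C (Ga k) (Ga h)"
      by (rule faithful) (use hk Ga D_cmp[OF hk] cmp mid_cmp in auto)
  qed (use Ga Go in auto)
  have isoC: "is_iso C (lift x y h)"
    if "x \<in> Ob C" "y \<in> Ob C" "h \<in> Ar D" "Dom D h = Fo x" "Cod D h = Fo y"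
      "k \<in> Ar D" "Dom D k = Fo y" "Cod D k = Fo x"
      "Cmp D k h = Ide D (Fo x)" "Cmp D h k = Ide D (Fo y)" for x y h k
  proof -
    have l: "lift x y h \<in> Ar C \<and> Dom C (lift x y h) = x \<and> Cod C (lift x y h) = y \<and> Fa (lift x y h) = h"
      "lift y x k \<in> Ar C \<and> Dom C (lift y x k) = y \<and> Cod C (lift y x k) = x \<and> Fa (lift y x k) = k"
      using lift that by auto
    have "Cmp C (lift y x k) (lift x y h) = Ide C x" "Cmp C (lift x y h) (lift y x k) = Ide C y"
      by (rule faithful; use l cmp ob[of x] ob[of y] that in auto)+
    then show ?thesis
      unfolding is_iso_def using l by auto
  qed
  \<comment> \<open>The unit is the lift of \<open>\<delta>\<close>, the inverse of
    \<open>\<epsilon>\<close>; its naturality is checked after applying \<open>Fa\<close>.\<close>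
  define \<eta> where "\<eta> x = lift x (Go (Fo x)) (\<delta> (Fo x))" for x
  have \<eta>: "\<eta> x \<in> Ar C \<and> Dom C (\<eta> x) = x \<and> Cod C (\<eta> x) = Go (Fo x) \<and> Fa (\<eta> x) = \<delta> (Fo x)"
    if "x \<in> Ob C" for x
    unfolding \<eta>_def by (rule lift) (use that ob[OF that] \<delta> Go in auto)
  have "is_natural_iso C C id id (Go \<circ> Fo) (Ga \<circ> Fa) \<eta>"
    unfolding is_natural_iso_def
  proof (intro conjI ballI)
    fix x assume x: "x \<in> Ob C"
    show "is_iso C (\<eta> x)"
      unfolding \<eta>_def by (rule isoC[where k = "\<epsilon> (Fo x)"]) (use x ob[OF x] \<delta> Go \<epsilon> in auto)
    show "Dom C (\<eta> x) = id x" "Cod C (\<eta> x) = (Go \<circ> Fo) x"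
      using \<eta>[OF x] by auto
  next
    fix f assume f: "f \<in> Ar C"
    note fa = ar[OF f]
    let ?x = "Dom C f" and ?y = "Cod C f"
    have "Cmp D (mid (Fa f)) (\<delta> (Fo ?x)) = Cmp D (\<delta> (Fo ?y)) (Fa f)"
    proof -
      have eps: "\<epsilon> (Fo ?x) \<in> Ar D" "Cod D (\<epsilon> (Fo ?x)) = Fo ?x" "Dom D (\<epsilon> (Fo ?x)) = Fo (Go (Fo ?x))"
        and del: "\<delta> (Fo ?x) \<in> Ar D" "\<delta> (Fo ?y) \<in> Ar D" "Dom D (\<delta> (Fo ?x)) = Fo ?x"
         "Cod D (\<delta> (Fo ?x)) = Fo (Go (Fo ?x))" "Dom D (\<delta> (Fo ?y)) = Fo ?y"
         "Cmp D (\<epsilon> (Fo ?x)) (\<delta> (Fo ?x)) = Ide D (Fo ?x)"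
        using fa ob \<epsilon> \<delta> Go by auto
      have "Cmp D (mid (Fa f)) (\<delta> (Fo ?x)) =
          Cmp D (\<delta> (Fo ?y)) (Cmp D (Fa f) (Cmp D (\<epsilon> (Fo ?x)) (\<delta> (Fo ?x))))"
        unfolding mid_def using fa by (simp add: D_assoc D_cmp eps del del(6)[symmetric] del: del(6))
      also have "\<dots> = Cmp D (\<delta> (Fo ?y)) (Fa f)"
        using fa D_unit[of "Fa f"] by (simp add: del)
      finally show ?thesis .
    qed
    then show "Cmp C ((Ga \<circ> Fa) f) (\<eta> (Dom C f)) = Cmp C (\<eta> (Cod C f)) (id f)"
      by (intro faithful) (use f fa \<eta> Ga cmp in auto)
  qed
  moreover have "is_natural_iso D D (Fo \<circ> Go) (Fa \<circ> Ga) id id \<epsilon>"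
    unfolding is_natural_iso_def
  proof (intro conjI ballI)
    fix h assume h: "h \<in> Ar D"
    let ?x = "Dom D h" and ?y = "Cod D h"
    have "Cmp D (\<epsilon> ?y) (mid h) = Cmp D (Cmp D (\<epsilon> ?y) (\<delta> ?y)) (Cmp D h (\<epsilon> ?x))"
      unfolding mid_def using D_ob[OF h] h \<epsilon> \<delta> Go D_cmp by (subst D_assoc) auto
    also have "\<dots> = Cmp D h (\<epsilon> ?x)"
      using D_ob[OF h] h \<epsilon> \<delta> Go D_cmp[of "\<epsilon> ?x" h] D_unit[of "Cmp D h (\<epsilon> ?x)"] by auto
    finally show "Cmp D (id h) (\<epsilon> (Dom D h)) = Cmp D (\<epsilon> (Cod D h)) ((Fa \<circ> Ga) h)"
      using Ga[OF h] by simp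
  qed (use Go in auto)
  ultimately show ?thesis
    unfolding equivalent_categories_def using C D F G by blast
qed

section \<open>Substitution of trees into vertices\<close>

lemma distinct_concat_map:
  assumes "distinct xs" "\<And>x. x \<in> set xs \<Longrightarrow> distinct (f x)"
    and "\<And>x y z. x \<in> set xs \<Longrightarrow> y \<in> set xs \<Longrightarrow> z \<in> set (f x) \<Longrightarrow> z \<in> set (f y) \<Longrightarrow> x = y"
  shows "distinct (concat (map f xs))"
  using assms
proof (induction xs)
  case (Cons x xs)
  have "z \<notin> set (concat (map f xs))" if "z \<in> set (f x)" for z
    using Cons.prems(1) Cons.prems(3)[of x _ z] that by auto
  then show ?case
    using Cons by auto
qed simp

abbreviation labels :: "'v ptree \<Rightarrow> 'v list" where
  "labels t \<equiv> map fst (vertices t)"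

definition corolla :: "'v \<Rightarrow> nat \<Rightarrow> 'v ptree" where
  "corolla v n = Node v (map Leaf [1..<Suc n])"

text \<open>Filling all vertices simultaneously avoids the index shifts of
  \<open>insert_tree\<close>. The number of inputs is passed to \<open>h\<close> so that
  \<open>corolla\<close> is itself such an \<open>h\<close>, namely the unit of the monad. Leaves
  are numbered from \<open>1\<close>, hence the index \<open>k - 1\<close>.\<close>

primrec subst :: "('v \<Rightarrow> nat \<Rightarrow> 'w ptree) \<Rightarrow> 'v ptree \<Rightarrow> 'w ptree" where
  "subst h (Leaf k) = Leaf k"
| "subst h (Node v ts) = graft (\<lambda>k. map (subst h) ts ! (k - 1)) (h v (length ts))"

text \<open>The condition for \<open>a\<close> to fit into a vertex with \<open>n\<close> inputs. As
  an equation of multisets it is inherited by every tree with the same multiset of leaves.\<close>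

definition proper :: "nat \<Rightarrow> 'v ptree \<Rightarrow> bool" where
  "proper n a \<longleftrightarrow> mset (leaf_numbers a) = mset [1..<Suc n]"

lemma proper_set: "proper n a \<Longrightarrow> set (leaf_numbers a) = {1..n}"
  unfolding proper_def by (metis atLeastLessThanSuc_atLeastAtMost set_mset_mset set_upt)

lemma proper_iff: "proper n a \<longleftrightarrow> distinct (leaf_numbers a) \<and> set (leaf_numbers a) = {1..n}"
  unfolding proper_def
  by (metis atLeastLessThanSuc_atLeastAtMost distinct_upt mset_eq_imp_distinct_iff
      set_eq_iff_mset_eq_distinct set_mset_mset set_upt)

lemma proper_length: "proper n a \<Longrightarrow> length (leaf_numbers a) = n"
  unfolding proper_def by (metis diff_Suc_1 length_upt size_mset)

lemma leaf_numbers_corolla [simp]: "leaf_numbers (corolla v n) = [1..<Suc n]"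
  by (simp add: corolla_def comp_def)

lemma proper_corolla [simp]: "proper n (corolla v n)"
  by (simp add: proper_def del: upt_Suc)

lemma vertices_corolla [simp]: "vertices (corolla v n) = [(v, n)]"
  by (simp add: corolla_def comp_def del: upt_Suc)

lemma map_ptree_corolla [simp]: "map_ptree f (corolla v n) = corolla (f v) n"
  by (simp add: corolla_def del: upt_Suc)

lemma leaf_numbers_graft:
  "leaf_numbers (graft k t) = concat (map (\<lambda>l. leaf_numbers (k l)) (leaf_numbers t))"
proof (induction t)
  case (Node v ts)
  then show ?case
    by (induction ts) auto
qed simp

lemma graft_cong:
  "(\<And>k. k \<in> set (leaf_numbers t) \<Longrightarrow> h k = h' k) \<Longrightarrow> graft h t = graft h' t"
  by (induction t) auto

lemma graft_graft: "graft h (graft k t) = graft (\<lambda>l. graft h (k l)) t"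
  by (induction t) auto

lemma graft_Leaf [simp]: "graft Leaf t = t"
  by (induction t) (auto intro: map_idI)

lemma graft_id: "(\<And>k. k \<in> set (leaf_numbers t) \<Longrightarrow> h k = Leaf k) \<Longrightarrow> graft h t = t"
  using graft_cong[of t h Leaf] by simp

lemma graft_corolla: "graft h (corolla v n) = Node v (map h [1..<Suc n])"
  by (simp add: corolla_def comp_def del: upt_Suc)

lemma map_nth_pred: "map (\<lambda>k. us ! (k - 1)) [1..<Suc (length us)] = us"
  by (rule nth_equalityI) (auto simp: nth_append simp del: upt_Suc)

lemma graft_nth_corolla [simp, unfolded One_nat_def, simp]:
  "length us = n \<Longrightarrow> graft (\<lambda>k. us ! (k - 1)) (corolla v n) = Node v us"
  by (auto simp only: graft_corolla map_nth_pred)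

lemma child_vertices:
  "t \<in> set ts \<Longrightarrow> x \<in> set (vertices t) \<Longrightarrow> x \<in> set (vertices (Node v ts))"
  by auto

lemma subst_cong:
  "(\<And>v n. (v, n) \<in> set (vertices t) \<Longrightarrow> h v n = h' v n) \<Longrightarrow> subst h t = subst h' t"
proof (induction t)
  case (Node v ts)
  have "map (subst h) ts = map (subst h') ts"
  proof (rule map_cong[OF refl])
    fix t assume t: "t \<in> set ts"
    show "subst h t = subst h' t"
      by (rule Node.IH[OF t], rule Node.prems[OF child_vertices[OF t]])
  qed
  moreover have "h v (length ts) = h' v (length ts)"
    using Node.prems by simp
  ultimately show ?case
    by (simp only: subst.simps)
qed simp

lemma subst_corolla_id [simp]: "subst corolla t = t"
  by (induction t) (auto simp: map_idI cong: map_cong)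

lemma subst_id:
  "(\<And>v n. (v, n) \<in> set (vertices t) \<Longrightarrow> h v n = corolla v n) \<Longrightarrow> subst h t = t"
  using subst_cong[of t h corolla] by simp

lemma map_ptree_eq_subst: "map_ptree f t = subst (\<lambda>v. corolla (f v)) t"
  by (induction t) (auto cong: map_cong)

lemma subst_corolla: "set (leaf_numbers (h v n)) \<subseteq> {1..n} \<Longrightarrow> subst h (corolla v n) = h v n"
  by (simp add: corolla_def del: upt_Suc) (rule graft_id, auto simp del: upt_Suc simp: subset_iff)

text \<open>The hypothesis keeps each index \<open>l - 1\<close> inside the list of children, where
  mapping and indexing commute. The same bound recurs in the laws below.\<close>

lemma subst_graft:
  assumes "\<And>v n. (v, n) \<in> set (vertices t) \<Longrightarrow> set (leaf_numbers (h v n)) \<subseteq> {1..n}"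
  shows "subst h (graft k t) = graft (\<lambda>l. subst h (k l)) (subst h t)"
  using assms
proof (induction t)
  case (Node v ts)
  have "set (leaf_numbers (h v (length ts))) \<subseteq> {1..length ts}"
    using Node.prems by simp
  moreover have "subst h (graft k t) = graft (\<lambda>l. subst h (k l)) (subst h t)" if "t \<in> set ts" for t
    by (rule Node.IH[OF that], rule Node.prems[OF child_vertices[OF that]])
  ultimately have "map (\<lambda>t. subst h (graft k t)) ts ! (i - 1) =
      graft (\<lambda>l. subst h (k l)) (map (subst h) ts ! (i - 1))"
    if "i \<in> set (leaf_numbers (h v (length ts)))" for i
    using that by (auto simp: subset_iff)
  then have "graft (\<lambda>i. map (\<lambda>t. subst h (graft k t)) ts ! (i - 1)) (h v (length ts)) =
      graft (\<lambda>i. graft (\<lambda>l. subst h (k l)) (map (subst h) ts ! (i - 1))) (h v (length ts))"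
    by (rule graft_cong)
  then show ?case
    by (simp add: graft_graft comp_def)
qed simp

text \<open>Associativity of the substitution monad; \<open>subst_corolla_id\<close> and
  \<open>subst_corolla\<close> are its unit laws.\<close>

lemma subst_subst:
  assumes "\<And>v n. (v, n) \<in> set (vertices t) \<Longrightarrow> set (leaf_numbers (h v n)) \<subseteq> {1..n}"
    and "\<And>v n w m. (v, n) \<in> set (vertices t) \<Longrightarrow> (w, m) \<in> set (vertices (h v n)) \<Longrightarrow>
      set (leaf_numbers (g w m)) \<subseteq> {1..m}"
  shows "subst g (subst h t) = subst (\<lambda>v n. subst g (h v n)) t"
  using assms
proof (induction t)
  case (Node v ts)
  let ?n = "length ts"
  have leaves: "set (leaf_numbers (subst g (h v ?n))) \<subseteq> {1..?n}"
    if "set (leaf_numbers (subst g (h v ?n))) \<subseteq> set (leaf_numbers (h v ?n))"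
    using that Node.prems(1)[of v ?n] by auto
  have IH: "subst g (subst h t) = subst (\<lambda>v n. subst g (h v n)) t" if "t \<in> set ts" for t
    by (rule Node.IH[OF that], rule Node.prems(1)[OF child_vertices[OF that]], assumption,
        rule Node.prems(2)[OF child_vertices[OF that]])
  \<comment> \<open>Substitution creates no new leaf numbers, so the leaves of
    \<open>subst g (h v ?n)\<close> still index children of \<open>v\<close>.\<close>
  have sub: "set (leaf_numbers (subst g s)) \<subseteq> set (leaf_numbers s)"
    if "\<And>w m. (w, m) \<in> set (vertices s) \<Longrightarrow> set (leaf_numbers (g w m)) \<subseteq> {1..m}" for s
    using that
  proof (induction s)
    case (Node w us)
    have "set (leaf_numbers (subst g u)) \<subseteq> set (leaf_numbers u)" if "u \<in> set us" for u
      by (rule Node.IH[OF that], rule Node.prems[OF child_vertices[OF that]])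
    moreover have "l - 1 < length us" if "l \<in> set (leaf_numbers (g w (length us)))" for l
      using Node.prems[of w "length us"] that by fastforce
    ultimately have "set (leaf_numbers (map (subst g) us ! (l - 1))) \<subseteq> set (leaf_numbers (Node w us))"
      if "l \<in> set (leaf_numbers (g w (length us)))" for l
      using that by (auto simp: subset_iff) (metis nth_mem)
    then show ?case
      by (auto simp: leaf_numbers_graft)
  qed simp
  have "graft (\<lambda>k. subst g (map (subst h) ts ! (k - 1))) (subst g (h v ?n))
      = graft (\<lambda>k. map (subst (\<lambda>v n. subst g (h v n))) ts ! (k - 1)) (subst g (h v ?n))"
  proof (rule graft_cong)
    fix k assume "k \<in> set (leaf_numbers (subst g (h v ?n)))"
    then have "k - 1 < ?n"
      using leaves sub[of "h v ?n"] Node.prems(2)[of v ?n] by fastforce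
    then show "subst g (map (subst h) ts ! (k - 1)) = map (subst (\<lambda>v n. subst g (h v n))) ts ! (k - 1)"
      using IH by simp
  qed
  moreover have "subst g (graft k (h v ?n)) = graft (\<lambda>l. subst g (k l)) (subst g (h v ?n))" for k
    using Node.prems(2)[of v ?n] by (intro subst_graft) simp
  ultimately show ?case
    by simp
qed simp

lemma mset_concat_map: "mset (concat (map f xs)) = (\<Sum>x\<in>#mset xs. mset (f x))"
  by (induction xs) auto

lemma mset_vertices_graft:
  "mset (vertices (graft k t)) =
    mset (vertices t) + (\<Sum>l\<in>#mset (leaf_numbers t). mset (vertices (k l)))"
proof (induction t)
  case (Node v ts)
  have "(\<Sum>t\<in>#mset ts. mset (vertices (graft k t))) = (\<Sum>t\<in>#mset ts. mset (vertices t)) +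
     (\<Sum>t\<in>#mset ts. \<Sum>l\<in>#mset (leaf_numbers t). mset (vertices (k l)))"
    using Node by (induction ts) (auto simp: ac_simps)
  moreover have "(\<Sum>l\<in>#mset (concat (map leaf_numbers ts)). mset (vertices (k l))) =
     (\<Sum>t\<in>#mset ts. \<Sum>l\<in>#mset (leaf_numbers t). mset (vertices (k l)))"
    by (induction ts) auto
  ultimately show ?case
    by (simp add: mset_concat_map comp_def image_mset.compositionality)
qed simp

text \<open>The leaves of a proper tree run once through \<open>1\<close>, ..., \<open>n\<close>, so
  grafting along them uses each child exactly once.\<close>

lemma sum_proper_nth:
  assumes "proper (length us) a"
  shows "(\<Sum>l\<in>#mset (leaf_numbers a). F (us ! (l - 1))) = (\<Sum>u\<in>#mset us. (F u :: 'x :: comm_monoid_add))"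
proof -
  have "(\<Sum>l\<in>#mset (leaf_numbers a). F (us ! (l - 1))) =
      sum_mset (mset (map F (map (\<lambda>k. us ! (k - 1)) [1..<Suc (length us)])))"
    using assms by (simp add: proper_def comp_def del: upt_Suc)
  then show ?thesis
    by (simp only: map_nth_pred mset_map)
qed

text \<open>Each child survives exactly once by \<open>sum_proper_nth\<close>, so leaves are at most
  reordered.\<close>

lemma mset_leaves_subst:
  assumes "\<And>v n. (v, n) \<in> set (vertices t) \<Longrightarrow> proper n (h v n)"
  shows "mset (leaf_numbers (subst h t)) = mset (leaf_numbers t)"
  using assms
proof (induction t)
  case (Node v ts)
  have IH: "mset (leaf_numbers (subst h t)) = mset (leaf_numbers t)" if "t \<in> set ts" for t
    by (rule Node.IH[OF that], rule Node.prems[OF child_vertices[OF that]])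
  have p: "proper (length ts) (h v (length ts))"
    using Node.prems by simp
  have "mset (leaf_numbers (subst h (Node v ts))) =
     (\<Sum>l\<in>#mset (leaf_numbers (h v (length ts))). mset (leaf_numbers (map (subst h) ts ! (l - 1))))"
    by (simp add: leaf_numbers_graft mset_concat_map)
  also have "\<dots> = (\<Sum>u\<in>#mset (map (subst h) ts). mset (leaf_numbers u))"
    by (rule sum_proper_nth) (use p in simp)
  also have "\<dots> = (\<Sum>u\<in>#mset ts. mset (leaf_numbers u))"
    using IH by (induction ts) auto
  finally show ?case
    by (simp add: mset_concat_map)
qed simp

lemma proper_subst:
  assumes "\<And>v n. (v, n) \<in> set (vertices t) \<Longrightarrow> proper n (h v n)"
  shows "proper n (subst h t) \<longleftrightarrow> proper n t"
  unfolding proper_def by (simp add: mset_leaves_subst assms)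

text \<open>Counting with multiplicity is what later shows that the labels of a target are
  \<open>1\<close>, ..., \<open>N\<close> without repetition.\<close>

lemma mset_vertices_subst:
  assumes "\<And>v n. (v, n) \<in> set (vertices t) \<Longrightarrow> proper n (h v n)"
  shows "mset (vertices (subst h t)) = (\<Sum>(v, n)\<in>#mset (vertices t). mset (vertices (h v n)))"
  using assms
proof (induction t)
  case (Node v ts)
  have IH: "mset (vertices (subst h t)) = (\<Sum>(v, n)\<in>#mset (vertices t). mset (vertices (h v n)))"
    if "t \<in> set ts" for t
    by (rule Node.IH[OF that], rule Node.prems[OF child_vertices[OF that]])
  have p: "proper (length ts) (h v (length ts))"
    using Node.prems by simp
  have "mset (vertices (subst h (Node v ts))) = mset (vertices (h v (length ts))) +
     (\<Sum>l\<in>#mset (leaf_numbers (h v (length ts))). mset (vertices (map (subst h) ts ! (l - 1))))"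
    by (simp add: mset_vertices_graft)
  also have "(\<Sum>l\<in>#mset (leaf_numbers (h v (length ts))). mset (vertices (map (subst h) ts ! (l - 1))))
     = (\<Sum>u\<in>#mset (map (subst h) ts). mset (vertices u))"
    by (rule sum_proper_nth) (use p in simp)
  also have "\<dots> = (\<Sum>u\<in>#mset ts. \<Sum>(v, n)\<in>#mset (vertices u). mset (vertices (h v n)))"
    using IH by (induction ts) auto
  also have "\<dots> = (\<Sum>(v, n)\<in>#mset (concat (map vertices ts)). mset (vertices (h v n)))"
    by (induction ts) auto
  finally show ?case
    by simp
qed simp

lemma leaf_numbers_map_ptree [simp]: "leaf_numbers (map_ptree f t) = leaf_numbers t"
  by (induction t) (auto simp: comp_def intro!: arg_cong[of _ _ concat])

lemma vertices_map_ptree: "vertices (map_ptree f t) = map (map_prod f id) (vertices t)"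
  by (induction t) (auto simp: comp_def map_concat intro!: arg_cong[of _ _ concat])

lemma labels_map_ptree [simp]: "labels (map_ptree f t) = map f (labels t)"
  by (simp add: vertices_map_ptree)

lemma proper_map_ptree [simp]: "proper n (map_ptree f t) = proper n t"
  by (simp add: proper_def)

lemma map_ptree_cong_labels:
  "(\<And>v. v \<in> set (labels t) \<Longrightarrow> f v = g v) \<Longrightarrow> map_ptree f t = map_ptree g t"
  by (simp add: map_ptree_eq_subst) (rule subst_cong, force)

lemma map_ptree_idI: "(\<And>v. v \<in> set (labels t) \<Longrightarrow> f v = v) \<Longrightarrow> map_ptree f t = t"
  using map_ptree_cong_labels[of t f id] by (simp add: ptree.map_id0)

lemma map_ptree_comp: "map_ptree f (map_ptree g t) = map_ptree (\<lambda>v. f (g v)) t"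
  by (simp add: ptree.map_comp comp_def)

lemma map_ptree_subst:
  assumes "\<And>v n. (v, n) \<in> set (vertices t) \<Longrightarrow> set (leaf_numbers (h v n)) \<subseteq> {1..n}"
  shows "map_ptree f (subst h t) = subst (\<lambda>v n. map_ptree f (h v n)) t"
  unfolding map_ptree_eq_subst by (rule subst_subst) (use assms in auto)

lemma subst_map_ptree:
  assumes "\<And>v n. (v, n) \<in> set (vertices t) \<Longrightarrow> set (leaf_numbers (h (f v) n)) \<subseteq> {1..n}"
  shows "subst h (map_ptree f t) = subst (\<lambda>v n. h (f v) n) t"
proof -
  have "subst h (map_ptree f t) = subst (\<lambda>v n. subst h (corolla (f v) n)) t"
    unfolding map_ptree_eq_subst by (rule subst_subst) (use assms in \<open>auto simp: subset_iff\<close>)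
  also have "\<dots> = subst (\<lambda>v n. h (f v) n) t"
    by (rule subst_cong, rule subst_corolla, rule assms)
  finally show ?thesis .
qed

section \<open>Compositions in the operad of symmetric operads\<close>

lemma sOp_sel [simp]:
  "Out sOp T = length (leaf_numbers T)" "Comp sOp T i S = insert_tree i S T"
  "Perm sOp f T = map_ptree f T" "Unit sOp n = corolla 1 n" "arity sOp T = length (vertices T)"
  by (simp_all add: sOp_def corolla_def del: upt_Suc)

lemma mset_eq_upt_iff:
  "mset xs = mset [1..<Suc n] \<longleftrightarrow> distinct xs \<and> set xs = {1..n}"
  by (metis atLeastLessThanSuc_atLeastAtMost distinct_upt mset_eq_imp_distinct_iff
      set_eq_iff_mset_eq_distinct set_mset_mset set_upt)

lemma Ops_sOp_iff:
  "T \<in> Ops sOp \<longleftrightarrow> mset (labels T) = mset [1..<Suc (length (vertices T))] \<and>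
     proper (length (leaf_numbers T)) T"
  unfolding mset_eq_upt_iff proper_iff by (auto simp: sOp_def)

lemma Ops_sOp_labels: "T \<in> Ops sOp \<Longrightarrow> set (labels T) = {1..length (vertices T)}"
  and Ops_sOp_distinct: "T \<in> Ops sOp \<Longrightarrow> distinct (labels T)"
  by (simp_all add: sOp_def)

lemma Inp_sOp:
  assumes "T \<in> Ops sOp" "(j, n) \<in> set (vertices T)"
  shows "Inp sOp T ! (j - 1) = n"
proof -
  have "j \<in> set (labels T)"
    using assms(2) by force
  then have "1 \<le> j" "j \<le> length (vertices T)"
    using Ops_sOp_labels[OF assms(1)] by auto
  moreover have "map_of (vertices T) j = Some n"
    using assms Ops_sOp_distinct by (intro map_of_is_SomeI) auto
  ultimately show ?thesis
    using nth_upt[of 1 "j - 1" "Suc (length (vertices T))"] by (simp add: sOp_def del: upt_Suc)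
qed

lemma Inp_sOp_vertex:
  assumes "T \<in> Ops sOp" "1 \<le> j" "j \<le> length (vertices T)"
  shows "(j, Inp sOp T ! (j - 1)) \<in> set (vertices T)"
proof -
  have "j \<in> set (labels T)"
    using assms Ops_sOp_labels by auto
  then obtain n where "(j, n) \<in> set (vertices T)"
    by auto
  then show ?thesis
    using Inp_sOp[OF assms(1)] by blast
qed

text \<open>Makes partial composition a case of \<open>subst\<close>, so that the monad laws govern
  iterated compositions.\<close>

lemma insert_tree_subst:
  "insert_tree i S T = subst (\<lambda>j n. if j = i then shift_vertices i S
     else corolla (shift i (length (vertices S)) j) n) T"
  by (induction T) (auto simp: Let_def cong: map_cong)

text \<open>The fold inserts at the last vertex first, and each further insertion at a smaller
  number shifts the labels already placed. The tree at vertex \<open>j\<close> is thus shifted by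
  the vertex counts of the trees before it. The starting number \<open>a\<close> is general for the
  sake of the induction.\<close>

lemma foldr_insert_tree:
  assumes "1 \<le> a"
    and "\<And>j n. (j, n) \<in> set (vertices p) \<Longrightarrow> j < a + length qs \<and>
      (a \<le> j \<longrightarrow> set (leaf_numbers (qs ! (j - a))) \<subseteq> {1..n})"
    and "\<And>q. q \<in> set qs \<Longrightarrow> 0 \<notin> set (labels q)"
  shows "foldr (\<lambda>(i, q) r. insert_tree i q r) (zip [a..<a + length qs] qs) p =
    subst (\<lambda>j n. if j < a then corolla j n else
      map_ptree (\<lambda>l. a - 1 + sum_list (take (j - a) (map (\<lambda>q. length (vertices q)) qs)) + l) (qs ! (j - a))) p"
  using assms
proof (induction qs arbitrary: a)
  case Nil
  then show ?case
    by (subst subst_id) auto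
next
  case (Cons q qs)
  let ?off = "\<lambda>a qs j. a - 1 + sum_list (take (j - a) (map (\<lambda>q. length (vertices q)) qs))"
  let ?g = "\<lambda>j n. if j = a then shift_vertices a q else corolla (shift a (length (vertices q)) j) n"
  let ?h = "\<lambda>j n. if j < Suc a then corolla j n else map_ptree (\<lambda>l. ?off (Suc a) qs j + l) (qs ! (j - Suc a))"
  have nth: "(q # qs) ! (j - a) = qs ! (j - Suc a)" if "Suc a \<le> j" for j
    using that by (simp add: nth_Cons')
  have leaves: "set (leaf_numbers (qs ! (j - Suc a))) \<subseteq> {1..n}"
    if "(j, n) \<in> set (vertices p)" "Suc a \<le> j" for j n
    using Cons.prems(2)[OF that(1)] that(2) nth[of j] by auto
  have "foldr (\<lambda>(i, q) r. insert_tree i q r) (zip [Suc a..<Suc a + length qs] qs) p = subst ?h p"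
    by (rule Cons.IH) (use Cons.prems leaves in auto)
  moreover have "zip [a..<a + length (q # qs)] (q # qs) = (a, q) # zip [Suc a..<Suc a + length qs] qs"
    by (simp add: upt_conv_Cons del: upt_Suc)
  ultimately have "foldr (\<lambda>(i, q) r. insert_tree i q r) (zip [a..<a + length (q # qs)] (q # qs)) p
      = subst ?g (subst ?h p)"
    by (simp add: insert_tree_subst)
  also have "\<dots> = subst (\<lambda>v n. subst ?g (?h v n)) p"
  proof (rule subst_subst)
    show "set (leaf_numbers (?h v n)) \<subseteq> {1..n}" if "(v, n) \<in> set (vertices p)" for v n
      using leaves[OF that] by (auto simp del: upt_Suc)
    show "set (leaf_numbers (?g w m)) \<subseteq> {1..m}"
      if "(v, n) \<in> set (vertices p)" "(w, m) \<in> set (vertices (?h v n))" for v n w m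
    proof (cases "v < Suc a")
      case True
      then have "(w, m) = (v, n)"
        using that by simp
      then show ?thesis
        using Cons.prems(2)[OF that(1)] by (auto simp: shift_vertices_def simp del: upt_Suc)
    next
      case False
      then have "w \<in> set (map (\<lambda>l. ?off (Suc a) qs v + l) (labels (qs ! (v - Suc a))))"
        using that(2) by (force simp: vertices_map_ptree)
      moreover have "qs ! (v - Suc a) \<in> set qs"
        using Cons.prems(2)[OF that(1)] False by auto
      \<comment> \<open>Labels of the inserted trees start at \<open>1\<close>, so after the shift
        they exceed \<open>a\<close>, and the insertion at \<open>a\<close> does not hit
        them.\<close>
      ultimately have "w \<noteq> a"
        using Cons.prems(1) Cons.prems(3)[of "qs ! (v - Suc a)"] by (cases "w = a") force+
      then show ?thesis
        by auto
    qed
  qed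
  also have "\<dots> = subst (\<lambda>j n. if j < a then corolla j n else
      map_ptree (\<lambda>l. ?off a (q # qs) j + l) ((q # qs) ! (j - a))) p"
  proof (rule subst_cong)
    fix v n assume v: "(v, n) \<in> set (vertices p)"
    consider "v < a" | "v = a" | "Suc a \<le> v"
      by linarith
    then show "subst ?g (?h v n) = (if v < a then corolla v n else
        map_ptree (\<lambda>l. ?off a (q # qs) v + l) ((q # qs) ! (v - a)))"
    proof cases
      case 1
      then show ?thesis
        by (simp, intro trans[OF subst_corolla]) (auto simp: shift_def)
    next
      case 2
      then show ?thesis
        using Cons.prems(2)[OF v] by (simp add: subst_corolla shift_vertices_def del: upt_Suc)
    next
      case 3
      let ?q = "qs ! (v - Suc a)"
      have "?q \<in> set qs"
        using Cons.prems(2)[OF v] 3 by auto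
      then have pos: "l \<noteq> 0" if "(l, m) \<in> set (vertices ?q)" for l m
        using Cons.prems(3)[of ?q] that by force
      have "subst ?g (map_ptree (\<lambda>l. ?off (Suc a) qs v + l) ?q) =
          subst (\<lambda>l m. ?g (?off (Suc a) qs v + l) m) ?q"
        by (rule subst_map_ptree) (use pos Cons.prems(1) in \<open>auto simp del: upt_Suc\<close>)
      also have "\<dots> = subst (\<lambda>l. corolla (?off a (q # qs) v + l)) ?q"
      proof (rule subst_cong)
        fix l m assume "(l, m) \<in> set (vertices ?q)"
        moreover have "v - a = Suc (v - Suc a)"
          using 3 by simp
        ultimately show "?g (?off (Suc a) qs v + l) m = corolla (?off a (q # qs) v + l) m"
          using pos[of l m] Cons.prems(1) by (simp add: shift_def add_ac)
      qed
      also have "\<dots> = map_ptree (\<lambda>l. ?off a (q # qs) v + l) ?q"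
        by (simp add: map_ptree_eq_subst)
      finally show ?thesis
        using 3 nth[OF 3] by simp
    qed
  qed
  finally show ?case .
qed

lemma image_mset_sum_mset:
  "image_mset f (\<Sum>x\<in>#M. g x) = (\<Sum>x\<in>#M. image_mset f (g x))"
  by (induction M) auto

lemma mset_labels_subst:
  assumes "\<And>v n. (v, n) \<in> set (vertices t) \<Longrightarrow> proper n (h v n)"
  shows "mset (labels (subst h t)) = (\<Sum>(v, n)\<in>#mset (vertices t). mset (labels (h v n)))"
proof -
  have "mset (vertices (subst h t)) = (\<Sum>(v, n)\<in>#mset (vertices t). mset (vertices (h v n)))"
    by (rule mset_vertices_subst) (rule assms)
  then show ?thesis
    by (auto simp: image_mset_sum_mset intro!: arg_cong[of _ _ sum_mset] image_mset_cong)
qed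

text \<open>The matching of colours in \<open>sOp\<close>. It is used both for the source with the
  upper vertices of an arrow and for a vertex of an arrow with the operations that the next arrow
  inserts into it.\<close>

definition composable_family :: "nat ptree \<Rightarrow> nat ptree list \<Rightarrow> bool" where
  "composable_family q rs \<longleftrightarrow> mset (labels q) = mset [1..<Suc (length rs)] \<and>
     (\<forall>(j, n)\<in>set (vertices q). proper n (rs ! (j - 1))) \<and>
     (\<forall>r\<in>set rs. mset (labels r) = mset [1..<Suc (length (vertices r))])"

lemma composable_family_vertex:
  assumes "composable_family q rs" "(j, n) \<in> set (vertices q)"
  shows "1 \<le> j" "j \<le> length rs" "proper n (rs ! (j - 1))" "rs ! (j - 1) \<in> set rs"
proof -
  have "j \<in> set (labels q)"
    using assms(2) by force
  moreover have "set (labels q) = {1..length rs}"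
    using assms(1) unfolding composable_family_def mset_eq_upt_iff by blast
  ultimately show "1 \<le> j" "j \<le> length rs"
    by auto
  then show "rs ! (j - 1) \<in> set rs"
    by simp
  show "proper n (rs ! (j - 1))"
    using assms by (auto simp: composable_family_def)
qed

lemma full_comp_sOp:
  assumes "composable_family q rs"
  shows "full_comp sOp q rs = subst (\<lambda>j n. map_ptree (\<lambda>l.
    sum_list (take (j - 1) (map (\<lambda>r. length (vertices r)) rs)) + l) (rs ! (j - 1))) q"
proof -
  have "full_comp sOp q rs = foldr (\<lambda>(i, q) r. insert_tree i q r) (zip [1..<1 + length rs] rs) q"
    by (simp add: full_comp_def)
  also have "\<dots> = subst (\<lambda>j n. if j < 1 then corolla j n else
      map_ptree (\<lambda>l. 1 - 1 + sum_list (take (j - 1) (map (\<lambda>q. length (vertices q)) rs)) + l) (rs ! (j - 1))) q"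
  proof (rule foldr_insert_tree)
    show "j < 1 + length rs \<and> (1 \<le> j \<longrightarrow> set (leaf_numbers (rs ! (j - 1))) \<subseteq> {1..n})"
      if "(j, n) \<in> set (vertices q)" for j n
      using composable_family_vertex[OF assms that] proper_set[of n "rs ! (j - 1)"] by auto
    show "0 \<notin> set (labels r)" if "r \<in> set rs" for r
      using assms that unfolding composable_family_def mset_eq_upt_iff by force
  qed simp
  also have "\<dots> = subst (\<lambda>j n. map_ptree (\<lambda>l.
      sum_list (take (j - 1) (map (\<lambda>r. length (vertices r)) rs)) + l) (rs ! (j - 1))) q"
    by (rule subst_cong) (use composable_family_vertex(1)[OF assms] in fastforce)
  finally show ?thesis .
qed

text \<open>The shifts in a full composite are the starting positions of the blocks of a
  concatenation.\<close>

lemma concat_nth_offset: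
  assumes "k < length xss" "l < length (xss ! k)"
  shows "sum_list (take k (map length xss)) + l < length (concat xss) \<and>
    concat xss ! (sum_list (take k (map length xss)) + l) = xss ! k ! l"
  using assms
proof (induction xss arbitrary: k)
  case (Cons xs xss)
  then show ?case
  proof (cases k)
    case (Suc k')
    then have "sum_list (take k' (map length xss)) + l < length (concat xss)"
      "concat xss ! (sum_list (take k' (map length xss)) + l) = xss ! k' ! l"
      using Cons by auto
    then show ?thesis
      by (simp add: Suc nth_append)
  qed (simp add: nth_append)
qed simp

text \<open>If the blocks in \<open>nss\<close> number the vertices of the composite in order, the
  offsets of \<open>full_comp_sOp\<close> are exactly the block positions and cancel: each tree is
  labelled by its own block and then substituted.\<close>

lemma
  assumes q: "composable_family q rs" and nss: "map length nss = map (\<lambda>r. length (vertices r)) rs"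
  shows map_full_comp: "map_ptree (\<lambda>l. concat nss ! (l - 1)) (full_comp sOp q rs) =
      subst (\<lambda>j n. map_ptree (\<lambda>l. nss ! (j - 1) ! (l - 1)) (rs ! (j - 1))) q"
    and labels_full_comp: "set (labels (full_comp sOp q rs)) \<subseteq> {1..length (concat nss)}"
    and length_full_comp: "length (vertices (full_comp sOp q rs)) = length (concat nss)"
    and mset_full_comp: "mset (labels (subst (\<lambda>j n. map_ptree (\<lambda>l. nss ! (j - 1) ! (l - 1)) (rs ! (j - 1))) q))
      = mset (concat nss)"
    and proper_full_comp: "proper n (full_comp sOp q rs) = proper n q"
proof -
  let ?off = "\<lambda>j. sum_list (take (j - 1) (map (\<lambda>r. length (vertices r)) rs))"
  let ?h = "\<lambda>j n. map_ptree (\<lambda>l. ?off j + l) (rs ! (j - 1))"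
  let ?g = "\<lambda>j n. map_ptree (\<lambda>l. nss ! (j - 1) ! (l - 1)) (rs ! (j - 1))"
  note fc = full_comp_sOp[OF q]
  have len: "length nss = length rs"
    using nss by (metis length_map)
  have lenj: "length (nss ! (j - 1)) = length (vertices (rs ! (j - 1)))"
    if "j - 1 < length rs" for j
    using arg_cong[OF nss, of "\<lambda>xs. xs ! (j - 1)"] that len by simp
  have labelling: "mset (labels r) = mset [1..<Suc (length (vertices r))]" if "r \<in> set rs" for r
    using q that by (simp add: composable_family_def)
  \<comment> \<open>List indices start at \<open>0\<close> and labels at \<open>1\<close>, so label
    \<open>l\<close> of the \<open>j\<close>-th tree is found at index
    \<open>?off j + l - 1\<close>.\<close>
  have off: "1 \<le> ?off j + l \<and> ?off j + l \<le> length (concat nss) \<and> concat nss ! (?off j + l - 1) = nss ! (j - 1) ! (l - 1)"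
    if "(j, n) \<in> set (vertices q)" "l \<in> set (labels (rs ! (j - 1)))" for j n l
  proof -
    note f = composable_family_vertex[OF q that(1)]
    have "set (labels (rs ! (j - 1))) = {1..length (vertices (rs ! (j - 1)))}"
      using labelling[OF f(4)] unfolding mset_eq_upt_iff by blast
    then have l: "1 \<le> l" "l \<le> length (vertices (rs ! (j - 1)))"
      using that(2) by auto
    have "j - 1 < length nss" "l - 1 < length (nss ! (j - 1))"
      using f l lenj[of j] len by auto
    from concat_nth_offset[OF this] l nss show ?thesis
      by (auto simp: add_diff_assoc)
  qed
  have ph: "proper n (?h j n)" "proper n (?g j n)" if "(j, n) \<in> set (vertices q)" for j n
    using composable_family_vertex[OF q that] by auto
  show "map_ptree (\<lambda>l. concat nss ! (l - 1)) (full_comp sOp q rs) = subst ?g q"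
    unfolding fc
  proof (subst map_ptree_subst)
    show "subst (\<lambda>v n. map_ptree (\<lambda>l. concat nss ! (l - 1)) (?h v n)) q = subst ?g q"
      by (rule subst_cong, simp only: map_ptree_comp, rule map_ptree_cong_labels) (use off in blast)
  qed (use ph proper_set in blast)
  have "set_mset (mset (vertices (subst ?h q))) = (\<Union>(j, n)\<in>set (vertices q). set (vertices (?h j n)))"
    by (subst mset_vertices_subst) (use ph in auto)
  then show "set (labels (full_comp sOp q rs)) \<subseteq> {1..length (concat nss)}"
    unfolding fc using off by (fastforce simp: vertices_map_ptree)
  have "mset (labels (subst ?g q)) = (\<Sum>(j, n)\<in>#mset (vertices q). mset (labels (?g j n)))"
    by (rule mset_labels_subst) (use ph in auto)
  also have "\<dots> = (\<Sum>(j, n)\<in>#mset (vertices q). mset (nss ! (j - 1)))"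
  proof -
    have "mset (labels (?g j n)) = mset (nss ! (j - 1))" if "(j, n) \<in> set (vertices q)" for j n
    proof -
      note f = composable_family_vertex[OF q that]
      have "mset (labels (?g j n)) = image_mset (\<lambda>l. nss ! (j - 1) ! (l - 1)) (mset (labels (rs ! (j - 1))))"
        by (simp only: labels_map_ptree mset_map)
      also have "\<dots> = mset (map (\<lambda>l. nss ! (j - 1) ! (l - 1)) [1..<Suc (length (nss ! (j - 1)))])"
        using labelling[OF f(4)] lenj[of j] f by simp
      finally show ?thesis
        by (simp only: map_nth_pred)
    qed
    then show ?thesis
      by (intro arg_cong[of _ _ sum_mset] image_mset_cong) auto
  qed
  also have "\<dots> = (\<Sum>j\<in>#mset (labels q). mset (nss ! (j - 1)))"
    by (simp add: image_mset.compositionality comp_def case_prod_unfold)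
  also have "mset (labels q) = mset [1..<Suc (length nss)]"
    using q len by (simp add: composable_family_def)
  also have "(\<Sum>j\<in>#mset [1..<Suc (length nss)]. mset (nss ! (j - 1))) =
      sum_mset (mset (map mset (map (\<lambda>k. nss ! (k - 1)) [1..<Suc (length nss)])))"
    by (simp add: comp_def del: upt_Suc)
  also have "\<dots> = mset (concat nss)"
    unfolding map_nth_pred using mset_concat_map[of "\<lambda>x. x" nss] by simp
  finally show mset: "mset (labels (subst ?g q)) = mset (concat nss)" .
  have "length (vertices (full_comp sOp q rs)) =
      length (labels (map_ptree (\<lambda>l. concat nss ! (l - 1)) (full_comp sOp q rs)))"
    by simp
  also have "\<dots> = length (concat nss)"
    unfolding \<open>map_ptree (\<lambda>l. concat nss ! (l - 1)) (full_comp sOp q rs) = subst ?g q\<close>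
    by (rule mset_eq_length[OF mset])
  finally show "length (vertices (full_comp sOp q rs)) = length (concat nss)" .
  show "proper n (full_comp sOp q rs) = proper n q"
    unfolding fc by (rule proper_subst) (use ph in auto)
qed

text \<open>The counterpart for the lower operation: \<open>S\<close> fills vertex \<open>1\<close>
  and takes the first numbers \<open>ns\<close>, while the vertices \<open>2\<close>,
  \<open>3\<close>, ... take \<open>ms\<close>, whence the index \<open>j - 2\<close>.\<close>

lemma map_insert_tree_1:
  assumes T: "mset (labels T) = mset [1..<Suc (Suc (length ms))]"
    and S: "set (labels S) \<subseteq> {1..length ns}" "length ns = length (vertices S)"
      "\<And>n. (1, n) \<in> set (vertices T) \<Longrightarrow> proper n S"
  shows "map_ptree (\<lambda>l. (ns @ ms) ! (l - 1)) (insert_tree 1 S T) =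
    subst (\<lambda>j n. if j = 1 then map_ptree (\<lambda>l. ns ! (l - 1)) S else corolla (ms ! (j - 2)) n) T"
    and "set (labels (insert_tree 1 S T)) \<subseteq> {1..length (ns @ ms)}"
proof -
  let ?h = "\<lambda>j n. if j = 1 then S else corolla (shift 1 (length (vertices S)) j) n"
  have "shift_vertices 1 S = S"
    by (auto simp: shift_vertices_def intro: map_ptree_idI)
  then have ins: "insert_tree 1 S T = subst ?h T"
    unfolding insert_tree_subst by (simp only:)
  have T1: "1 \<le> j \<and> j \<le> Suc (length ms)" if "(j, n) \<in> set (vertices T)" for j n
  proof -
    have "set (labels T) = {1..Suc (length ms)}"
      using T unfolding mset_eq_upt_iff by blast
    then show ?thesis
      using that by force
  qed
  show "map_ptree (\<lambda>l. (ns @ ms) ! (l - 1)) (insert_tree 1 S T) =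
    subst (\<lambda>j n. if j = 1 then map_ptree (\<lambda>l. ns ! (l - 1)) S else corolla (ms ! (j - 2)) n) T"
    unfolding ins
  proof (subst map_ptree_subst)
    show "subst (\<lambda>v n. map_ptree (\<lambda>l. (ns @ ms) ! (l - 1)) (?h v n)) T =
      subst (\<lambda>j n. if j = 1 then map_ptree (\<lambda>l. ns ! (l - 1)) S else corolla (ms ! (j - 2)) n) T"
    proof (rule subst_cong)
      fix j n assume j: "(j, n) \<in> set (vertices T)"
      show "map_ptree (\<lambda>l. (ns @ ms) ! (l - 1)) (?h j n) =
         (if j = 1 then map_ptree (\<lambda>l. ns ! (l - 1)) S else corolla (ms ! (j - 2)) n)"
      proof (cases "j = 1")
        case True
        have "l - 1 < length ns" if "l \<in> set (labels S)" for l
          using subsetD[OF S(1) that] by auto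
        then have "map_ptree (\<lambda>l. (ns @ ms) ! (l - 1)) S = map_ptree (\<lambda>l. ns ! (l - 1)) S"
          by (intro map_ptree_cong_labels) (auto simp: nth_append)
        then show ?thesis
          using True by simp
      next
        case False
        then have "2 \<le> j"
          using T1[OF j] by auto
        then obtain i where "j = i + 2"
          by (metis le_add_diff_inverse2)
        then show ?thesis
          using S(2) by (simp add: shift_def nth_append)
      qed
    qed
  qed (use S(3) proper_set in \<open>auto simp del: upt_Suc split: if_splits\<close>)
  show "set (labels (insert_tree 1 S T)) \<subseteq> {1..length (ns @ ms)}"
  proof -
    have "set_mset (mset (vertices (subst ?h T))) = (\<Union>(j, n)\<in>set (vertices T). set (vertices (?h j n)))"
      by (subst mset_vertices_subst) (use S(3) in auto)
    moreover have "set (labels (?h j n)) \<subseteq> {1..length (ns @ ms)}"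
      if "(j, n) \<in> set (vertices T)" for j n
      using T1[OF that] S(1,2) by (auto simp: shift_def)
    ultimately show ?thesis
      unfolding ins by fastforce
  qed
qed

section \<open>Twisted arrows as families of labelled trees\<close>

definition rank :: "nat list \<Rightarrow> nat \<Rightarrow> nat" where
  "rank L x = card {y \<in> set L. y \<le> x}"

text \<open>With \<open>sort_rank\<close> it makes ranking and indexing into the sorted list
  mutually inverse, on which the round trip between twisted arrows and labelled trees rests.\<close>

lemma rank_sort:
  assumes "distinct L" "k < length L"
  shows "rank L (sort L ! k) = Suc k"
proof -
  let ?S = "sort L"
  have S: "sorted ?S" "distinct ?S" "k < length ?S"
    using assms by auto
  \<comment> \<open>In a strictly increasing list the entries not exceeding the one at index
    \<open>k\<close> are the first \<open>k + 1\<close>.\<close>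
  have "{y \<in> set ?S. y \<le> ?S ! k} = set (take (Suc k) ?S)"
  proof
    show "{y \<in> set ?S. y \<le> ?S ! k} \<subseteq> set (take (Suc k) ?S)"
    proof
      fix y assume "y \<in> {y \<in> set ?S. y \<le> ?S ! k}"
      then obtain i where i: "i < length ?S" "y = ?S ! i" "?S ! i \<le> ?S ! k"
        unfolding in_set_conv_nth by auto
      have "i \<le> k"
      proof (rule ccontr)
        assume "\<not> i \<le> k"
        then have "?S ! k \<le> ?S ! i"
          using S i by (intro sorted_nth_mono) auto
        then have "?S ! k = ?S ! i"
          using i by simp
        then show False
          using nth_eq_iff_index_eq[OF S(2,3) i(1)] \<open>\<not> i \<le> k\<close> by simp
      qed
      then show "y \<in> set (take (Suc k) ?S)"
        using i by (force simp: in_set_conv_nth)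
    qed
    show "set (take (Suc k) ?S) \<subseteq> {y \<in> set ?S. y \<le> ?S ! k}"
    proof
      fix y assume "y \<in> set (take (Suc k) ?S)"
      then obtain i where "i < Suc k" "y = ?S ! i"
        unfolding in_set_conv_nth by auto
      then show "y \<in> {y \<in> set ?S. y \<le> ?S ! k}"
        using S sorted_nth_mono[OF S(1), of i k] nth_mem[of i ?S] by auto
    qed
  qed
  moreover have "card (set (take (Suc k) ?S)) = Suc k"
    using S by (simp add: distinct_card del: length_sort)
  ultimately show ?thesis
    by (simp add: rank_def)
qed

lemma sort_rank:
  assumes "distinct L" "x \<in> set L"
  shows "1 \<le> rank L x" "rank L x \<le> length L" "sort L ! (rank L x - 1) = x"
proof -
  have "x \<in> set (sort L)"
    using assms by simp
  then obtain k where "k < length L" "x = sort L ! k"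
    unfolding in_set_conv_nth by auto
  then show "1 \<le> rank L x" "rank L x \<le> length L" "sort L ! (rank L x - 1) = x"
    using rank_sort[OF assms(1)] by auto
qed

lemma mset_map_rank:
  assumes "distinct L"
  shows "mset (map (rank L) L) = mset [1..<Suc (length L)]"
proof -
  have "map (rank L) (sort L) = [1..<Suc (length L)]"
    by (rule nth_equalityI) (use assms in \<open>auto simp: rank_sort simp del: upt_Suc\<close>)
  then show ?thesis
    by (metis mset_map mset_sort)
qed

lemma map_tw_leaves:
  "map f (tw_leaves sOp vs) =
    concat (map (\<lambda>i. map (\<lambda>k. f (i, k)) [1..<Suc (length (vertices (vs ! i)))]) [1..<length vs]) @
    map (\<lambda>k. f (0, k)) [2..<Suc (length (vertices (vs ! 0)))]"
  by (simp add: tw_leaves_def map_concat comp_def del: upt_Suc)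

lemma set_tw_leaves:
  "(i, k) \<in> set (tw_leaves sOp vs) \<longleftrightarrow> i < length vs \<and> k \<le> length (vertices (vs ! i)) \<and>
     (if i = 0 then 2 \<le> k else 1 \<le> k)" if "vs \<noteq> []"
proof -
  have "(i, k) \<in> Pair x ` S \<longleftrightarrow> x = i \<and> k \<in> S" for x and S :: "nat set"
    by auto
  then show ?thesis
    using that by (auto simp: tw_leaves_def simp del: upt_Suc)
qed

lemma distinct_tw_leaves: "distinct (tw_leaves sOp vs)"
proof -
  have "distinct (concat (map (\<lambda>i. map (Pair i) [1..<Suc (f i)]) xs))"
    if "distinct xs" for xs :: "nat list" and f :: "nat \<Rightarrow> nat"
    using that by (rule distinct_concat_map) (auto simp: distinct_map inj_on_def simp del: upt_Suc)
  then show ?thesis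
    by (auto simp: tw_leaves_def distinct_map inj_on_def simp del: upt_Suc)
qed

text \<open>The label \<open>0\<close> marks the place of the source operation; it cannot collide
  with the numbers of an operation, which start at \<open>1\<close>.\<close>

definition plug :: "nat ptree \<Rightarrow> nat ptree \<Rightarrow> nat ptree" where
  "plug P = subst (\<lambda>j n. if j = 0 then P else corolla j n)"

lemma unique_vertex_0:
  assumes "count (mset (labels a)) 0 = 1" "(0, m) \<in> set (vertices a)"
  obtains V where "mset (vertices a) = add_mset (0, m) V" "\<And>n. (0, n) \<notin># V"
proof -
  obtain V where V: "mset (vertices a) = add_mset (0, m) V"
    using assms(2) by (metis multi_member_split set_mset_mset)
  then have "mset (labels a) = add_mset 0 (image_mset fst V)"
    by simp
  then have "count (image_mset fst V) 0 = 0"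
    using assms(1) by simp
  then have "(0, n) \<notin># V" for n
    by (metis count_eq_zero_iff fst_conv image_eqI set_image_mset)
  with V show ?thesis
    by (rule that)
qed

text \<open>Uniqueness of the mark means that \<open>P\<close> is inserted once. The consumed vertex
  is added on the left, which avoids a subtraction of multisets.\<close>

lemma
  assumes "count (mset (labels a)) 0 = 1" "(0, m) \<in> set (vertices a)" "proper m P"
  shows mset_plug: "add_mset (0, m) (mset (vertices (plug P a))) = mset (vertices a) + mset (vertices P)"
    and mset_leaves_plug: "mset (leaf_numbers (plug P a)) = mset (leaf_numbers a)"
proof -
  let ?h = "\<lambda>j n. if j = 0 then P else corolla j n"
  obtain V where V: "mset (vertices a) = add_mset (0, m) V" "\<And>n. (0, n) \<notin># V"
    using unique_vertex_0[OF assms(1,2)] by metis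
  have h: "proper n (?h v n)" if "(v, n) \<in> set (vertices a)" for v n
  proof -
    have "(v, n) \<in># add_mset (0, m) V"
      using that V(1) by (metis set_mset_mset)
    then show ?thesis
      using V(2)[of n] assms(3) by auto
  qed
  have "mset (vertices (plug P a)) = (\<Sum>(v, n)\<in>#mset (vertices a). mset (vertices (?h v n)))"
    unfolding plug_def by (rule mset_vertices_subst) (rule h)
  also have "\<dots> = mset (vertices P) + (\<Sum>(v, n)\<in>#V. {#(v, n)#})"
  proof -
    have "(\<Sum>(v, n)\<in>#V. mset (vertices (?h v n))) = (\<Sum>(v, n)\<in>#V. {#(v, n)#})"
      using V(2) by (intro arg_cong[of _ _ sum_mset] image_mset_cong) auto
    then show ?thesis
      by (simp add: V(1))
  qed
  also have "(\<Sum>(v, n)\<in>#V. {#(v, n)#}) = V"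
    by (induction V) auto
  finally show "add_mset (0, m) (mset (vertices (plug P a))) = mset (vertices a) + mset (vertices P)"
    by (simp add: V(1))
  show "mset (leaf_numbers (plug P a)) = mset (leaf_numbers a)"
    unfolding plug_def by (rule mset_leaves_subst) (rule h)
qed

definition target :: "nat ptree \<Rightarrow> (nat \<Rightarrow> nat ptree) \<Rightarrow> nat ptree" where
  "target p A = plug (subst (\<lambda>j _. A j) p) (A 0)"

text \<open>The local conditions: the trees fit their vertices and \<open>A 0\<close> has a single
  mark, which fits \<open>p\<close>. Extensionality lets families be compared as functions. The
  global condition in \<open>arrow\<close>, that the target is an operation, accounts for the
  bijectivity of \<open>\<lambda>\<close>.\<close>

definition pre_arrow :: "nat ptree \<Rightarrow> (nat \<Rightarrow> nat ptree) \<Rightarrow> bool" where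
  "pre_arrow p A \<longleftrightarrow> p \<in> Ops sOp \<and> A \<in> extensional {0..length (vertices p)} \<and>
     (\<forall>(j, n)\<in>set (vertices p). proper n (A j)) \<and>
     count (mset (labels (A 0))) 0 = 1 \<and> (0, length (leaf_numbers p)) \<in> set (vertices (A 0))"

definition arrow :: "nat ptree \<Rightarrow> (nat \<Rightarrow> nat ptree) \<Rightarrow> bool" where
  "arrow p A \<longleftrightarrow> pre_arrow p A \<and> target p A \<in> Ops sOp"

text \<open>Plugging and substitution add multisets of vertices, and the labels of \<open>p\<close>
  run once through its vertex numbers, so a sum over the vertices of \<open>p\<close> becomes a sum
  over the trees of the family.\<close>

lemma
  assumes "pre_arrow p A"
  shows mset_vertices_tgt: "add_mset (0, length (leaf_numbers p)) (mset (vertices (target p A))) =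
      mset (concat (map (\<lambda>i. vertices (A i)) [0..<Suc (length (vertices p))]))"
    and mset_labels_tgt: "add_mset 0 (mset (labels (target p A))) =
      mset (concat (map (\<lambda>i. labels (A i)) [0..<Suc (length (vertices p))]))"
    and mset_leaves_tgt: "mset (leaf_numbers (target p A)) = mset (leaf_numbers (A 0))"
    and proper_source: "proper (length (leaf_numbers p)) (subst (\<lambda>j _. A j) p)"
proof -
  have A: "proper n (A j)" if "(j, n) \<in> set (vertices p)" for j n
    using assms that by (auto simp: pre_arrow_def)
  have p: "p \<in> Ops sOp"
    using assms by (simp add: pre_arrow_def)
  show P: "proper (length (leaf_numbers p)) (subst (\<lambda>j _. A j) p)"
    using proper_subst[of p "\<lambda>j _. A j"] A p by (auto simp: Ops_sOp_iff)
  have 0: "count (mset (labels (A 0))) 0 = 1" "(0, length (leaf_numbers p)) \<in> set (vertices (A 0))"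
    using assms by (auto simp: pre_arrow_def)
  show "mset (leaf_numbers (target p A)) = mset (leaf_numbers (A 0))"
    unfolding target_def by (rule mset_leaves_plug[OF 0 P])
  have "add_mset (0, length (leaf_numbers p)) (mset (vertices (target p A))) =
      mset (vertices (A 0)) + mset (vertices (subst (\<lambda>j _. A j) p))"
    unfolding target_def by (rule mset_plug[OF 0 P])
  also have "mset (vertices (subst (\<lambda>j _. A j) p)) = (\<Sum>(j, n)\<in>#mset (vertices p). mset (vertices (A j)))"
    by (rule mset_vertices_subst) (rule A)
  also have "\<dots> = (\<Sum>j\<in>#mset (labels p). mset (vertices (A j)))"
    by (simp add: image_mset.compositionality comp_def case_prod_unfold)
  also have "mset (labels p) = mset [1..<Suc (length (vertices p))]"
    using p by (simp add: Ops_sOp_iff)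
  also have "mset (vertices (A 0)) + (\<Sum>j\<in>#mset [1..<Suc (length (vertices p))]. mset (vertices (A j))) =
      (\<Sum>j\<in>#mset [0..<Suc (length (vertices p))]. mset (vertices (A j)))"
    by (subst (2) upt_conv_Cons) (simp_all del: upt_Suc)
  finally show v: "add_mset (0, length (leaf_numbers p)) (mset (vertices (target p A))) =
      mset (concat (map (\<lambda>i. vertices (A i)) [0..<Suc (length (vertices p))]))"
    by (simp only: mset_concat_map)
  show "add_mset 0 (mset (labels (target p A))) =
      mset (concat (map (\<lambda>i. labels (A i)) [0..<Suc (length (vertices p))]))"
    using arg_cong[OF v, of "image_mset fst"] by (simp add: map_concat comp_def flip: mset_map del: upt_Suc)
qed

text \<open>All labels of the family together are \<open>0\<close> and the numbers of the target,
  each once; so no tree repeats a label and the mark occurs in \<open>A 0\<close> only.\<close>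

lemma arrow_vertices:
  assumes "arrow p A"
  shows "\<And>i. i \<le> length (vertices p) \<Longrightarrow> distinct (labels (A i))"
    and "\<And>i j n. i \<le> length (vertices p) \<Longrightarrow> (j, n) \<in> set (vertices (A i)) \<Longrightarrow>
      j = 0 \<and> i = 0 \<and> n = length (leaf_numbers p) \<or> j \<noteq> 0 \<and> (j, n) \<in> set (vertices (target p A))"
proof -
  have pre: "pre_arrow p A" and t: "target p A \<in> Ops sOp"
    using assms by (auto simp: arrow_def)
  note t' = Ops_sOp_distinct[OF t] Ops_sOp_labels[OF t]
  have "mset (concat (map (\<lambda>i. labels (A i)) [0..<Suc (length (vertices p))])) = mset (0 # labels (target p A))"
    using mset_labels_tgt[OF pre] by simp
  moreover have "distinct (0 # labels (target p A))"
    using t' by auto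
  ultimately have d: "distinct (concat (map (\<lambda>i. labels (A i)) [0..<Suc (length (vertices p))]))"
    by (metis mset_eq_imp_distinct_iff)
  then show D: "distinct (labels (A i))" if "i \<le> length (vertices p)" for i
    using that by (auto simp: distinct_concat_iff simp del: upt_Suc)
  fix i j n assume i: "i \<le> length (vertices p)" and j: "(j, n) \<in> set (vertices (A i))"
  have "(j, n) \<in># add_mset (0, length (leaf_numbers p)) (mset (vertices (target p A)))"
    unfolding mset_vertices_tgt[OF pre] using i j by (auto simp del: upt_Suc)
  then consider "j = 0" "n = length (leaf_numbers p)" | "(j, n) \<in> set (vertices (target p A))"
    by auto
  then show "j = 0 \<and> i = 0 \<and> n = length (leaf_numbers p) \<or> j \<noteq> 0 \<and> (j, n) \<in> set (vertices (target p A))"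
  proof cases
    case 1
    have "i = 0"
    proof (rule ccontr)
      assume "i \<noteq> 0"
      have "[0..<Suc (length (vertices p))] = 0 # [1..<Suc (length (vertices p))]"
        by (subst upt_conv_Cons) simp_all
      then have "set (labels (A 0)) \<inter> set (labels (A i)) = {}"
        using d i \<open>i \<noteq> 0\<close> by (force simp del: upt_Suc)
      moreover have "0 \<in> set (labels (A 0))" "0 \<in> set (labels (A i))"
        using pre j 1 by (force simp: pre_arrow_def)+
      ultimately show False
        by blast
    qed
    then show ?thesis
      using 1 by simp
  next
    case 2
    then have "j \<in> set (labels (target p A))"
      by force
    then show ?thesis
      using t' 2 by auto
  qed
qed

text \<open>The inverse of \<open>labelling\<close>. Ranks turn the labels of a tree into vertex
  numbers, and the sorted labels become the values of \<open>\<lambda>\<close>, increasing as an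
  arrow requires. The mark has rank \<open>1\<close> and so becomes the first input of the lower
  operation.\<close>

definition standard :: "nat ptree \<Rightarrow> (nat \<Rightarrow> nat ptree) \<Rightarrow> nat ptree tw_arrow" where
  "standard p A = (let us = map (\<lambda>i. map_ptree (rank (labels (A i))) (A i)) [0..<Suc (length (vertices p))]
     in (p, us, \<lambda>(i, k)\<in>set (tw_leaves sOp us). sort (labels (A i)) ! (k - 1)))"

text \<open>The first input of the lower operation is not a leaf and has no value of
  \<open>\<lambda>\<close>. It is given the mark \<open>0\<close>, below all these values.\<close>

definition leaf_label :: "(nat \<times> nat \<Rightarrow> nat) \<Rightarrow> nat \<Rightarrow> nat \<Rightarrow> nat" where
  "leaf_label lam i k = (if (i, k) = (0, 1) then 0 else lam (i, k))"

definition labelling :: "nat ptree tw_arrow \<Rightarrow> nat \<Rightarrow> nat ptree" where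
  "labelling = (\<lambda>(p, vs, lam). \<lambda>i\<in>{0..length (vertices p)}. map_ptree (leaf_label lam i) (vs ! i))"

lemma tw_arrowsD:
  assumes "(p, vs, lam) \<in> tw_arrows sOp"
  shows "p \<in> Ops sOp" "length vs = Suc (length (vertices p))"
    "\<And>i. i \<le> length (vertices p) \<Longrightarrow> vs ! i \<in> Ops sOp"
    "(1, length (leaf_numbers p)) \<in> set (vertices (vs ! 0))"
    "1 \<le> length (vertices (vs ! 0))"
    "\<And>j n. (j, n) \<in> set (vertices p) \<Longrightarrow> proper n (vs ! j)"
    "lam \<in> extensional (set (tw_leaves sOp vs))"
    "mset (map lam (tw_leaves sOp vs)) = mset [1..<Suc (length (tw_leaves sOp vs))]"
    "\<And>i k l. (i, k) \<in> set (tw_leaves sOp vs) \<Longrightarrow> (i, l) \<in> set (tw_leaves sOp vs) \<Longrightarrow> k < l \<Longrightarrow>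
        lam (i, k) < lam (i, l)"
proof -
  have *: "p \<in> Ops sOp" "length vs = Suc (length (vertices p))" "set vs \<subseteq> Ops sOp"
    "Inp sOp (vs ! 0) \<noteq> []" "Inp sOp (vs ! 0) ! 0 = length (leaf_numbers p)"
    "\<forall>i\<in>{1..length (vertices p)}. length (leaf_numbers (vs ! i)) = Inp sOp p ! (i - 1)"
     "bij_betw lam (set (tw_leaves sOp vs)) {1..length (tw_leaves sOp vs)}"
    using assms by (auto simp: tw_arrows_def)
  show "p \<in> Ops sOp" "length vs = Suc (length (vertices p))"
    "lam \<in> extensional (set (tw_leaves sOp vs))"
    "\<And>i k l. (i, k) \<in> set (tw_leaves sOp vs) \<Longrightarrow> (i, l) \<in> set (tw_leaves sOp vs) \<Longrightarrow> k < l \<Longrightarrow>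
        lam (i, k) < lam (i, l)"
    using assms by (auto simp: tw_arrows_def)
  show vs: "vs ! i \<in> Ops sOp" if "i \<le> length (vertices p)" for i
    using * that by (simp add: subset_iff)
  show one: "1 \<le> length (vertices (vs ! 0))"
    using *(4) by (metis One_nat_def Suc_leI length_greater_0_conv sOp_sel(5))
  show "(1, length (leaf_numbers p)) \<in> set (vertices (vs ! 0))"
    using Inp_sOp_vertex[OF vs[of 0], of 1] one *(5) by simp
  show "proper n (vs ! j)" if "(j, n) \<in> set (vertices p)" for j n
  proof -
    have "j \<in> set (labels p)"
      using that by force
    then have "j \<in> {1..length (vertices p)}"
      using Ops_sOp_labels[OF *(1)] by simp
    then show ?thesis
      using *(6) Inp_sOp[OF *(1) that] vs[of j] by (simp add: Ops_sOp_iff)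
  qed
  show "mset (map lam (tw_leaves sOp vs)) = mset [1..<Suc (length (tw_leaves sOp vs))]"
    unfolding mset_eq_upt_iff using *(7) distinct_tw_leaves[of vs]
    by (auto simp: distinct_map bij_betw_def)
qed

section \<open>From twisted arrows to families of labelled trees\<close>

context
  fixes p vs lam
  assumes f: "(p, vs, lam) \<in> tw_arrows sOp"
begin

private abbreviation "A \<equiv> labelling (p, vs, lam)"

lemma lab_nth: "i \<le> length (vertices p) \<Longrightarrow> A i = map_ptree (leaf_label lam i) (vs ! i)"
  by (simp add: labelling_def)

lemma tw_leaves_iff:
  "(i, k) \<in> set (tw_leaves sOp vs) \<longleftrightarrow> i \<le> length (vertices p) \<and> k \<le> length (vertices (vs ! i)) \<and>
     (if i = 0 then 2 \<le> k else 1 \<le> k)"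
proof -
  have "vs \<noteq> []"
    using tw_arrowsD(2)[OF f] by auto
  then show ?thesis
    using set_tw_leaves[of vs i k] tw_arrowsD(2)[OF f] by auto
qed

lemma lam_pos: "(i, k) \<in> set (tw_leaves sOp vs) \<Longrightarrow> 1 \<le> lam (i, k)"
proof -
  have "set (map lam (tw_leaves sOp vs)) = {1..length (tw_leaves sOp vs)}"
    using tw_arrowsD(8)[OF f] unfolding mset_eq_upt_iff by blast
  moreover assume "(i, k) \<in> set (tw_leaves sOp vs)"
  ultimately show ?thesis
    by (force simp del: map_map)
qed

lemma leaf_label_0_iff:
  assumes "i \<le> length (vertices p)" "k \<in> set (labels (vs ! i))"
  shows "leaf_label lam i k = 0 \<longleftrightarrow> (i, k) = (0, 1)"
  using lam_pos[of i k] assms Ops_sOp_labels[OF tw_arrowsD(3)[OF f assms(1)]]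
  by (cases "i = 0") (auto simp: leaf_label_def tw_leaves_iff)

lemma mset_labels_lab:
  assumes "i \<le> length (vertices p)"
  shows "mset (labels (A i)) = mset (map (leaf_label lam i) [1..<Suc (length (vertices (vs ! i)))])"
  using tw_arrowsD(3)[OF f assms] unfolding Ops_sOp_iff
  by (simp only: lab_nth[OF assms] labels_map_ptree mset_map)

lemma leaf_label_mono:
  assumes "i \<le> length (vertices p)" "1 \<le> k" "k < l" "l \<le> length (vertices (vs ! i))"
  shows "leaf_label lam i k < leaf_label lam i l"
proof (cases "(i, k) = (0, 1)")
  case True
  then show ?thesis
    using lam_pos[of i l] assms by (auto simp: leaf_label_def tw_leaves_iff)
next
  case False
  then have "(i, k) \<in> set (tw_leaves sOp vs)" "(i, l) \<in> set (tw_leaves sOp vs)"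
    using assms by (auto simp: tw_leaves_iff)
  then show ?thesis
    using False assms tw_arrowsD(9)[OF f] by (auto simp: leaf_label_def)
qed

lemma sort_labels_lab:
  assumes "i \<le> length (vertices p)"
  shows "sort (labels (A i)) = map (leaf_label lam i) [1..<Suc (length (vertices (vs ! i)))]"
proof (rule properties_for_sort[OF mset_labels_lab[OF assms, symmetric]])
  show "sorted (map (leaf_label lam i) [1..<Suc (length (vertices (vs ! i)))])"
    using leaf_label_mono[OF assms]
    by (auto simp: sorted_iff_nth_mono_less nth_append less_imp_le simp del: upt_Suc)
qed

lemma distinct_labels_lab: "i \<le> length (vertices p) \<Longrightarrow> distinct (labels (A i))"
proof -
  assume i: "i \<le> length (vertices p)"
  have "inj_on (leaf_label lam i) {1..<Suc (length (vertices (vs ! i)))}"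
  proof (rule linorder_inj_onI')
    fix k l
    assume "k \<in> {1..<Suc (length (vertices (vs ! i)))}" "l \<in> {1..<Suc (length (vertices (vs ! i)))}" "k < l"
    then show "leaf_label lam i k \<noteq> leaf_label lam i l"
      using leaf_label_mono[OF i, of k l] by auto
  qed
  then have "distinct (map (leaf_label lam i) [1..<Suc (length (vertices (vs ! i)))])"
    by (simp add: distinct_map del: upt_Suc)
  then show ?thesis
    using mset_labels_lab[OF i] mset_eq_imp_distinct_iff by blast
qed

lemma length_lab: "i \<le> length (vertices p) \<Longrightarrow> length (vertices (A i)) = length (vertices (vs ! i))"
  by (simp add: lab_nth vertices_map_ptree)

text \<open>\<open>leaf_label\<close> is increasing on each vertex, so the rank of its value at
  \<open>k\<close> is \<open>k\<close> again.\<close>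

lemma std_lab: "standard p A = (p, vs, lam)"
proof -
  let ?n = "length (vertices p)"
  let ?us = "map (\<lambda>i. map_ptree (rank (labels (A i))) (A i)) [0..<Suc ?n]"
  have us: "?us = vs"
  proof (rule nth_equalityI)
    show "length ?us = length vs"
      using tw_arrowsD(2)[OF f] by simp
    fix i assume "i < length ?us"
    then have i: "i \<le> ?n"
      by simp
    have "map_ptree (rank (labels (A i))) (A i) =
        map_ptree (\<lambda>k. rank (labels (A i)) (leaf_label lam i k)) (vs ! i)"
      by (simp add: lab_nth[OF i] map_ptree_comp)
    also have "\<dots> = vs ! i"
    proof (rule map_ptree_idI)
      fix k assume "k \<in> set (labels (vs ! i))"
      then have k: "1 \<le> k" "k \<le> length (vertices (vs ! i))"
        using Ops_sOp_labels[OF tw_arrowsD(3)[OF f i]] by auto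
      then have "sort (labels (A i)) ! (k - 1) = leaf_label lam i k"
        using nth_upt[of 1 "k - 1" "Suc (length (vertices (vs ! i)))"]
        unfolding sort_labels_lab[OF i] by (simp del: upt_Suc)
      then show "rank (labels (A i)) (leaf_label lam i k) = k"
        using rank_sort[OF distinct_labels_lab[OF i], of "k - 1"] k length_lab[OF i] by simp
    qed
    finally show "?us ! i = vs ! i"
      using i by (simp add: nth_append del: upt_Suc)
  qed
  have "(\<lambda>(i, k)\<in>set (tw_leaves sOp vs). sort (labels (A i)) ! (k - 1)) = lam"
  proof (rule extensionalityI[OF restrict_extensional tw_arrowsD(7)[OF f]])
    fix x assume x: "x \<in> set (tw_leaves sOp vs)"
    obtain i k where ik: "x = (i, k)"
      by fastforce
    then have i: "i \<le> ?n" and k: "k \<le> length (vertices (vs ! i))" "(if i = 0 then 2 \<le> k else 1 \<le> k)"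
      using x by (auto simp: tw_leaves_iff)
    have "sort (labels (A i)) ! (k - 1) = leaf_label lam i k"
      using k nth_upt[of 1 "k - 1" "Suc (length (vertices (vs ! i)))"]
      unfolding sort_labels_lab[OF i] by (auto simp del: upt_Suc split: if_splits)
    then show "(\<lambda>(i, k)\<in>set (tw_leaves sOp vs). sort (labels (A i)) ! (k - 1)) x = lam x"
      using x ik k by (auto simp: leaf_label_def)
  qed
  then show ?thesis
    unfolding standard_def Let_def us by simp
qed

lemma pre_arr_lab: "pre_arrow p A"
  unfolding pre_arrow_def
proof (intro conjI)
  show "p \<in> Ops sOp"
    by (rule tw_arrowsD(1)[OF f])
  show "A \<in> extensional {0..length (vertices p)}"
    by (simp add: labelling_def)
  show "\<forall>(j, n)\<in>set (vertices p). proper n (A j)"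
  proof clarify
    fix j n assume j: "(j, n) \<in> set (vertices p)"
    then have "j \<in> set (labels p)"
      by force
    then have "j \<le> length (vertices p)"
      using Ops_sOp_labels[OF tw_arrowsD(1)[OF f]] by auto
    then show "proper n (A j)"
      using tw_arrowsD(6)[OF f j] by (simp add: lab_nth)
  qed
  have "(leaf_label lam 0 1, length (leaf_numbers p)) \<in> set (vertices (A 0))"
    using tw_arrowsD(4)[OF f] by (force simp: lab_nth vertices_map_ptree)
  then show 0: "(0, length (leaf_numbers p)) \<in> set (vertices (A 0))"
    by (simp add: leaf_label_def)
  then have "0 \<in> set (labels (A 0))"
    by force
  then show "count (mset (labels (A 0))) 0 = 1"
    using distinct_labels_lab[of 0] by (simp add: distinct_count_atmost_1)
qed

lemma mset_labels_tgt_lab: "mset (labels (target p A)) = mset (map lam (tw_leaves sOp vs))"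
proof -
  let ?n = "length (vertices p)"
  let ?L = "\<lambda>i. map (leaf_label lam i) [1..<Suc (length (vertices (vs ! i)))]"
  have "add_mset 0 (mset (labels (target p A))) = (\<Sum>i\<in>#mset [0..<Suc ?n]. mset (labels (A i)))"
    by (simp only: mset_labels_tgt[OF pre_arr_lab] mset_concat_map)
  also have "\<dots> = (\<Sum>i\<in>#mset [0..<Suc ?n]. mset (?L i))"
    by (intro arg_cong[of _ _ sum_mset] image_mset_cong mset_labels_lab) (auto simp del: upt_Suc)
  also have "\<dots> = mset (concat (map ?L (0 # [1..<Suc ?n])))"
    by (simp add: mset_concat_map upt_conv_Cons del: upt_Suc)
  also have "\<dots> = mset (concat (map ?L [1..<Suc ?n]) @ ?L 0)"
    by simp
  also have "map ?L [1..<Suc ?n] = map (\<lambda>i. map (\<lambda>k. lam (i, k)) [1..<Suc (length (vertices (vs ! i)))]) [1..<Suc ?n]"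
    by (auto simp: leaf_label_def simp del: upt_Suc)
  \<comment> \<open>The mark supplies the extra \<open>0\<close>; the remaining entries belong to
    the leaves of the lower vertex, whose numbering starts at \<open>2\<close>.\<close>
  also have "?L 0 = 0 # map (\<lambda>k. lam (0, k)) [2..<Suc (length (vertices (vs ! 0)))]"
    using tw_arrowsD(5)[OF f]
    by (subst upt_conv_Cons) (auto simp: leaf_label_def numeral_2_eq_2 simp del: upt_Suc)
  finally show ?thesis
    by (simp add: map_tw_leaves tw_arrowsD(2)[OF f] del: upt_Suc)
qed

lemma tgt_lab_Ops: "target p A \<in> Ops sOp"
proof -
  have "length (vertices (target p A)) = length (tw_leaves sOp vs)"
    using arg_cong[OF mset_labels_tgt_lab, of size] by simp
  moreover have "proper (length (leaf_numbers (target p A))) (target p A)"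
  proof -
    have "proper (length (leaf_numbers (vs ! 0))) (vs ! 0)"
      using tw_arrowsD(3)[OF f, of 0] by (simp add: Ops_sOp_iff)
    moreover have "mset (leaf_numbers (target p A)) = mset (leaf_numbers (vs ! 0))"
      using mset_leaves_tgt[OF pre_arr_lab] by (simp add: lab_nth)
    moreover from this have "length (leaf_numbers (target p A)) = length (leaf_numbers (vs ! 0))"
      by (rule mset_eq_length)
    ultimately show ?thesis
      by (simp add: proper_def)
  qed
  ultimately show ?thesis
    unfolding Ops_sOp_iff using mset_labels_tgt_lab tw_arrowsD(8)[OF f] by simp
qed

lemma arrow_lab: "arrow p A"
  by (simp add: arrow_def pre_arr_lab tgt_lab_Ops)

text \<open>\<open>tw_target\<close> is a full composite inserted at vertex \<open>1\<close> of the
  lower operation. Relabelling by \<open>\<lambda>\<close> turns this into a substitution into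
  \<open>p\<close>, followed by plugging at the vertex that carries the mark.\<close>

lemma tw_target_lab: "tw_target sOp (p, vs, lam) = target p A"
proof -
  let ?n = "length (vertices p)"
  let ?ls = "tw_leaves sOp vs"
  let ?v = "\<lambda>i. length (vertices (vs ! i))"
  define nss where "nss = map (\<lambda>i. map (\<lambda>k. lam (i, k)) [1..<Suc (?v i)]) [1..<Suc ?n]"
  define ms where "ms = map (\<lambda>k. lam (0, k)) [2..<Suc (?v 0)]"
  note D = tw_arrowsD[OF f]
  have ls: "map lam ?ls = concat nss @ ms"
    by (simp add: map_tw_leaves nss_def ms_def D(2) del: upt_Suc)
  have tl: "tl vs = map (\<lambda>i. vs ! i) [1..<Suc ?n]"
    by (rule nth_equalityI) (use D(2) in \<open>auto simp: nth_tl simp del: upt_Suc\<close>)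
  have tl_nth: "tl vs ! (j - 1) = vs ! j" "nss ! (j - 1) = map (\<lambda>k. lam (j, k)) [1..<Suc (?v j)]"
     if "1 \<le> j" "j \<le> ?n" for j
    using that nth_upt[of 1 "j - 1" "Suc ?n"] by (simp_all add: tl nss_def del: upt_Suc)
  have p: "1 \<le> j \<and> j \<le> ?n" if "(j, n) \<in> set (vertices p)" for j n
  proof -
    have "j \<in> set (labels p)"
      using that by force
    then show ?thesis
      using Ops_sOp_labels[OF D(1)] by auto
  qed
  have composable_family: "composable_family p (tl vs)"
    unfolding composable_family_def
  proof (intro conjI)
    show "mset (labels p) = mset [1..<Suc (length (tl vs))]"
      using D(1,2) by (simp add: Ops_sOp_iff)
    show "\<forall>(j, n)\<in>set (vertices p). proper n (tl vs ! (j - 1))"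
      using D(6) p tl_nth by auto
    show "\<forall>r\<in>set (tl vs). mset (labels r) = mset [1..<Suc (length (vertices r))]"
      using D(3) unfolding tl by (auto simp: Ops_sOp_iff simp del: upt_Suc)
  qed
  have nss: "map length nss = map (\<lambda>r. length (vertices r)) (tl vs)"
    by (simp add: nss_def tl comp_def del: upt_Suc)
  let ?F = "full_comp sOp p (tl vs)"
  \<comment> \<open>The first input colour of the lower operation is the output colour of
    \<open>p\<close>, that is, its number of leaves.\<close>
  have properF: "proper n ?F" if "(1, n) \<in> set (vertices (vs ! 0))" for n
  proof -
    have "n = length (leaf_numbers p)"
      using that D(4) Inp_sOp[OF D(3)[of 0]] by (metis le0)
    then show ?thesis
      using proper_full_comp[OF composable_family nss] D(1) by (simp add: Ops_sOp_iff)
  qed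
  have v0: "mset (labels (vs ! 0)) = mset [1..<Suc (Suc (length ms))]"
  proof -
    have "Suc (length ms) = ?v 0"
      using D(5) by (auto simp: ms_def simp del: upt_Suc)
    then show ?thesis
      using D(3)[of 0] by (simp add: Ops_sOp_iff del: upt_Suc)
  qed
  note ins = map_insert_tree_1[OF v0 labels_full_comp[OF composable_family nss] length_full_comp[OF composable_family nss, symmetric] properF]
  have "tw_target sOp (p, vs, lam) = map_ptree (\<lambda>l. if l \<in> {1..length ?ls} then lam (?ls ! (l - 1)) else l)
      (insert_tree 1 ?F (vs ! 0))"
    by (simp add: tw_target_def Let_def)
  also have "\<dots> = map_ptree (\<lambda>l. (concat nss @ ms) ! (l - 1)) (insert_tree 1 ?F (vs ! 0))"
  proof (rule map_ptree_cong_labels)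
    fix l assume "l \<in> set (labels (insert_tree 1 ?F (vs ! 0)))"
    then have "l \<in> {1..length (concat nss @ ms)}"
      using ins(2) by blast
    then have l: "l \<in> {1..length ?ls}"
      by (metis ls length_map)
    then have "lam (?ls ! (l - 1)) = (concat nss @ ms) ! (l - 1)"
      unfolding ls[symmetric] by auto
    then show "(if l \<in> {1..length ?ls} then lam (?ls ! (l - 1)) else l) = (concat nss @ ms) ! (l - 1)"
      using l by simp
  qed
  also have "\<dots> = subst (\<lambda>j n. if j = 1 then map_ptree (\<lambda>l. concat nss ! (l - 1)) ?F else corolla (ms ! (j - 2)) n) (vs ! 0)"
    by (rule ins(1))
  also have "map_ptree (\<lambda>l. concat nss ! (l - 1)) ?F = subst (\<lambda>j _. A j) p"
    unfolding map_full_comp[OF composable_family nss]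
  proof (rule subst_cong)
    fix j n assume "(j, n) \<in> set (vertices p)"
    then have j: "1 \<le> j" "j \<le> ?n"
      using p by auto
    have "map_ptree (\<lambda>l. nss ! (j - 1) ! (l - 1)) (tl vs ! (j - 1)) = map_ptree (leaf_label lam j) (vs ! j)"
      unfolding tl_nth[OF j]
    proof (rule map_ptree_cong_labels)
      fix l assume "l \<in> set (labels (vs ! j))"
      then have "1 \<le> l" "l \<le> ?v j"
        using Ops_sOp_labels[OF D(3)[OF j(2)]] by auto
      then show "map (\<lambda>k. lam (j, k)) [1..<Suc (?v j)] ! (l - 1) = leaf_label lam j l"
        using j nth_upt[of 1 "l - 1" "Suc (?v j)"] by (simp add: leaf_label_def del: upt_Suc)
    qed
    then show "map_ptree (\<lambda>l. nss ! (j - 1) ! (l - 1)) (tl vs ! (j - 1)) = A j"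
      using lab_nth[OF j(2)] by simp
  qed
  \<comment> \<open>Being vertex \<open>1\<close> and carrying label \<open>0\<close> mean the same
    here, because the values of \<open>\<lambda>\<close> are positive.\<close>
  also have "subst (\<lambda>j n. if j = 1 then subst (\<lambda>j _. A j) p else corolla (ms ! (j - 2)) n) (vs ! 0)
      = subst (\<lambda>j n. if leaf_label lam 0 j = 0 then subst (\<lambda>j _. A j) p else corolla (leaf_label lam 0 j) n) (vs ! 0)"
  proof (rule subst_cong)
    fix j n assume "(j, n) \<in> set (vertices (vs ! 0))"
    then have j: "j \<in> set (labels (vs ! 0))"
      by force
    then have j': "1 \<le> j" "j \<le> ?v 0"
      using Ops_sOp_labels[OF D(3)[of 0]] by auto
    have "ms ! (j - 2) = lam (0, j)" if "j \<noteq> 1"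
    proof -
      have "2 + (j - 2) = j" "2 + (j - 2) < Suc (?v 0)"
        using that j' by auto
      then show ?thesis
        using nth_upt[of 2 "j - 2" "Suc (?v 0)"] by (simp only: ms_def) (subst nth_map, auto simp del: upt_Suc)
    qed
    then show "(if j = 1 then subst (\<lambda>j _. A j) p else corolla (ms ! (j - 2)) n) =
      (if leaf_label lam 0 j = 0 then subst (\<lambda>j _. A j) p else corolla (leaf_label lam 0 j) n)"
      using leaf_label_0_iff[of 0 j] j by (auto simp: leaf_label_def)
  qed
  also have "\<dots> = target p A"
    unfolding target_def plug_def lab_nth[OF le0]
  proof (rule subst_map_ptree[symmetric])
    fix j n assume j: "(j, n) \<in> set (vertices (vs ! 0))"
    then have "j \<in> set (labels (vs ! 0))"
      by force
    then have "n = length (leaf_numbers p)" if "leaf_label lam 0 j = 0"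
      using leaf_label_0_iff[of 0 j] that j D(4) Inp_sOp[OF D(3)[of 0]] by (metis le0 prod.inject)
    then show "set (leaf_numbers (if leaf_label lam 0 j = 0 then subst (\<lambda>j _. A j) p
        else corolla (leaf_label lam 0 j) n)) \<subseteq> {1..n}"
      using proper_set[OF proper_source[OF pre_arr_lab]] by (auto simp del: upt_Suc)
  qed
  finally show ?thesis .
qed

end

section \<open>From families of labelled trees to twisted arrows\<close>

lemma vertex_label: "(j, n) \<in> set (vertices t) \<Longrightarrow> j \<in> set (labels t)"
  by force

lemma Ops_sOp_vertex:
  assumes "p \<in> Ops sOp" "(j, n) \<in> set (vertices p)"
  shows "1 \<le> j" "j \<le> length (vertices p)"
  using vertex_label[OF assms(2)] Ops_sOp_labels[OF assms(1)] by auto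

text \<open>Bijectivity of \<open>\<lambda>\<close> is read off the labels of the target, and its
  monotonicity holds because sorted distinct labels increase strictly. Labels within one tree are
  distinct, so ranks and sorted labels recover the tree.\<close>

lemma
  assumes A: "arrow p A"
  shows std_tw_arrows: "standard p A \<in> tw_arrows sOp"
    and lab_std: "labelling (standard p A) = A"
proof -
  let ?n = "length (vertices p)"
  let ?L = "\<lambda>i. labels (A i)"
  define vs where "vs = map (\<lambda>i. map_ptree (rank (?L i)) (A i)) [0..<Suc ?n]"
  define lam where "lam = (\<lambda>(i, k)\<in>set (tw_leaves sOp vs). sort (?L i) ! (k - 1))"
  have pre: "pre_arrow p A" and t: "target p A \<in> Ops sOp"
    using A by (auto simp: arrow_def)
  have p: "p \<in> Ops sOp" and proper: "\<And>j n. (j, n) \<in> set (vertices p) \<Longrightarrow> proper n (A j)"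
    and A0: "(0, length (leaf_numbers p)) \<in> set (vertices (A 0))" and ext: "A \<in> extensional {0..?n}"
    using pre by (auto simp: pre_arrow_def)
  have standard: "standard p A = (p, vs, lam)"
    by (simp add: standard_def Let_def vs_def lam_def)
  have len: "length vs = Suc ?n"
    by (simp add: vs_def)
  have vs: "vs ! i = map_ptree (rank (?L i)) (A i)" if "i \<le> ?n" for i
    using that unfolding vs_def by (simp add: nth_append del: upt_Suc)
  have lenvs: "length (vertices (vs ! i)) = length (vertices (A i))" if "i \<le> ?n" for i
    by (simp add: vs[OF that] vertices_map_ptree)
  have d: "distinct (?L i)" if "i \<le> ?n" for i
    using arrow_vertices(1)[OF A that] .
  have leaves: "(i, k) \<in> set (tw_leaves sOp vs) \<longleftrightarrow> i \<le> ?n \<and> k \<le> length (?L i) \<and> (if i = 0 then 2 \<le> k else 1 \<le> k)" for i k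
  proof -
    have "vs \<noteq> []"
      using len by auto
    then show ?thesis
      using set_tw_leaves[of vs i k] len lenvs[of i] by (auto split: if_splits)
  qed
  \<comment> \<open>The mark is the least label of \<open>A 0\<close> and becomes vertex
    \<open>1\<close>.\<close>
  have r0: "rank (?L 0) 0 = 1"
  proof -
    have "{y \<in> set (?L 0). y \<le> 0} = {0}"
      using vertex_label[OF A0] by auto
    then show ?thesis
      by (simp add: rank_def)
  qed
  then have s0: "sort (?L 0) ! 0 = 0"
    using sort_rank(3)[OF d[OF le0] vertex_label[OF A0]] by simp
  have lam: "lam (i, k) = sort (?L i) ! (k - 1)" if "(i, k) \<in> set (tw_leaves sOp vs)" for i k
    using that by (simp add: lam_def)
  \<comment> \<open>For \<open>i = 0\<close> this is a global condition: plugging preserves the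
    leaves of \<open>A 0\<close>, so they are those of the target, which is an operation.\<close>
  have prp: "proper (length (leaf_numbers (A i))) (A i)" if "i \<le> ?n" for i
  proof (cases "i = 0")
    case True
    then show ?thesis
      using t mset_leaves_tgt[OF pre] mset_eq_length[OF mset_leaves_tgt[OF pre]]
      by (simp add: Ops_sOp_iff proper_def)
  next
    case False
    then have "proper (Inp sOp p ! (i - 1)) (A i)"
      using proper[OF Inp_sOp_vertex[OF p, of i]] that by auto
    then show ?thesis
      using proper_length by metis
  qed
  have vs_Ops: "vs ! i \<in> Ops sOp" if "i \<le> ?n" for i
    unfolding Ops_sOp_iff lenvs[OF that]
    using mset_map_rank[OF d[OF that]] prp[OF that] by (simp add: vs[OF that] flip: mset_map)
  have "mset (map lam (tw_leaves sOp vs)) = mset (labels (target p A))"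
  proof -
    have upt: "[0..<Suc ?n] = 0 # [1..<Suc ?n]"
      by (subst upt_conv_Cons) simp_all
    have "map lam (tw_leaves sOp vs) = concat (map (\<lambda>i. sort (?L i)) [1..<Suc ?n]) @ tl (sort (?L 0))"
    proof -
      have "map (\<lambda>k. lam (i, k)) [1..<Suc (length (vertices (vs ! i)))] = sort (?L i)"
        if "i \<in> set [1..<Suc ?n]" for i
      proof -
        have i: "1 \<le> i" "i \<le> ?n"
          using that by auto
        have "map (\<lambda>k. lam (i, k)) [1..<Suc (length (vertices (vs ! i)))] =
            map (\<lambda>k. sort (?L i) ! (k - 1)) [1..<Suc (length (sort (?L i)))]"
          using i lenvs[OF i(2)] by (auto simp: leaves lam simp del: upt_Suc)
        then show ?thesis
          by (simp only: map_nth_pred)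
      qed
      moreover have "map (\<lambda>k. lam (0, k)) [2..<Suc (length (vertices (vs ! 0)))] = tl (sort (?L 0))"
        by (rule nth_equalityI) (auto simp: lenvs leaves lam nth_tl simp del: upt_Suc)
      ultimately show ?thesis
        unfolding map_tw_leaves len by (simp only: cong: map_cong)
    qed
    \<comment> \<open>Dropping the mark at the front corresponds to the lower leaves being numbered
      from \<open>2\<close>.\<close>
    moreover have "0 # tl (sort (?L 0)) = sort (?L 0)"
      using s0 vertex_label[OF A0] by (cases "sort (?L 0)") (auto simp del: sort_key_simps dest: arg_cong[of _ _ set])
    ultimately have "add_mset 0 (mset (map lam (tw_leaves sOp vs))) = mset (concat (map (\<lambda>i. sort (?L i)) [1..<Suc ?n])) + mset (sort (?L 0))"
      by (metis mset.simps(2) mset_append union_mset_add_mset_right)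
    also have "\<dots> = mset (concat (map ?L [0..<Suc ?n]))"
      unfolding upt by (simp add: mset_concat_map del: upt_Suc)
    also have "\<dots> = add_mset 0 (mset (labels (target p A)))"
      by (rule mset_labels_tgt[OF pre, symmetric])
    finally show ?thesis
      by (simp only: add_mset_add_mset_same_iff)
  qed
  moreover from this have "length (tw_leaves sOp vs) = length (vertices (target p A))"
    using mset_eq_length by fastforce
  ultimately have lam_mset: "mset (map lam (tw_leaves sOp vs)) = mset [1..<Suc (length (tw_leaves sOp vs))]"
    using t by (simp add: Ops_sOp_iff)
  have "set (map lam (tw_leaves sOp vs)) = {1..length (tw_leaves sOp vs)}" "distinct (map lam (tw_leaves sOp vs))"
    using lam_mset unfolding mset_eq_upt_iff by blast+
  then have bij: "bij_betw lam (set (tw_leaves sOp vs)) {1..length (tw_leaves sOp vs)}"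
    by (simp add: bij_betw_def distinct_map)
  have mono: "lam (i, k) < lam (i, l)"
    if "(i, k) \<in> set (tw_leaves sOp vs)" "(i, l) \<in> set (tw_leaves sOp vs)" "k < l" for i k l
  proof -
    have "sorted_wrt (<) (sort (?L i))"
      using d[of i] that(1) by (simp add: strict_sorted_iff leaves)
    then show ?thesis
      unfolding lam[OF that(1)] lam[OF that(2)]
      using that by (elim sorted_wrt_nth_less) (auto simp: leaves split: if_splits)
  qed
  have v1: "(1, length (leaf_numbers p)) \<in> set (vertices (vs ! 0))"
    using A0 r0 by (force simp: vs vertices_map_ptree)
  have "arity sOp (vs ! 0) = length (vertices (vs ! 0))"
    by (rule sOp_sel(5))
  then have "Inp sOp (vs ! 0) \<noteq> []"
    using v1 by (auto simp del: sOp_sel)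
  moreover have "Inp sOp (vs ! 0) ! 0 = Out sOp p"
    using Inp_sOp[OF vs_Ops[OF le0] v1] by simp
  moreover have "Out sOp (vs ! i) = Inp sOp p ! (i - 1)" if "i \<in> {1..arity sOp p}" for i
  proof -
    have "(i, Inp sOp p ! (i - 1)) \<in> set (vertices p)"
      using that by (intro Inp_sOp_vertex[OF p]) auto
    from proper_length[OF proper[OF this]] show ?thesis
      using that by (simp add: vs)
  qed
  moreover have "set vs \<subseteq> Ops sOp"
    using vs_Ops len by (auto simp: in_set_conv_nth less_Suc_eq_le)
  ultimately show "standard p A \<in> tw_arrows sOp"
    unfolding standard tw_arrows_def using p len bij mono by (auto simp: lam_def)
  show "labelling (standard p A) = A"
    unfolding standard labelling_def split
  proof (rule extensionalityI[OF restrict_extensional ext])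
    fix i assume "i \<in> {0..?n}"
    then have i: "i \<le> ?n"
      by simp
    have "map_ptree (leaf_label lam i) (vs ! i) = map_ptree (\<lambda>x. leaf_label lam i (rank (?L i) x)) (A i)"
      by (simp add: vs[OF i] map_ptree_comp)
    also have "\<dots> = A i"
    proof (rule map_ptree_idI)
      fix x assume x: "x \<in> set (?L i)"
      note r = sort_rank[OF d[OF i] x]
      show "leaf_label lam i (rank (?L i) x) = x"
      proof (cases "(i, rank (?L i) x) = (0, 1)")
        case True
        then have "i = 0" "rank (?L 0) x = 1"
          by auto
        then show ?thesis
          using r(3) s0 by (simp add: leaf_label_def)
      next
        case False
        then have "(i, rank (?L i) x) \<in> set (tw_leaves sOp vs)"
          using r i by (auto simp: leaves)
        then show ?thesis
          using False r by (auto simp: leaf_label_def lam)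
      qed
    qed
    finally show "(\<lambda>i\<in>{0..?n}. map_ptree (leaf_label lam i) (vs ! i)) i = A i"
      using i by simp
  qed
qed

lemma tw_target_std: "arrow p A \<Longrightarrow> tw_target sOp (standard p A) = target p A"
  using tw_target_lab[of p "fst (snd (standard p A))" "snd (snd (standard p A))"] std_tw_arrows[of p A] lab_std[of p A]
  by (simp add: standard_def Let_def)

lemma fst_std [simp]: "fst (standard p A) = p"
  by (simp add: standard_def Let_def)


section \<open>Composition of families of labelled trees\<close>

text \<open>Inside \<open>A 0\<close> the marked vertex has to stay, as the place for
  \<open>p\<close>. The tree \<open>B 0\<close> is not inserted there but lies below the whole of
  \<open>A 0\<close>.\<close>

definition lower_id :: "(nat \<Rightarrow> nat ptree) \<Rightarrow> nat \<Rightarrow> nat \<Rightarrow> nat ptree" where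
  "lower_id B = (\<lambda>j n. if j = 0 then corolla 0 n else B j)"

text \<open>The expanded lower tree of the first arrow fills the mark of \<open>B 0\<close>; the
  mark of the composite is the one that it brings along.\<close>

definition arrow_comp :: "nat ptree \<Rightarrow> (nat \<Rightarrow> nat ptree) \<Rightarrow> (nat \<Rightarrow> nat ptree) \<Rightarrow> nat \<Rightarrow> nat ptree" where
  "arrow_comp p B A = (\<lambda>i\<in>{0..length (vertices p)}.
     if i = 0 then plug (subst (lower_id B) (A 0)) (B 0) else subst (lower_id B) (A i))"

lemma plug_id:
  assumes "0 \<notin> set (labels a)"
  shows "plug P a = a"
  unfolding plug_def by (rule subst_id) (use assms vertex_label in metis)

text \<open>By associativity of substitution both targets are \<open>B 0\<close> with
  \<open>subst (\<lambda>j _. B j) (target p A)\<close> plugged into its mark; for the composite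
  this is the auxiliary fact \<open>RQ\<close>.\<close>

lemma
  assumes A: "arrow p A" and B: "arrow (target p A) B"
  shows arrow_comp: "arrow p (arrow_comp p B A)"
    and tgt_arr_comp: "target p (arrow_comp p B A) = target (target p A) B"
proof -
  let ?n = "length (vertices p)" and ?t = "target p A" and ?m = "length (leaf_numbers p)"
  let ?C = "arrow_comp p B A" and ?E = "lower_id B"
  let ?M = "length (leaf_numbers ?t)"
  have preA: "pre_arrow p A" and t: "?t \<in> Ops sOp" and preB: "pre_arrow ?t B"
    using A B by (auto simp: arrow_def)
  have p: "p \<in> Ops sOp" and properA: "\<And>j n. (j, n) \<in> set (vertices p) \<Longrightarrow> proper n (A j)"
    and A0: "count (mset (labels (A 0))) 0 = 1" "(0, ?m) \<in> set (vertices (A 0))"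
    using preA by (auto simp: pre_arrow_def)
  have properB: "\<And>j n. (j, n) \<in> set (vertices ?t) \<Longrightarrow> proper n (B j)"
    and B0: "count (mset (labels (B 0))) 0 = 1" "(0, ?M) \<in> set (vertices (B 0))"
    using preB by (auto simp: pre_arrow_def)
  have no0: "0 \<notin> set (labels (B j))" if "(j, n) \<in> set (vertices ?t)" for j n
    using Ops_sOp_vertex[OF t that] arrow_vertices(2)[OF B, of j 0] by auto
  note vA = arrow_vertices(2)[OF A]
  have E: "proper n (?E j n)" if "i \<le> ?n" "(j, n) \<in> set (vertices (A i))" for i j n
    using vA[OF that] properB[of j n] by (auto simp: lower_id_def)
  have E': "set (leaf_numbers (?E j n)) \<subseteq> {1..n}"
    if "i \<le> ?n" "(j, n) \<in> set (vertices (A i))" for i j n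
    using proper_set[OF E[OF that]] by simp
  let ?Q = "subst ?E (A 0)"
  have "mset (leaf_numbers ?Q) = mset (leaf_numbers (A 0))"
    by (rule mset_leaves_subst) (rule E[OF le0])
  then have Q: "proper ?M ?Q"
    using t mset_leaves_tgt[OF preA] by (simp add: Ops_sOp_iff proper_def)
  \<comment> \<open>\<open>VB\<close> and \<open>VA\<close> collect the unmarked vertices. They
    serve to show that \<open>?C 0\<close> has exactly one mark, the one coming from
    \<open>A 0\<close>.\<close>
  obtain VB where VB: "mset (vertices (B 0)) = add_mset (0, ?M) VB" "\<And>n. (0, n) \<notin># VB"
    using unique_vertex_0[OF B0] by metis
  obtain VA where VA: "mset (vertices (A 0)) = add_mset (0, ?m) VA" "\<And>n. (0, n) \<notin># VA"
    using unique_vertex_0[OF A0] by metis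
  have C0: "?C 0 = plug ?Q (B 0)"
    by (simp add: arrow_comp_def)
  have vC0: "mset (vertices (?C 0)) = VB + mset (vertices ?Q)"
    using mset_plug[OF B0 Q] VB by (simp add: C0)
  have "mset (vertices ?Q) = (\<Sum>(j, n)\<in>#mset (vertices (A 0)). mset (vertices (?E j n)))"
    by (rule mset_vertices_subst) (rule E[OF le0])
  then have vQ: "mset (vertices ?Q) = add_mset (0, ?m) (\<Sum>(j, n)\<in>#VA. mset (vertices (?E j n)))"
    by (simp add: VA(1)) (simp add: lower_id_def)
  have zVB: "0 \<notin># image_mset fst VB"
    using VB(2) by auto
  have zVA: "0 \<notin># image_mset fst (\<Sum>(j, n)\<in>#VA. mset (vertices (?E j n)))"
  proof
    assume "0 \<in># image_mset fst (\<Sum>(j, n)\<in>#VA. mset (vertices (?E j n)))"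
    then obtain j n m where jn: "(j, n) \<in># VA" "(0, m) \<in> set (vertices (?E j n))"
      by auto
    then have "j \<noteq> 0"
      using VA(2) by metis
    moreover have "(j, n) \<in> set (vertices (A 0))"
      using jn VA(1) by (metis insertCI set_mset_add_mset_insert set_mset_mset)
    ultimately have "(j, n) \<in> set (vertices ?t)" "(0, m) \<in> set (vertices (B j))"
      using vA[OF le0] jn(2) by (auto simp: lower_id_def)
    then show False
      using no0 vertex_label by metis
  qed
  have "count (mset (labels (?C 0))) 0 = 1"
  proof -
    have "count (image_mset fst VB) 0 = 0"
      "count (image_mset fst (\<Sum>(j, n)\<in>#VA. mset (vertices (?E j n)))) 0 = 0"
      using zVB zVA by (simp_all only: not_in_iff)
    then show ?thesis
      by (simp add: vC0 vQ)
  qed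
  moreover have "(0, ?m) \<in># mset (vertices (?C 0))"
    by (simp only: vC0 vQ) simp
  moreover have Cj: "?C j = subst ?E (A j)" if "(j, n) \<in> set (vertices p)" for j n
    using Ops_sOp_vertex[OF p that] by (simp add: arrow_comp_def)
  moreover have "proper n (subst ?E (A j))" if "(j, n) \<in> set (vertices p)" for j n
  proof -
    have "proper n (subst ?E (A j)) = proper n (A j)"
      by (rule proper_subst) (use E Ops_sOp_vertex(2)[OF p that] in blast)
    then show ?thesis
      using properA[OF that] by simp
  qed
  ultimately have pre: "pre_arrow p ?C"
    unfolding pre_arrow_def using p by (auto simp: arrow_comp_def simp flip: mset_map)
  let ?P = "subst (\<lambda>j _. A j) p" and ?R = "subst (\<lambda>j _. ?C j) p"
  have P: "proper ?m ?P" and R: "proper ?m ?R"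
    using proper_source[OF preA] proper_source[OF pre] by auto
  have vP: "j \<noteq> 0 \<and> (j, n) \<in> set (vertices ?t)" if "(j, n) \<in> set (vertices ?P)" for j n
  proof -
    have "mset (vertices ?P) = (\<Sum>(j, n)\<in>#mset (vertices p). mset (vertices (A j)))"
      by (rule mset_vertices_subst) (rule properA)
    then have "(j, n) \<in># (\<Sum>(j, n)\<in>#mset (vertices p). mset (vertices (A j)))"
      using that by (metis set_mset_mset)
    then obtain i k where "(i, k) \<in> set (vertices p)" "(j, n) \<in> set (vertices (A i))"
      by auto
    then show ?thesis
      using vA[of i j n] Ops_sOp_vertex[OF p, of i k] by auto
  qed
  have R_eq: "?R = subst ?E ?P"
  proof -
    have "subst ?E ?P = subst (\<lambda>j _. subst ?E (A j)) p"
      by (rule subst_subst) (use properA proper_set E' Ops_sOp_vertex(2)[OF p] in blast)+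
    also have "\<dots> = ?R"
      by (rule subst_cong) (simp add: Cj)
    finally show ?thesis ..
  qed
  have inA0: "j \<noteq> 0 \<Longrightarrow> (j, n) \<in> set (vertices ?t)" "j = 0 \<Longrightarrow> n = ?m"
    if "(j, n) \<in> set (vertices (A 0))" for j n
    using vA[OF le0 that] by auto
  \<comment> \<open>Expanding the vertices of \<open>A 0\<close> and then filling its mark agrees
    with filling the mark and then expanding, because the inserted trees \<open>B j\<close> contain
    no mark and plugging leaves them alone.\<close>
  have RQ: "plug ?R ?Q = subst (\<lambda>j _. B j) ?t"
  proof -
    let ?h = "\<lambda>j n. if j = 0 then ?R else corolla j n"
    have "plug ?R ?Q = subst (\<lambda>j n. subst ?h (?E j n)) (A 0)"
      unfolding plug_def
    proof (rule subst_subst[OF E'[OF le0]])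
      fix v n w m assume v: "(v, n) \<in> set (vertices (A 0))" and w: "(w, m) \<in> set (vertices (?E v n))"
      have "w = 0 \<Longrightarrow> m = ?m"
        using w inA0[OF v] no0[of v n] vertex_label[of w m] by (cases "v = 0") (auto simp: lower_id_def)
      then show "set (leaf_numbers (?h w m)) \<subseteq> {1..m}"
        using proper_set[OF R] by auto
    qed
    also have "\<dots> = subst (\<lambda>j n. subst (\<lambda>j _. B j) (if j = 0 then ?P else corolla j n)) (A 0)"
    proof (rule subst_cong)
      fix j n assume j: "(j, n) \<in> set (vertices (A 0))"
      show "subst ?h (?E j n) = subst (\<lambda>j _. B j) (if j = 0 then ?P else corolla j n)"
      proof (cases "j = 0")
        case True
        then have "subst ?h (?E j n) = ?R"
          using inA0(2)[OF j] proper_set[OF R] by (simp add: lower_id_def subst_corolla)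
        also have "\<dots> = subst (\<lambda>j _. B j) ?P"
          unfolding R_eq by (rule subst_cong) (use vP in \<open>auto simp: lower_id_def\<close>)
        finally show ?thesis
          using True by simp
      next
        case False
        have "subst ?h (B j) = B j"
          using plug_id[OF no0[OF inA0(1)[OF j False]], of ?R] by (simp add: plug_def)
        moreover have "subst (\<lambda>j _. B j) (corolla j n) = B j"
          using proper_set[OF properB[OF inA0(1)[OF j False]]] by (intro subst_corolla) auto
        ultimately show ?thesis
          using False by (simp add: lower_id_def)
      qed
    qed
    also have "\<dots> = subst (\<lambda>j _. B j) ?t"
      unfolding target_def plug_def
    proof (rule subst_subst[symmetric])
      fix v n assume v: "(v, n) \<in> set (vertices (A 0))"
      show "set (leaf_numbers (if v = 0 then ?P else corolla v n)) \<subseteq> {1..n}"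
        using inA0[OF v] proper_set[OF P] by (auto simp: subset_iff)
      fix w m assume "(w, m) \<in> set (vertices (if v = 0 then ?P else corolla v n))"
      then have "(w, m) \<in> set (vertices ?t)"
        using vP inA0[OF v] by (auto split: if_splits)
      then show "set (leaf_numbers (B w)) \<subseteq> {1..m}"
        using proper_set[OF properB] by blast
    qed
    finally show ?thesis .
  qed
  show target: "target p ?C = target ?t B"
  proof -
    let ?h = "\<lambda>P j n. if j = 0 then P else corolla j n"
    have B0': "n = ?M" if "(0, n) \<in> set (vertices (B 0))" for n
      using arrow_vertices(2)[OF B le0 that] by simp
    have Q0: "n = ?m" if "(0, n) \<in> set (vertices ?Q)" for n
    proof -
      have "(0, n) \<in># add_mset (0, ?m) (\<Sum>(j, n)\<in>#VA. mset (vertices (?E j n)))"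
        using that vQ by (metis set_mset_mset)
      then show ?thesis
        using zVA by force
    qed
    have "target p ?C = plug ?R (plug ?Q (B 0))"
      by (simp add: target_def C0)
    also have "\<dots> = subst (\<lambda>j n. subst (?h ?R) (?h ?Q j n)) (B 0)"
      unfolding plug_def
    proof (rule subst_subst)
      fix v n assume v: "(v, n) \<in> set (vertices (B 0))"
      show "set (leaf_numbers (?h ?Q v n)) \<subseteq> {1..n}"
        using B0' v proper_set[OF Q] by (auto simp: subset_iff)
      fix w m assume "(w, m) \<in> set (vertices (?h ?Q v n))"
      then have "w = 0 \<Longrightarrow> m = ?m"
        using Q0 by (auto split: if_splits)
      then show "set (leaf_numbers (?h ?R w m)) \<subseteq> {1..m}"
        using proper_set[OF R] by (auto simp: subset_iff)
    qed
    also have "\<dots> = subst (?h (subst (\<lambda>j _. B j) ?t)) (B 0)"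
    proof (rule subst_cong)
      fix v n
      have "subst (?h ?R) (corolla v n) = corolla v n" if "v \<noteq> 0"
        using that by (intro trans[OF subst_corolla]) auto
      then show "subst (?h ?R) (?h ?Q v n) = ?h (subst (\<lambda>j _. B j) ?t) v n"
        using RQ by (simp add: plug_def)
    qed
    finally show ?thesis
      by (simp only: target_def[of ?t] plug_def)
  qed
  show "arrow p ?C"
    using pre target B by (simp add: arrow_def)
qed

section \<open>Composites of twisted arrows in terms of labelled trees\<close>

text \<open>The rank of a number within \<open>L\<close> is its rank among the labels after
  relabelling, so sorting the inputs is the normalisation performed by
  \<open>standard\<close>.\<close>

lemma sort_inputs_relabel:
  assumes X: "set (labels X) \<subseteq> {1..length L}" and C: "C = map_ptree (\<lambda>l. L ! (l - 1)) X"
    and L: "mset (labels C) = mset L"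
  shows "sort_inputs sOp L X = map_ptree (rank (labels C)) C" "sort (labels C) = sort L"
proof -
  have "set (labels C) = set L"
    using L by (rule mset_eq_setD)
  then have "rank (labels C) = rank L"
    by (simp add: rank_def fun_eq_iff)
  then have "map_ptree (rank (labels C)) C = map_ptree (\<lambda>l. rank L (L ! (l - 1))) X"
    by (simp add: C map_ptree_comp)
  also have "\<dots> = sort_inputs sOp L X"
    unfolding sort_inputs_def sOp_sel rank_def
    by (rule map_ptree_cong_labels) (use X in auto)
  finally show "sort_inputs sOp L X = map_ptree (rank (labels C)) C" ..
  show "sort (labels C) = sort L"
    using L by (intro properties_for_sort) (auto simp: mset_sort)
qed

lemma map_upt_nth: "1 \<le> l \<Longrightarrow> l \<le> n \<Longrightarrow> map f [1..<Suc n] ! (l - 1) = f l"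
  using nth_upt[of 1 "l - 1" "Suc n"] by (simp del: upt_Suc)

lemma map_upt2_nth:
  assumes "2 \<le> l" "l \<le> n"
  shows "map f [2..<Suc n] ! (l - 2) = f l"
proof -
  obtain k where "l = k + 2"
    using assms(1) by (metis le_add_diff_inverse2)
  then show ?thesis
    using nth_upt[of 2 k "Suc n"] assms(2) by (simp add: add.commute del: upt_Suc)
qed

text \<open>Before sorting, a vertex of a composite in \<open>Tw sOp\<close> is a full composite
  whose inputs carry the numbers \<open>num\<close>; labelling it by them cancels the offsets and
  leaves the substitution in \<open>arrow_comp\<close>. For the lower vertex an insertion at vertex
  \<open>1\<close> comes on top.\<close>

lemma
  assumes f: "(p, vs, lam) \<in> tw_arrows sOp" and g: "(t, ws, mu) \<in> tw_arrows sOp"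
    and t: "tw_target sOp (p, vs, lam) = t" and i: "i \<le> length (vertices p)"
  defines "num \<equiv> tw_numbers sOp vs lam ws mu i" and "X \<equiv> tw_vertex sOp vs lam ws i"
    and "C \<equiv> arrow_comp p (labelling (t, ws, mu)) (labelling (p, vs, lam)) i"
  shows arrow_comp_relabel: "C = map_ptree (\<lambda>l. num ! (l - 1)) X"
    and mset_labels_arr_comp: "mset (labels C) = mset num"
    and labels_tw_vertex: "set (labels X) \<subseteq> {1..length num}"
proof -
  let ?A = "labelling (p, vs, lam)" and ?B = "labelling (t, ws, mu)"
  let ?v = "\<lambda>i. length (vertices (vs ! i))" and ?w = "\<lambda>i. length (vertices (ws ! i))"
  note Df = tw_arrowsD[OF f] and Dg = tw_arrowsD[OF g]
  note vA = arrow_vertices(2)[OF arrow_lab[OF f]]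
  have tA: "target p ?A = t"
    using tw_target_lab[OF f] t by simp
  have vt: "leaf_label lam i j \<noteq> 0 \<Longrightarrow> (leaf_label lam i j, n) \<in> set (vertices t)"
    and vt0: "leaf_label lam i j = 0 \<Longrightarrow> i = 0 \<and> n = length (leaf_numbers p)"
    if "(j, n) \<in> set (vertices (vs ! i))" for j n
  proof -
    have "(leaf_label lam i j, n) \<in> set (vertices (?A i))"
      using that by (force simp: lab_nth[OF f i] vertices_map_ptree)
    from vA[OF i this] show "leaf_label lam i j \<noteq> 0 \<Longrightarrow> (leaf_label lam i j, n) \<in> set (vertices t)"
      "leaf_label lam i j = 0 \<Longrightarrow> i = 0 \<and> n = length (leaf_numbers p)"
      by (auto simp: tA)
  qed
  have B: "?B r = map_ptree (\<lambda>l. map (\<lambda>l. mu (r, l)) [1..<Suc (?w r)] ! (l - 1)) (ws ! r)"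
    if "(r, n) \<in> set (vertices t)" for r n
  proof -
    note r = Ops_sOp_vertex[OF Dg(1) that]
    show ?thesis
      unfolding lab_nth[OF g r(2)]
    proof (rule map_ptree_cong_labels)
      fix l assume "l \<in> set (labels (ws ! r))"
      then have "1 \<le> l" "l \<le> ?w r"
        using Ops_sOp_labels[OF Dg(3)[OF r(2)]] by auto
      then show "leaf_label mu r l = map (\<lambda>l. mu (r, l)) [1..<Suc (?w r)] ! (l - 1)"
        using r(1) by (simp only: map_upt_nth) (simp add: leaf_label_def)
    qed
  qed
  have ws: "mset (labels (ws ! r)) = mset [1..<Suc (?w r)]" "proper n (ws ! r)"
    if "(r, n) \<in> set (vertices t)" for r n
    using Dg(3)[OF Ops_sOp_vertex(2)[OF Dg(1) that]] Dg(6)[OF that] by (auto simp: Ops_sOp_iff)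
  have vs: "mset (labels (vs ! i)) = mset [1..<Suc (?v i)]"
    using Df(3)[OF i] by (simp add: Ops_sOp_iff)
  have vs1: "1 \<le> j" "j \<le> ?v i" if "(j, n) \<in> set (vertices (vs ! i))" for j n
    using Ops_sOp_vertex[OF Df(3)[OF i] that] by auto
  have lower: "set (leaf_numbers (lower_id ?B (leaf_label lam i j) n)) \<subseteq> {1..n}"
    if "(j, n) \<in> set (vertices (vs ! i))" for j n
    using proper_set[OF ws(2)[OF vt[OF that]]] B[OF vt[OF that]] by (auto simp: lower_id_def)
  have A_sub: "subst (lower_id ?B) (?A i) = subst (\<lambda>j. lower_id ?B (leaf_label lam i j)) (vs ! i)"
    unfolding lab_nth[OF f i] by (rule subst_map_ptree) (rule lower)
  have "C = map_ptree (\<lambda>l. num ! (l - 1)) X \<and> mset (labels C) = mset num \<and> set (labels X) \<subseteq> {1..length num}"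
  proof (cases "i = 0")
    \<comment> \<open>Upper vertices: no mark occurs, and the input \<open>j\<close> of
      \<open>vs ! i\<close> receives \<open>ws ! lam (i, j)\<close>.\<close>
    case False
    then have ll: "leaf_label lam i j = lam (i, j)" for j
      by (simp add: leaf_label_def)
    define rs where "rs = map (\<lambda>k. ws ! lam (i, k)) [1..<Suc (?v i)]"
    define nss where "nss = map (\<lambda>k. map (\<lambda>l. mu (lam (i, k), l)) [1..<Suc (?w (lam (i, k)))]) [1..<Suc (?v i)]"
    have X: "X = full_comp sOp (vs ! i) rs" and num: "num = concat nss"
      using False by (simp_all add: X_def num_def tw_vertex_def tw_numbers_def rs_def nss_def del: upt_Suc)
    have vtx: "(lam (i, j), n) \<in> set (vertices t)" if "(j, n) \<in> set (vertices (vs ! i))" for j n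
      using vt[OF that] vt0[OF that] False by (auto simp: ll)
    have vtx': "\<exists>n. (lam (i, j), n) \<in> set (vertices t)" if "1 \<le> j" "j \<le> ?v i" for j
      using vtx[OF Inp_sOp_vertex[OF Df(3)[OF i] that]] by blast
    have composable_family: "composable_family (vs ! i) rs"
      unfolding composable_family_def
    proof (intro conjI)
      show "mset (labels (vs ! i)) = mset [1..<Suc (length rs)]"
        using vs by (simp add: rs_def del: upt_Suc)
      show "\<forall>(j, n)\<in>set (vertices (vs ! i)). proper n (rs ! (j - 1))"
        using vs1 ws(2)[OF vtx] by (auto simp only: rs_def map_upt_nth)
      show "\<forall>r\<in>set rs. mset (labels r) = mset [1..<Suc (length (vertices r))]"
      proof
        fix r assume "r \<in> set rs"
        then obtain j where "r = ws ! lam (i, j)" "1 \<le> j" "j \<le> ?v i"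
          by (auto simp: rs_def simp del: upt_Suc)
        then show "mset (labels r) = mset [1..<Suc (length (vertices r))]"
          using ws(1) vtx' by blast
      qed
    qed
    have nss: "map length nss = map (\<lambda>r. length (vertices r)) rs"
      by (simp add: nss_def rs_def comp_def del: upt_Suc)
    have C: "C = subst (\<lambda>j n. map_ptree (\<lambda>l. nss ! (j - 1) ! (l - 1)) (rs ! (j - 1))) (vs ! i)"
    proof -
      have "C = subst (\<lambda>j. lower_id ?B (leaf_label lam i j)) (vs ! i)"
        using False i A_sub by (simp add: C_def arrow_comp_def)
      also have "\<dots> = subst (\<lambda>j n. map_ptree (\<lambda>l. nss ! (j - 1) ! (l - 1)) (rs ! (j - 1))) (vs ! i)"
      proof (rule subst_cong)
        fix j n assume j: "(j, n) \<in> set (vertices (vs ! i))"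
        have "lam (i, j) \<noteq> 0"
          using vt0[OF j] False by (auto simp: ll)
        then show "lower_id ?B (leaf_label lam i j) n = map_ptree (\<lambda>l. nss ! (j - 1) ! (l - 1)) (rs ! (j - 1))"
          unfolding nss_def rs_def map_upt_nth[OF vs1[OF j]] using B[OF vtx[OF j]] by (simp add: lower_id_def ll del: upt_Suc)
      qed
      finally show ?thesis .
    qed
    show ?thesis
      unfolding C X num using map_full_comp[OF composable_family nss] mset_full_comp[OF composable_family nss] labels_full_comp[OF composable_family nss]
      by (intro conjI; (simp only:)?)
  next
    case True
    let ?c = "Inp sOp (vs ! 0) ! 0"
    have c: "?c = length (leaf_numbers p)"
      using Inp_sOp[OF Df(3)[OF le0] Df(4)] by simp
    have v1: "1 \<le> ?v 0"
      by (rule Df(5))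
    \<comment> \<open>The unit in first place lets the input reserved for \<open>p\<close> pass
      unchanged through the full composite; its block of numbers in \<open>nss\<close> is
      \<open>[0]\<close>, the mark.\<close>
    define rs where "rs = corolla 1 ?c # map (\<lambda>k. ws ! lam (0, k)) [2..<Suc (?v 0)]"
    define nss where "nss = [0] # map (\<lambda>k. map (\<lambda>l. mu (lam (0, k), l)) [1..<Suc (?w (lam (0, k)))]) [2..<Suc (?v 0)]"
    define ms where "ms = map (\<lambda>l. mu (0, l)) [2..<Suc (?w 0)]"
    let ?F = "full_comp sOp (vs ! 0) rs"
    have X: "X = insert_tree 1 ?F (ws ! 0)" and num: "num = concat nss @ ms"
      using True by (simp_all add: X_def num_def tw_vertex_def tw_numbers_def rs_def nss_def ms_def del: upt_Suc)
    have lrs: "length rs = ?v 0"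
      using v1 by (simp add: rs_def del: upt_Suc)
    have nth: "rs ! (j - 1) = ws ! lam (0, j)"
      "nss ! (j - 1) = map (\<lambda>l. mu (lam (0, j), l)) [1..<Suc (?w (lam (0, j)))]" if "2 \<le> j" "j \<le> ?v 0" for j
    proof -
      have j: "j - 1 = Suc (j - 2)"
        using that by simp
      show "rs ! (j - 1) = ws ! lam (0, j)"
      "nss ! (j - 1) = map (\<lambda>l. mu (lam (0, j), l)) [1..<Suc (?w (lam (0, j)))]"
        unfolding rs_def nss_def j nth_Cons_Suc map_upt2_nth[OF that] by (rule refl)+
    qed
    have ll: "leaf_label lam 0 j = lam (0, j)" if "2 \<le> j" for j
      using that by (simp add: leaf_label_def)
    have vtx: "(lam (0, j), n) \<in> set (vertices t)"
      if "(j, n) \<in> set (vertices (vs ! 0))" "2 \<le> j" for j n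
    proof -
      have "j \<in> set (labels (vs ! 0))"
        by (rule vertex_label[OF that(1)])
      then have "leaf_label lam 0 j \<noteq> 0"
        using leaf_label_0_iff[OF f le0] that(2) by auto
      then show ?thesis
        using vt[of j n] that True ll by simp
    qed
    have vtx': "\<exists>n. (lam (0, j), n) \<in> set (vertices t)" if "2 \<le> j" "j \<le> ?v 0" for j
      using vtx[OF Inp_sOp_vertex[OF Df(3)[OF le0]], of j] that by auto
    have n1: "n = ?c" if "(1, n) \<in> set (vertices (vs ! 0))" for n
      using Inp_sOp[OF Df(3)[OF le0] that] by simp
    have j12: "j = 1 \<or> 2 \<le> j \<and> j \<le> ?v 0" if "(j, n) \<in> set (vertices (vs ! 0))" for j n
      using vs1[of j n] that True by auto
    have composable_family: "composable_family (vs ! 0) rs"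
      unfolding composable_family_def
    proof (intro conjI)
      show "mset (labels (vs ! 0)) = mset [1..<Suc (length rs)]"
        using vs True lrs by simp
      show "\<forall>(j, n)\<in>set (vertices (vs ! 0)). proper n (rs ! (j - 1))"
      proof clarify
        fix j n assume j: "(j, n) \<in> set (vertices (vs ! 0))"
        from j12[OF j] show "proper n (rs ! (j - 1))"
        proof
          assume "j = 1"
          then show ?thesis
            using n1 j by (simp add: rs_def)
        next
          assume "2 \<le> j \<and> j \<le> ?v 0"
          then show ?thesis
            using nth(1)[of j] ws(2)[OF vtx[OF j]] by simp
        qed
      qed
      show "\<forall>r\<in>set rs. mset (labels r) = mset [1..<Suc (length (vertices r))]"
      proof
        fix r assume "r \<in> set rs"
        then consider "r = corolla 1 ?c" | j where "r = ws ! lam (0, j)" "2 \<le> j" "j \<le> ?v 0"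
          by (auto simp: rs_def simp del: upt_Suc)
        then show "mset (labels r) = mset [1..<Suc (length (vertices r))]"
        proof cases
          case 2
          then show ?thesis
            using ws(1) vtx' by blast
        qed simp
      qed
    qed
    have nss: "map length nss = map (\<lambda>r. length (vertices r)) rs"
      by (simp add: nss_def rs_def comp_def del: upt_Suc)
    have nss0: "nss ! (1 - 1) = [0]" "rs ! (1 - 1) = corolla 1 ?c"
      by (simp_all add: nss_def rs_def)
    have w1: "1 \<le> ?w 0"
      by (rule Dg(5))
    have w0: "mset (labels (ws ! 0)) = mset [1..<Suc (Suc (length ms))]"
    proof -
      have "Suc (length ms) = ?w 0"
        using w1 by (auto simp: ms_def simp del: upt_Suc)
      then show ?thesis
        using Dg(3)[of 0] by (simp add: Ops_sOp_iff del: upt_Suc)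
    qed
    have properv: "proper (length (leaf_numbers (vs ! 0))) (vs ! 0)"
      using Df(3)[OF le0] by (simp add: Ops_sOp_iff)
    have "mset (leaf_numbers t) = mset (leaf_numbers (vs ! 0))"
      using mset_leaves_tgt[OF pre_arr_lab[OF f]] by (simp add: tA lab_nth[OF f])
    then have lt: "length (leaf_numbers t) = length (leaf_numbers (vs ! 0))"
      by (rule mset_eq_length)
    \<comment> \<open>The first input colour of \<open>ws ! 0\<close> is the number of leaves of
      \<open>t\<close>, and these are the leaves of \<open>vs ! 0\<close>.\<close>
    have properF: "proper n ?F" if "(1, n) \<in> set (vertices (ws ! 0))" for n
      using Inp_sOp[OF Dg(3)[OF le0] that] Inp_sOp[OF Dg(3)[OF le0] Dg(4)] proper_full_comp[OF composable_family nss] properv lt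
      by simp
    note ins = map_insert_tree_1[OF w0 labels_full_comp[OF composable_family nss] length_full_comp[OF composable_family nss, symmetric] properF]
    have F: "map_ptree (\<lambda>l. concat nss ! (l - 1)) ?F = subst (lower_id ?B) (?A 0)"
    proof -
      have "subst (lower_id ?B) (?A 0) = subst (\<lambda>j. lower_id ?B (leaf_label lam 0 j)) (vs ! 0)"
        using A_sub True by simp
      also have "\<dots> = subst (\<lambda>j n. map_ptree (\<lambda>l. nss ! (j - 1) ! (l - 1)) (rs ! (j - 1))) (vs ! 0)"
      proof (rule subst_cong)
        fix j n assume j: "(j, n) \<in> set (vertices (vs ! 0))"
        from j12[OF j] show "lower_id ?B (leaf_label lam 0 j) n =
          map_ptree (\<lambda>l. nss ! (j - 1) ! (l - 1)) (rs ! (j - 1))"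
        proof
          assume "j = 1"
          then show ?thesis
            using n1[of n] j by (simp only: nss0) (simp add: lower_id_def leaf_label_def)
        next
          assume j2: "2 \<le> j \<and> j \<le> ?v 0"
          have "lam (0, j) \<noteq> 0"
            using Ops_sOp_vertex(1)[OF Dg(1) vtx[OF j]] j2 by auto
          then show ?thesis
            using j2 nth[of j] B[OF vtx[OF j]] by (simp add: lower_id_def ll del: upt_Suc)
        qed
      qed
      also have "\<dots> = map_ptree (\<lambda>l. concat nss ! (l - 1)) ?F"
        by (rule map_full_comp[OF composable_family nss, symmetric])
      finally show ?thesis ..
    qed
    have C: "C = plug (subst (lower_id ?B) (?A 0)) (?B 0)"
      using True by (simp add: C_def arrow_comp_def)
    have B0: "?B 0 = map_ptree (leaf_label mu 0) (ws ! 0)"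
      by (rule lab_nth[OF g le0])
    have Cnum: "C = map_ptree (\<lambda>l. num ! (l - 1)) X"
    proof -
      let ?Q = "subst (lower_id ?B) (?A 0)"
      have Q: "proper n ?Q" if "(1, n) \<in> set (vertices (ws ! 0))" for n
        using properF[OF that] unfolding F[symmetric] by simp
      have "C = subst (\<lambda>j n. if leaf_label mu 0 j = 0 then ?Q else corolla (leaf_label mu 0 j) n) (ws ! 0)"
        unfolding C B0 plug_def
      proof (rule subst_map_ptree)
        fix j n assume j: "(j, n) \<in> set (vertices (ws ! 0))"
        show "set (leaf_numbers (if leaf_label mu 0 j = 0 then ?Q else corolla (leaf_label mu 0 j) n)) \<subseteq> {1..n}"
          using leaf_label_0_iff[OF g le0 vertex_label[OF j]] Q[of n] j proper_set[of n ?Q] by auto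
      qed
      also have "\<dots> = subst (\<lambda>j n. if j = 1 then ?Q else corolla (ms ! (j - 2)) n) (ws ! 0)"
      proof (rule subst_cong)
        fix j n assume j: "(j, n) \<in> set (vertices (ws ! 0))"
        have "ms ! (j - 2) = leaf_label mu 0 j" if "j \<noteq> 1"
        proof -
          have "2 \<le> j" "j \<le> ?w 0"
            using Ops_sOp_vertex[OF Dg(3)[OF le0] j] that by auto
          then show ?thesis
            unfolding ms_def using that by (simp only: map_upt2_nth) (simp add: leaf_label_def)
        qed
        then show "(if leaf_label mu 0 j = 0 then ?Q else corolla (leaf_label mu 0 j) n) =
          (if j = 1 then ?Q else corolla (ms ! (j - 2)) n)"
          using leaf_label_0_iff[OF g le0 vertex_label[OF j]] by auto
      qed
      also have "\<dots> = map_ptree (\<lambda>l. num ! (l - 1)) X"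
        unfolding X num F[symmetric] by (rule ins(1)[symmetric])
      finally show ?thesis .
    qed
    have "mset (labels C) = mset num"
    proof -
      let ?Q = "subst (lower_id ?B) (?A 0)"
      have "mset (labels ?Q) = mset (concat nss)"
        using mset_full_comp[OF composable_family nss] unfolding F[symmetric] map_full_comp[OF composable_family nss] .
      have pB: "count (mset (labels (?B 0))) 0 = 1" "(0, length (leaf_numbers t)) \<in> set (vertices (?B 0))"
        using pre_arr_lab[OF g] by (auto simp: pre_arrow_def)
      have pQ: "proper (length (leaf_numbers t)) ?Q"
        unfolding F[symmetric] using proper_full_comp[OF composable_family nss] properv lt by simp
      \<comment> \<open>Plugging consumes the mark of \<open>?B 0\<close>; the mark that remains is
        the entry \<open>0\<close> at the head of \<open>concat nss\<close>.\<close>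
      have "add_mset 0 (mset (labels C)) = mset (labels (?B 0)) + mset (labels ?Q)"
        using arg_cong[OF mset_plug[OF pB pQ], of "image_mset fst"] by (simp add: C)
      also have "mset (labels ?Q) = mset (concat nss)"
        by fact
      also have "mset (labels (?B 0)) = mset (0 # ms)"
      proof -
        have "[1..<Suc (?w 0)] = 1 # [2..<Suc (?w 0)]"
          using w1 by (subst upt_conv_Cons) (auto simp add: numeral_2_eq_2 simp del: upt_Suc)
        then have "map (leaf_label mu 0) [1..<Suc (?w 0)] = 0 # ms"
          by (simp add: ms_def leaf_label_def del: upt_Suc)
        then show ?thesis
          using mset_labels_lab[OF g le0] by simp
      qed
      finally show ?thesis
        by (simp add: num)
    qed
    then show ?thesis
      using Cnum ins(2) unfolding X num by blast
  qed
  then show "C = map_ptree (\<lambda>l. num ! (l - 1)) X" "mset (labels C) = mset num" "set (labels X) \<subseteq> {1..length num}"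
    by blast+
qed

lemma tw_composite_lab:
  assumes f: "(p, vs, lam) \<in> tw_arrows sOp" and g: "(t, ws, mu) \<in> tw_arrows sOp"
    and t: "tw_target sOp (p, vs, lam) = t"
  shows "tw_composite sOp (t, ws, mu) (p, vs, lam) = standard p (arrow_comp p (labelling (t, ws, mu)) (labelling (p, vs, lam)))"
proof -
  let ?n = "length (vertices p)"
  let ?C = "arrow_comp p (labelling (t, ws, mu)) (labelling (p, vs, lam))"
  let ?num = "tw_numbers sOp vs lam ws mu"
  define us where "us = map (\<lambda>i. map_ptree (rank (labels (?C i))) (?C i)) [0..<Suc ?n]"
  have *: "sort_inputs sOp (?num i) (tw_vertex sOp vs lam ws i) = map_ptree (rank (labels (?C i))) (?C i)"
    "sort (labels (?C i)) = sort (?num i)" if "i \<le> ?n" for i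
    using sort_inputs_relabel[OF labels_tw_vertex[OF f g t that] arrow_comp_relabel[OF f g t that]
      mset_labels_arr_comp[OF f g t that]] by auto
  have us: "[sort_inputs sOp (?num i) (tw_vertex sOp vs lam ws i). i \<leftarrow> [0..<length vs]] = us"
    unfolding us_def tw_arrowsD(2)[OF f] by (rule map_cong[OF refl], rule *(1)) auto
  have "(\<lambda>(i, k)\<in>set (tw_leaves sOp us). sort (?num i) ! (k - 1)) =
     (\<lambda>(i, k)\<in>set (tw_leaves sOp us). sort (labels (?C i)) ! (k - 1))"
  proof (rule restrict_ext, clarify)
    fix i k assume ik: "(i, k) \<in> set (tw_leaves sOp us)"
    have "us \<noteq> []" "length us = Suc ?n"
      by (simp_all add: us_def)
    then have "i \<le> ?n"
      using ik set_tw_leaves[of us i k] by simp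
    then show "sort (?num i) ! (k - 1) = sort (labels (?C i)) ! (k - 1)"
      by (simp only: *(2))
  qed
  then show ?thesis
    unfolding tw_composite_def standard_def Let_def split us us_def by simp
qed

section \<open>Identity arrows\<close>

definition arrow_id :: "nat ptree \<Rightarrow> nat \<Rightarrow> nat ptree" where
  "arrow_id p = (\<lambda>i\<in>{0..length (vertices p)}.
     corolla i (if i = 0 then length (leaf_numbers p) else Inp sOp p ! (i - 1)))"

lemma
  assumes p: "p \<in> Ops sOp"
  shows arrow_arr_id: "arrow p (arrow_id p)" and tgt_arr_id: "target p (arrow_id p) = p"
    and std_arr_id: "standard p (arrow_id p) = tw_identity sOp p"
proof -
  let ?n = "length (vertices p)" and ?A = "arrow_id p"
  have A: "?A j = corolla j n" if "(j, n) \<in> set (vertices p)" for j n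
    using Ops_sOp_vertex[OF p that] Inp_sOp[OF p that] by (simp add: arrow_id_def)
  have A0: "?A 0 = corolla 0 (length (leaf_numbers p))"
    by (simp add: arrow_id_def)
  have "subst (\<lambda>j _. ?A j) p = p"
    by (rule subst_id) (rule A)
  then show t: "target p ?A = p"
    using p proper_set[of "length (leaf_numbers p)" p]
    by (simp add: target_def plug_def A0 subst_corolla Ops_sOp_iff)
  show "arrow p ?A"
    unfolding arrow_def pre_arrow_def t using p A A0 by (auto simp: arrow_id_def)
  have rank1: "rank [i] i = 1" for i
  proof -
    have "{y. y = i \<and> y \<le> i} = {i}"
      by auto
    then show ?thesis
      by (simp add: rank_def)
  qed
  have len: "length (Inp sOp p) = ?n"
    using sOp_sel(5) .
  define us where "us = Unit sOp (Out sOp p) # map (Unit sOp) (Inp sOp p)"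
  have us: "map (\<lambda>i. map_ptree (rank (labels (?A i))) (?A i)) [0..<Suc ?n] = us"
  proof (rule nth_equalityI)
    fix i assume i: "i < length (map (\<lambda>i. map_ptree (rank (labels (?A i))) (?A i)) [0..<Suc ?n])"
    then have "map (\<lambda>i. map_ptree (rank (labels (?A i))) (?A i)) [0..<Suc ?n] ! i = map_ptree (rank (labels (?A i))) (?A i)"
      by (simp add: nth_append del: upt_Suc)
    also have "\<dots> = us ! i"
      using i len by (cases i) (auto simp: us_def arrow_id_def rank1)
    finally show "map (\<lambda>i. map_ptree (rank (labels (?A i))) (?A i)) [0..<Suc ?n] ! i = us ! i" .
  qed (simp add: us_def len)
  have unit: "length (vertices (us ! i)) = 1" if "i \<le> ?n" for i
    using that len by (cases i) (auto simp: us_def)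
  have "(i, k) \<in> set (tw_leaves sOp us) \<longleftrightarrow> (i, k) \<in> {1..?n} \<times> {1}" for i k
    using set_tw_leaves[of us i k] unit[of i] len by (auto simp: us_def)
  then have leaves: "set (tw_leaves sOp us) = {1..?n} \<times> {1}"
    by auto
  show "standard p ?A = tw_identity sOp p"
    unfolding standard_def tw_identity_def Let_def us us_def[symmetric] leaves sOp_sel(5)
    by (auto simp: arrow_id_def intro!: restrict_ext)
qed

section \<open>Subtrees and cuts of planar trees\<close>

primrec subtrees :: "'v ptree \<Rightarrow> 'v ptree set" where
  "subtrees (Leaf k) = {Leaf k}"
| "subtrees (Node v ts) = insert (Node v ts) (\<Union>(set (map subtrees ts)))"

text \<open>Distinct numbers make the subtrees at different positions different values, so that a
  subtree can serve as the name of its root edge.\<close>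

definition separated :: "'v ptree \<Rightarrow> bool" where
  "separated t \<longleftrightarrow> distinct (labels t) \<and> distinct (leaf_numbers t)"

lemma Ops_sOp_separated: "p \<in> Ops sOp \<Longrightarrow> separated p"
  by (auto simp: separated_def sOp_def)

lemma subtrees_refl [simp]: "t \<in> subtrees t"
  by (cases t) auto

lemma finite_subtrees [simp]: "finite (subtrees t)"
  by (induction t) auto

lemma subtrees_trans: "s \<in> subtrees t \<Longrightarrow> r \<in> subtrees s \<Longrightarrow> r \<in> subtrees t"
  by (induction t) auto

lemma child_subtrees: "Node v ts \<in> subtrees t \<Longrightarrow> s \<in> set ts \<Longrightarrow> s \<in> subtrees t"
proof -
  assume "Node v ts \<in> subtrees t" "s \<in> set ts"
  moreover from this(2) have "s \<in> subtrees (Node v ts)"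
    by (auto intro: bexI[of _ s])
  ultimately show ?thesis
    by (meson subtrees_trans)
qed

lemma subtrees_length: "s \<in> subtrees t \<Longrightarrow> s = t \<or> length (vertices s) < length (vertices t)"
proof (induction t)
  case (Node v ts)
  have "length (vertices u) < length (vertices (Node v ts))" if u: "u \<in> set ts" for u
  proof -
    obtain us ws where "ts = us @ u # ws"
      using split_list[OF u] by blast
    then show ?thesis
      by simp
  qed
  then show ?case
    using Node by fastforce
qed simp

lemma subtrees_vertices: "s \<in> subtrees t \<Longrightarrow> set (vertices s) \<subseteq> set (vertices t)"
  and subtrees_leaf_numbers: "s \<in> subtrees t \<Longrightarrow> set (leaf_numbers s) \<subseteq> set (leaf_numbers t)"
proof -
  assume "s \<in> subtrees t"
  then have "set (vertices s) \<subseteq> set (vertices t) \<and> set (leaf_numbers s) \<subseteq> set (leaf_numbers t)"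
  proof (induction t)
    case (Node v ts)
    show ?case
    proof (cases "s = Node v ts")
      case False
      then obtain u where u: "u \<in> set ts" "s \<in> subtrees u"
        using Node.prems by auto
      have "set (vertices u) \<subseteq> set (vertices (Node v ts))" "set (leaf_numbers u) \<subseteq> set (leaf_numbers (Node v ts))"
        using u(1) by auto
      then show ?thesis
        using Node.IH[OF u] by blast
    qed simp
  qed simp
  then show "set (vertices s) \<subseteq> set (vertices t)" "set (leaf_numbers s) \<subseteq> set (leaf_numbers t)"
    by auto
qed

lemma vertices_subtrees: "(v, n) \<in> set (vertices t) \<longleftrightarrow> (\<exists>ts. Node v ts \<in> subtrees t \<and> length ts = n)"
  by (induction t) auto

lemma leaf_numbers_subtrees: "k \<in> set (leaf_numbers t) \<longleftrightarrow> Leaf k \<in> subtrees t"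
  by (induction t) auto

lemma separated_subtrees: "separated t \<Longrightarrow> s \<in> subtrees t \<Longrightarrow> separated s"
proof (induction t)
  case (Node v ts)
  have "separated u" if "u \<in> set ts" for u
    using that Node.prems(1) by (auto simp: separated_def map_concat distinct_concat_iff)
  then show ?case
    using Node by auto
qed simp

lemma separated_child: "separated (Node v ts) \<Longrightarrow> s \<in> set ts \<Longrightarrow> separated s"
  by (rule separated_subtrees[of "Node v ts"]) (auto intro: bexI[of _ s])

lemma distinct_concat_nth:
  assumes "distinct (concat xss)" "i < length xss" "j < length xss" "x \<in> set (xss ! i)" "x \<in> set (xss ! j)"
  shows "i = j"
  using assms
proof (induction xss arbitrary: i j)
  case (Cons xs xss)
  have "x \<notin> set xs" if "k < length xss" "x \<in> set (xss ! k)" for k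
    using that Cons.prems(1) nth_mem[of k xss] by (auto simp: disjoint_iff)
  then show ?case
    using Cons by (cases i; cases j) auto
qed simp

text \<open>The root of a subtree is a leaf or a vertex, and its number occurs in one child
  only.\<close>

lemma separated_children:
  assumes "separated (Node v ts)" "i < length ts" "j < length ts" "s \<in> subtrees (ts ! i)" "s \<in> subtrees (ts ! j)"
  shows "i = j"
proof -
  have d: "distinct (concat (map labels ts))" "distinct (concat (map leaf_numbers ts))"
    using assms(1) by (auto simp: separated_def map_concat comp_def)
  show ?thesis
  proof (cases s)
    case (Leaf k)
    then show ?thesis
      using distinct_concat_nth[OF d(2), of i j k] assms by (simp add: leaf_numbers_subtrees)
  next
    case (Node w us)
    have "w \<in> set (labels (ts ! i))" "w \<in> set (labels (ts ! j))"
      using assms(4,5) Node vertices_subtrees[of w "length us"] vertex_label by metis+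
    then show ?thesis
      using distinct_concat_nth[OF d(1), of i j w] assms by simp
  qed
qed

lemma separated_distinct_children: "separated (Node v ts) \<Longrightarrow> distinct ts"
  unfolding distinct_conv_nth using separated_children subtrees_refl by metis

lemma separated_root_label:
  assumes "separated (Node v ts)" "s \<in> set ts"
  shows "v \<notin> set (labels s)"
  using assms by (auto simp: separated_def)

lemma separated_Node_unique: "separated t \<Longrightarrow> Node v ts \<in> subtrees t \<Longrightarrow> Node v us \<in> subtrees t \<Longrightarrow> ts = us"
proof (induction t)
  case (Node w rs)
  have root: "Node v xs \<notin> subtrees r" if "v = w" "r \<in> set rs" for xs r
    using separated_root_label[OF Node.prems(1) that(2)] vertices_subtrees[of v "length xs" r] vertex_label that(1)
    by metis
  show ?case
  proof (cases "v = w")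
    case True
    then show ?thesis
      using root Node.prems by auto
  next
    case False
    then obtain i j where ij: "i < length rs" "Node v ts \<in> subtrees (rs ! i)" "j < length rs" "Node v us \<in> subtrees (rs ! j)"
      using Node.prems by (auto simp: in_set_conv_nth)
    have "v \<in> set (labels (rs ! i))" "v \<in> set (labels (rs ! j))"
      using ij vertices_subtrees[of v "length ts"] vertices_subtrees[of v "length us"] vertex_label by metis+
    moreover have "distinct (concat (map labels rs))"
      using Node.prems(1) by (auto simp: separated_def map_concat comp_def)
    ultimately have "i = j"
      using distinct_concat_nth[of "map labels rs" i j v] ij by simp
    then show ?thesis
      using Node.IH[of "rs ! i"] ij separated_child[OF Node.prems(1), of "rs ! i"] by auto
  qed
qed simp

lemma subtrees_graft: "s \<in> subtrees t \<Longrightarrow> graft h s \<in> subtrees (graft h t)"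
  by (induction t) auto

lemma subtrees_graft_leaf: "k \<in> set (leaf_numbers t) \<Longrightarrow> h k \<in> subtrees (graft h t)"
  using subtrees_graft[of "Leaf k" t h] by (simp add: leaf_numbers_subtrees)

text \<open>A child whose number is missing among the leaves of \<open>h v n\<close> would be
  discarded together with its subtrees; hence the lower bound on the leaf numbers.\<close>

lemma subtrees_subst:
  assumes "s \<in> subtrees t" "\<And>v n. (v, n) \<in> set (vertices t) \<Longrightarrow> {1..n} \<subseteq> set (leaf_numbers (h v n))"
  shows "subst h s \<in> subtrees (subst h t)"
  using assms
proof (induction t)
  case (Node v ts)
  show ?case
  proof (cases "s = Node v ts")
    case False
    then obtain i where i: "i < length ts" "s \<in> subtrees (ts ! i)"
      using Node.prems(1) by (auto simp: in_set_conv_nth)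
    then have mem: "ts ! i \<in> set ts"
      by simp
    have "subst h s \<in> subtrees (subst h (ts ! i))"
      by (rule Node.IH[OF mem i(2)], rule Node.prems(2)[OF child_vertices[OF mem]])
    moreover have "map (subst h) ts ! (Suc i - 1) \<in> subtrees (subst h (Node v ts))"
    proof -
      have "{1..length ts} \<subseteq> set (leaf_numbers (h v (length ts)))"
        using Node.prems(2) by simp
      then have "Suc i \<in> set (leaf_numbers (h v (length ts)))"
        using i by auto
      from subtrees_graft_leaf[OF this] show ?thesis
        by (simp only: subst.simps)
    qed
    ultimately show ?thesis
      using i(1) by (auto intro: subtrees_trans)
  qed simp
qed simp

text \<open>The leaves of a subtree with the same root, as an unordered set. For
  \<open>ts = []\<close> the second rule gives the empty cut: a vertex without inputs closes its
  branch.\<close>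

inductive planar_cut :: "'v ptree \<Rightarrow> 'v ptree set \<Rightarrow> bool" where
  edge: "planar_cut t {t}"
| node: "(\<And>i. i < length ts \<Longrightarrow> planar_cut (ts ! i) (X i)) \<Longrightarrow> planar_cut (Node v ts) (\<Union>i<length ts. X i)"

lemma planar_cut_subtrees: "planar_cut t X \<Longrightarrow> X \<subseteq> subtrees t"
  by (induction rule: planar_cut.induct) (auto simp: subset_iff in_set_conv_nth, metis nth_mem)

text \<open>\<open>a\<close> is the part of \<open>t\<close> below the cut, with number
  \<open>k\<close> at the leaf where \<open>h k\<close> was cut off. The numbering is arbitrary,
  which leaves room for maps that do not respect the planar order.\<close>

lemma planar_cut_graft_ex:
  assumes "planar_cut t X" "separated t" "h ` K = X" "inj_on h K"
  shows "\<exists>a. graft h a = t \<and> distinct (leaf_numbers a) \<and> set (leaf_numbers a) = K"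
  using assms
proof (induction arbitrary: K rule: planar_cut.induct)
  case (edge t)
  then obtain k where "k \<in> K" "h k = t"
    by (metis imageE insertI1)
  moreover have "k' = k" if "k' \<in> K" for k'
    using edge that \<open>k \<in> K\<close> \<open>h k = t\<close> by (metis image_eqI inj_onD singletonD)
  ultimately have "K = {k}" "h k = t"
    by blast+
  then show ?case
    by (intro exI[of _ "Leaf k"]) simp
next
  case (node ts X v)
  \<comment> \<open>The numbers of the cut edges in the \<open>i\<close>-th child; these sets are
    disjoint because different children share no subtree.\<close>
  let ?K = "\<lambda>i. {k \<in> K. h k \<in> X i}"
  have sub: "X i \<subseteq> subtrees (ts ! i)" if "i < length ts" for i
    using planar_cut_subtrees[OF node.hyps[OF that]] .
  have "\<exists>a. graft h a = ts ! i \<and> distinct (leaf_numbers a) \<and> set (leaf_numbers a) = ?K i"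
    if i: "i < length ts" for i
  proof (rule node.IH[OF i])
    show "separated (ts ! i)"
      using separated_child[OF node.prems(1), of "ts ! i"] i by auto
    show "h ` ?K i = X i"
      using node.prems(2) i by auto
    show "inj_on h (?K i)"
      using node.prems(3) by (rule inj_on_subset) auto
  qed
  then have "\<exists>a. \<forall>i\<in>{..<length ts}. graft h (a i) = ts ! i \<and> distinct (leaf_numbers (a i)) \<and> set (leaf_numbers (a i)) = ?K i"
    by (intro bchoice) auto
  then obtain a where a: "\<And>i. i < length ts \<Longrightarrow> graft h (a i) = ts ! i \<and> distinct (leaf_numbers (a i)) \<and> set (leaf_numbers (a i)) = ?K i"
    by auto
  have K: "K = (\<Union>i<length ts. ?K i)"
    using node.prems(2) by auto
  have disj: "i = j" if "i < length ts" "j < length ts" "k \<in> ?K i" "k \<in> ?K j" for i j k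
    using separated_children[OF node.prems(1) that(1,2), of "h k"] sub[OF that(1)] sub[OF that(2)] that(3,4) by auto
  have "distinct (concat (map (\<lambda>i. leaf_numbers (a i)) [0..<length ts]))"
  proof (rule distinct_concat_map)
    fix i j k assume ij: "i \<in> set [0..<length ts]" "j \<in> set [0..<length ts]"
      and "k \<in> set (leaf_numbers (a i))" "k \<in> set (leaf_numbers (a j))"
    then show "i = j"
      using a[of i] a[of j] disj[of i j k] by auto
  qed (use a in auto)
  then have "distinct (leaf_numbers (Node v (map a [0..<length ts])))"
    by (simp add: comp_def atLeast0LessThan)
  moreover have "set (leaf_numbers (Node v (map a [0..<length ts]))) = K"
    using a by (subst K) auto
  moreover have "graft h (Node v (map a [0..<length ts])) = Node v ts"
    using a by (auto intro: nth_equalityI)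
  ultimately show ?case
    by blast
qed

text \<open>The converse of \<open>planar_cut_graft_ex\<close>: the leaves of \<open>a\<close> trace
  out a cut. That no vertex of \<open>a\<close> lies at a cut edge is what makes the decomposition
  unique.\<close>

lemma
  assumes "separated (graft h a)" "distinct (leaf_numbers a)"
  shows graft_pcut: "planar_cut (graft h a) (h ` set (leaf_numbers a))"
    and graft_inj: "inj_on h (set (leaf_numbers a))"
    and graft_Node_not_leaf: "Node v bs \<in> subtrees a \<Longrightarrow> graft h (Node v bs) \<notin> h ` set (leaf_numbers a)"
proof -
  have "planar_cut (graft h a) (h ` set (leaf_numbers a)) \<and> inj_on h (set (leaf_numbers a)) \<and>
    (\<forall>v bs. Node v bs \<in> subtrees a \<longrightarrow> graft h (Node v bs) \<notin> h ` set (leaf_numbers a))"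
    using assms
  proof (induction a)
    case (Leaf k)
    then show ?case
      by (auto intro: planar_cut.edge)
  next
    case (Node w as)
    let ?ts = "map (graft h) as"
    have separated: "separated (Node w ?ts)"
      using Node.prems(1) by simp
    have d: "distinct (concat (map leaf_numbers as))"
      using Node.prems(2) by simp
    have IH: "planar_cut (graft h a) (h ` set (leaf_numbers a))" "inj_on h (set (leaf_numbers a))"
      "\<And>v bs. Node v bs \<in> subtrees a \<Longrightarrow> graft h (Node v bs) \<notin> h ` set (leaf_numbers a)" if "a \<in> set as" for a
    proof -
      have "separated (graft h a)" "distinct (leaf_numbers a)"
        using that d separated_child[OF separated, of "graft h a"] by (auto simp: distinct_concat_iff)
      then show "planar_cut (graft h a) (h ` set (leaf_numbers a))" "inj_on h (set (leaf_numbers a))"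
       "\<And>v bs. Node v bs \<in> subtrees a \<Longrightarrow> graft h (Node v bs) \<notin> h ` set (leaf_numbers a)"
        using Node.IH[OF that] by auto
    qed
    have "planar_cut (Node w ?ts) (\<Union>i<length ?ts. h ` set (leaf_numbers (as ! i)))"
      by (rule planar_cut.node) (use IH in auto)
    moreover have "(\<Union>i<length ?ts. h ` set (leaf_numbers (as ! i))) = h ` set (leaf_numbers (Node w as))"
    proof -
      have "set as = (\<lambda>i. as ! i) ` {..<length as}"
        by (auto simp: in_set_conv_nth)
      then show ?thesis
        by (simp add: image_UN)
    qed
    ultimately have 1: "planar_cut (graft h (Node w as)) (h ` set (leaf_numbers (Node w as)))"
      by simp
    have idx: "\<exists>i<length as. k \<in> set (leaf_numbers (as ! i)) \<and> h k \<in> subtrees (?ts ! i)"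
      if k: "k \<in> set (leaf_numbers (Node w as))" for k
    proof -
      obtain a where "a \<in> set as" "k \<in> set (leaf_numbers a)"
        using k by auto
      then obtain i where "i < length as" "k \<in> set (leaf_numbers (as ! i))"
        by (metis in_set_conv_nth)
      then show ?thesis
        using subtrees_graft_leaf by force
    qed
    have 2: "inj_on h (set (leaf_numbers (Node w as)))"
    proof (rule inj_onI)
      fix k l assume k: "k \<in> set (leaf_numbers (Node w as))" and l: "l \<in> set (leaf_numbers (Node w as))" and "h k = h l"
      obtain i where i: "i < length as" "k \<in> set (leaf_numbers (as ! i))" "h k \<in> subtrees (?ts ! i)"
        using idx[OF k] by auto
      obtain j where j: "j < length as" "l \<in> set (leaf_numbers (as ! j))" "h l \<in> subtrees (?ts ! j)"
        using idx[OF l] by auto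
      have "i = j"
        using separated_children[OF separated, of i j "h k"] i j \<open>h k = h l\<close> by simp
      then show "k = l"
        using i j IH(2)[of "as ! i"] \<open>h k = h l\<close> by (auto dest: inj_onD)
    qed
    have 3: "graft h (Node v bs) \<notin> h ` set (leaf_numbers (Node w as))"
      if b: "Node v bs \<in> subtrees (Node w as)" for v bs
    proof
      assume "graft h (Node v bs) \<in> h ` set (leaf_numbers (Node w as))"
      then obtain k where k: "k \<in> set (leaf_numbers (Node w as))" "graft h (Node v bs) = h k"
        by auto
      obtain i where i: "i < length as" "k \<in> set (leaf_numbers (as ! i))" "h k \<in> subtrees (?ts ! i)"
        using idx[OF k(1)] by auto
      consider "Node v bs = Node w as" | j where "j < length as" "Node v bs \<in> subtrees (as ! j)"
        using b by (auto simp: in_set_conv_nth)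
      then show False
      proof cases
        \<comment> \<open>The whole tree would occur inside one of its children, which has fewer
          vertices.\<close>
        case 1
        then have "Node w ?ts \<in> subtrees (?ts ! i)"
          using i k by simp
        then have "Node w ?ts = ?ts ! i \<or> length (vertices (Node w ?ts)) < length (vertices (?ts ! i))"
          by (rule subtrees_length)
        moreover have "?ts ! i \<in> set ?ts"
          using i(1) by simp
        moreover have "length (vertices (?ts ! i)) < length (vertices (Node w ?ts))"
        proof -
          obtain us ws where "?ts = us @ ?ts ! i # ws"
            using split_list[OF \<open>?ts ! i \<in> set ?ts\<close>] by blast
          then have "length (vertices (Node w ?ts)) = length (vertices (Node w (us @ ?ts ! i # ws)))"
            by metis
          then show ?thesis
            by simp
        qed
        ultimately show False
          by (metis less_asym less_irrefl)
      next
        case 2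
        have "graft h (Node v bs) \<in> subtrees (?ts ! j)"
          using subtrees_graft[OF 2(2), of h] 2(1) by simp
        then have "i = j"
          using separated_children[OF separated, of i j "h k"] i 2 k(2) by simp
        then show False
          using IH(3)[of "as ! i" v bs] i 2 k(2) by auto
      qed
    qed
    show ?case
      using 1 2 3 by blast
  qed
  then show "planar_cut (graft h a) (h ` set (leaf_numbers a))" "inj_on h (set (leaf_numbers a))"
    "Node v bs \<in> subtrees a \<Longrightarrow> graft h (Node v bs) \<notin> h ` set (leaf_numbers a)"
    by blast+
qed

text \<open>Subtrees with the same image are compared: a leaf cannot match a vertex by
  \<open>graft_Node_not_leaf\<close>, leaves agree by injectivity of \<open>h\<close>, and vertices
  agree by induction.\<close>

lemma graft_unique:
  assumes "graft h a = graft h a'" "separated (graft h a)" "distinct (leaf_numbers a)" "distinct (leaf_numbers a')"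
    and "set (leaf_numbers a) = set (leaf_numbers a')"
  shows "a = a'"
proof -
  have "b = b'" if "b \<in> subtrees a" "b' \<in> subtrees a'" "graft h b = graft h b'" for b b'
    using that
  proof (induction b arbitrary: b')
    case (Leaf k)
    then have k: "k \<in> set (leaf_numbers a)"
      by (simp add: leaf_numbers_subtrees)
    show ?case
    proof (cases b')
      case (Leaf k')
      then have "k' \<in> set (leaf_numbers a)"
        using Leaf.prems assms(5) by (simp add: leaf_numbers_subtrees)
      then show ?thesis
        using graft_inj[OF assms(2,3)] k Leaf.prems Leaf by (auto dest: inj_onD)
    next
      case (Node v bs)
      have "graft h (Node v bs) \<in> h ` set (leaf_numbers a')"
        using Leaf.prems(3) Node k assms(5) by (metis graft.simps(1) image_eqI)
      moreover have "separated (graft h a')"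
        using assms(1,2) by simp
      ultimately show ?thesis
        using graft_Node_not_leaf[OF _ assms(4), of h v bs] Leaf.prems(2) Node by blast
    qed
  next
    case (Node v bs)
    show ?case
    proof (cases b')
      case (Leaf k)
      then show ?thesis
        using graft_Node_not_leaf[OF assms(2,3), of v bs] assms(5) Node.prems by (auto simp: leaf_numbers_subtrees)
    next
      case b': (Node v' bs')
      have len: "length bs = length bs'" and maps: "map (graft h) bs = map (graft h) bs'"
        using Node.prems(3) b' by (auto dest: map_eq_imp_length_eq)
      have "bs = bs'"
      proof (rule nth_equalityI[OF len])
        fix i assume i: "i < length bs"
        then show "bs ! i = bs' ! i"
          using Node.IH[of "bs ! i" "bs' ! i"] child_subtrees[OF Node.prems(1), of "bs ! i"]
            child_subtrees[of v' bs' a' "bs' ! i"] Node.prems(2) b' len arg_cong[OF maps, of "\<lambda>xs. xs ! i"] by auto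
      qed
      then show ?thesis
        using Node.prems(3) b' by simp
    qed
  qed
  then show ?thesis
    using assms(1) by auto
qed

section \<open>The edge map of a twisted arrow\<close>

lemma plug_Node: "v \<noteq> 0 \<Longrightarrow> plug P (Node v ts) = Node v (map (plug P) ts)"
  by (simp add: plug_def)

lemma plug_Node_0:
  "(\<And>u. u \<in> set us \<Longrightarrow> 0 \<notin> set (labels u)) \<Longrightarrow> proper (length us) P \<Longrightarrow>
    plug P (Node 0 us) = graft (\<lambda>k. us ! (k - 1)) P"
  unfolding plug_def subst.simps
  by (simp, rule graft_cong) (use proper_set plug_id in \<open>force simp: plug_def\<close>)

text \<open>The occurrence of the grafted tree in \<open>t\<close> is replaced by a marked vertex
  with inputs \<open>us\<close>; the rest of \<open>t\<close> has no label \<open>0\<close>, so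
  plugging restores it.\<close>

lemma plug_ex:
  assumes "graft (\<lambda>k. us ! (k - 1)) P \<in> subtrees t" "0 \<notin> set (labels t)" "proper (length us) P"
  shows "\<exists>a. plug P a = t \<and> Node 0 us \<in> subtrees a \<and> count (mset (labels a)) 0 = 1"
proof -
  let ?R = "graft (\<lambda>k. us ! (k - 1)) P"
  have us: "0 \<notin> set (labels u)" if u: "u \<in> set us" for u
  proof -
    obtain i where i: "i < length us" "u = us ! i"
      using u by (auto simp: in_set_conv_nth)
    then have "Suc i \<in> set (leaf_numbers P)"
      using proper_set[OF assms(3)] by auto
    from subtrees_graft_leaf[OF this, of "\<lambda>k. us ! (k - 1)"] have "u \<in> subtrees ?R"
      using i by simp
    then have "u \<in> subtrees t"
      using assms(1) by (rule subtrees_trans[rotated])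
    then show ?thesis
      using subtrees_vertices assms(2) by fastforce
  qed
  have root: "plug P (Node 0 us) = ?R" "count (mset (labels (Node 0 us))) 0 = 1"
  proof -
    show "plug P (Node 0 us) = ?R"
      by (rule plug_Node_0[OF us assms(3)])
    have "0 \<notin> set (concat (map labels us))"
      using us by auto
    then show "count (mset (labels (Node 0 us))) 0 = 1"
      by (simp add: map_concat comp_def not_in_iff[symmetric] flip: mset_map)
  qed
  show ?thesis
    using assms(1,2)
  proof (induction t)
    case (Leaf k)
    then show ?case
      using root by (intro exI[of _ "Node 0 us"]) auto
  next
    case (Node v ts)
    show ?case
    proof (cases "?R = Node v ts")
      case True
      then show ?thesis
        using root by (intro exI[of _ "Node 0 us"]) auto
    next
      case False
      then obtain u where u: "u \<in> set ts" "?R \<in> subtrees u"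
        using Node.prems(1) by auto
      obtain rs ws where ts: "ts = rs @ u # ws"
        using split_list[OF u(1)] by blast
      have no0: "0 \<notin> set (labels s)" if "s \<in> set ts" for s
        using Node.prems(2) that by auto
      obtain a where a: "plug P a = u" "Node 0 us \<in> subtrees a" "count (mset (labels a)) 0 = 1"
        using Node.IH[OF u no0[OF u(1)]] by blast
      have "map (plug P) rs = rs" "map (plug P) ws = ws"
        using no0 plug_id by (auto simp: ts intro: map_idI)
      moreover have "v \<noteq> 0"
        using Node.prems(2) by auto
      moreover have "count (mset (concat (map labels rs))) 0 = 0" "count (mset (concat (map labels ws))) 0 = 0"
        using no0 unfolding not_in_iff[symmetric] ts by auto
      ultimately show ?thesis
        using a by (intro exI[of _ "Node v (rs @ a # ws)"]) (auto simp: plug_Node ts map_concat comp_def)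
    qed
  qed
qed

text \<open>The place of the mark is forced, because the grafted tree cannot occur under two
  different children of a separated tree, and plugging changes nothing away from that
  branch.\<close>

lemma plug_unique:
  assumes "plug P a = plug P a'" "separated (plug P a)" "Node 0 us \<in> subtrees a" "Node 0 us \<in> subtrees a'"
    and "distinct (labels a)" "distinct (labels a')" "proper (length us) P"
  shows "a = a'"
proof -
  let ?R = "graft (\<lambda>k. us ! (k - 1)) P"
  have no0: "0 \<notin> set (labels u)"
    if "distinct (labels b)" "Node 0 us \<in> subtrees b" "u \<in> set us" for b u
    using that by (induction b) (auto simp: map_concat comp_def distinct_concat_iff)
  have no0': "plug P (Node 0 us) = ?R"
    using plug_Node_0[OF no0[OF assms(5,3)] assms(7)] by blast
  have root: "b = Node 0 us"
    if b: "Node 0 us \<in> subtrees b" "distinct (labels b)" "b = Node 0 bs" for b bs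
  proof (rule ccontr)
    assume "b \<noteq> Node 0 us"
    then obtain c where c: "c \<in> set bs" "Node 0 us \<in> subtrees c"
      using b by auto
    then have "0 \<in> set (labels c)"
      using vertices_subtrees vertex_label by metis
    then show False
      using b(2) c(1) unfolding b(3) by auto
  qed
  have R: "?R \<in> subtrees (plug P b)" if "Node 0 us \<in> subtrees b" "distinct (labels b)" for b
    using that
  proof (induction b)
    case (Node v bs)
    show ?case
    proof (cases "v = 0")
      case True
      then show ?thesis
        using root[OF Node.prems] no0' by simp
    next
      case False
      then obtain b where b: "b \<in> set bs" "Node 0 us \<in> subtrees b"
        using Node.prems by auto
      then have "distinct (labels b)"
        using Node.prems by (auto simp: map_concat comp_def distinct_concat_iff)
      then have "?R \<in> subtrees (plug P b)"
        using Node.IH b by blast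
      then show ?thesis
        using False b by (auto simp: plug_Node)
    qed
  qed simp
  \<comment> \<open>A deeper mark would put the grafted tree inside a child of itself, against the
    count of vertices.\<close>
  have top: "b = Node 0 us"
    if b: "Node 0 us \<in> subtrees b" "distinct (labels b)" "plug P b = ?R" for b
  proof (cases b)
    case (Node v bs)
    show ?thesis
    proof (rule ccontr)
      assume neq: "b \<noteq> Node 0 us"
      then obtain c where c: "c \<in> set bs" "Node 0 us \<in> subtrees c"
        using b Node by auto
      then have "0 \<in> set (labels c)"
        using vertices_subtrees vertex_label by metis
      then have "v \<noteq> 0"
        using b(2) Node c(1) by auto
      have "distinct (labels c)"
        using b(2) c(1) unfolding Node by (auto simp: map_concat comp_def distinct_concat_iff)
      then have "?R \<in> subtrees (plug P c)"
        using R c by blast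
      then have "?R = plug P c \<or> length (vertices ?R) < length (vertices (plug P c))"
        by (rule subtrees_length)
      moreover obtain rs ws where "bs = rs @ c # ws"
        using split_list[OF c(1)] by blast
      then have "length (vertices (plug P c)) < length (vertices (plug P b))"
        using \<open>v \<noteq> 0\<close> Node by (simp add: plug_Node)
      ultimately show False
        using b(3) by auto
    qed
  qed (use b in auto)
  show ?thesis
    using assms(1-6)
  proof (induction a arbitrary: a')
    case (Node v ts)
    show ?case
    proof (cases "plug P (Node v ts) = ?R")
      case True
      then show ?thesis
        using top Node.prems by metis
    next
      case False
      have "v \<noteq> 0"
        using root[OF Node.prems(3,5)] False no0' by metis
      obtain v' ts' where a': "a' = Node v' ts'"
        using Node.prems by (cases a') auto
      have "v' \<noteq> 0"
        using root[OF Node.prems(4,6)] a' Node.prems(1) False no0' by metis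
      have eq: "v = v'" "map (plug P) ts = map (plug P) ts'"
        using Node.prems(1) \<open>v \<noteq> 0\<close> \<open>v' \<noteq> 0\<close> by (auto simp: a' plug_Node)
      have len: "length ts = length ts'"
        using eq(2) by (rule map_eq_imp_length_eq)
      have separated: "separated (Node v (map (plug P) ts))"
        using Node.prems(2) \<open>v \<noteq> 0\<close> by (simp add: plug_Node)
      have d: "distinct (concat (map labels ts))" "distinct (concat (map labels ts'))"
        using Node.prems(5,6) by (auto simp: a' map_concat comp_def)
      obtain i where i: "i < length ts" "Node 0 us \<in> subtrees (ts ! i)"
        using Node.prems(3) \<open>v \<noteq> 0\<close> by (auto simp: in_set_conv_nth)
      obtain i' where i': "i' < length ts'" "Node 0 us \<in> subtrees (ts' ! i')"
        using Node.prems(4) \<open>v' \<noteq> 0\<close> a' by (auto simp: in_set_conv_nth)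
      have di: "distinct (labels (ts ! j))" "distinct (labels (ts' ! j))" if "j < length ts" for j
        using d that len by (auto simp: distinct_concat_iff)
      have nth: "plug P (ts ! j) = plug P (ts' ! j)" if "j < length ts" for j
        using arg_cong[OF eq(2), of "\<lambda>xs. xs ! j"] that len by simp
      have "?R \<in> subtrees (map (plug P) ts ! i)" "?R \<in> subtrees (map (plug P) ts ! i')"
        using R[OF i(2)] R[OF i'(2)] di i(1) i'(1) len nth by auto
      \<comment> \<open>The grafted tree occurs above both marks' children, hence the two children
        coincide.\<close>
      then have "i = i'"
        using separated_children[OF separated, of i i'] i i' len by simp
      have z: "0 \<in> set (labels (ts ! i))" "0 \<in> set (labels (ts' ! i))"
        using i(2) i'(2) \<open>i = i'\<close> vertices_subtrees vertex_label by metis+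
      have "ts = ts'"
      proof (rule nth_equalityI[OF len])
        fix j assume j: "j < length ts"
        show "ts ! j = ts' ! j"
        proof (cases "j = i")
          case True
          show ?thesis
            unfolding True
          proof (rule Node.IH)
            show "separated (plug P (ts ! i))"
              using separated_child[OF separated, of "plug P (ts ! i)"] i(1) by auto
          qed (use i i' \<open>i = i'\<close> di nth in auto)
        next
          case False
          have "0 \<notin> set (labels (ts ! j))" "0 \<notin> set (labels (ts' ! j))"
            using distinct_concat_nth[OF d(1), of i j 0] distinct_concat_nth[OF d(2), of i j 0] z False j i len by auto
          then show ?thesis
            using nth[OF j] plug_id by metis
        qed
      qed
      then show ?thesis
        using eq a' by simp
    qed
  qed simp
qed

lemma image_nth_pred: "(\<lambda>k. f (ts ! (k - 1))) ` {1..length ts} = f ` set ts"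
proof -
  have "set (map (\<lambda>k. ts ! (k - 1)) [1..<Suc (length ts)]) = set ts"
    by (simp only: map_nth_pred)
  then have "(\<lambda>k. ts ! (k - 1)) ` {1..length ts} = set ts"
    by (simp only: set_map set_upt atLeastLessThanSuc_atLeastAtMost)
  then show ?thesis
    by (metis image_image)
qed

text \<open>Injectivity is asked only among the inputs of one vertex: the input and the output of a
  unary vertex have the same image when the tree inserted there is a bare edge.\<close>

definition edge_maps :: "nat ptree \<Rightarrow> nat ptree \<Rightarrow> (nat ptree \<Rightarrow> nat ptree) set" where
  "edge_maps p t = {f. f \<in> subtrees p \<rightarrow>\<^sub>E subtrees t \<and>
     (\<forall>v ts. Node v ts \<in> subtrees p \<longrightarrow> inj_on f (set ts) \<and> planar_cut (f (Node v ts)) (f ` set ts))}"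

definition lower_args :: "nat ptree \<Rightarrow> nat ptree list" where
  "lower_args a = (SOME us. Node 0 us \<in> subtrees a)"

text \<open>Above leaf \<open>k\<close> of \<open>p\<close> the target continues with the
  \<open>k\<close>-th input of the marked vertex, so these inputs are grafted onto the substituted
  subtree.\<close>

definition edge_map :: "nat ptree \<Rightarrow> (nat \<Rightarrow> nat ptree) \<Rightarrow> nat ptree \<Rightarrow> nat ptree" where
  "edge_map p A = (\<lambda>s\<in>subtrees p. graft (\<lambda>k. lower_args (A 0) ! (k - 1)) (subst (\<lambda>j _. A j) s))"

lemma lower_args_eq: "separated a \<Longrightarrow> Node 0 us \<in> subtrees a \<Longrightarrow> lower_args a = us"
  unfolding lower_args_def by (rule some_equality) (auto dest: separated_Node_unique)

context
  fixes p A
  assumes A: "arrow p A"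
begin

lemma arrow_source: "p \<in> Ops sOp" and arrow_target: "target p A \<in> Ops sOp" and arrow_pre: "pre_arrow p A"
  and arrow_proper: "\<And>j n. (j, n) \<in> set (vertices p) \<Longrightarrow> proper n (A j)"
  using A by (auto simp: arrow_def pre_arrow_def)

lemma separated_lower: "separated (A 0)"
proof -
  have "proper (length (leaf_numbers (target p A))) (A 0)"
    using arrow_target mset_leaves_tgt[OF arrow_pre] by (simp add: Ops_sOp_iff proper_def)
  then show ?thesis
    using arrow_vertices(1)[OF A, of 0] by (simp add: separated_def proper_iff)
qed

lemma lower_args:
  "Node 0 (lower_args (A 0)) \<in> subtrees (A 0)" "length (lower_args (A 0)) = length (leaf_numbers p)"
  "u \<in> set (lower_args (A 0)) \<Longrightarrow> 0 \<notin> set (labels u)"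
proof -
  have "(0, length (leaf_numbers p)) \<in> set (vertices (A 0))"
    using arrow_pre by (simp add: pre_arrow_def)
  then obtain us where us: "Node 0 us \<in> subtrees (A 0)" "length us = length (leaf_numbers p)"
    unfolding vertices_subtrees by auto
  then have "lower_args (A 0) = us"
    using lower_args_eq[OF separated_lower] by simp
  with us show 1: "Node 0 (lower_args (A 0)) \<in> subtrees (A 0)" "length (lower_args (A 0)) = length (leaf_numbers p)"
    by auto
  show "0 \<notin> set (labels u)" if "u \<in> set (lower_args (A 0))"
    using separated_root_label[OF separated_subtrees[OF separated_lower 1(1)] that] .
qed

lemma edge_map_root: "edge_map p A p = plug (subst (\<lambda>j _. A j) p) (Node 0 (lower_args (A 0)))"
proof -
  have "proper (length (lower_args (A 0))) (subst (\<lambda>j _. A j) p)"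
    using proper_source[OF arrow_pre] by (simp add: lower_args)
  from plug_Node_0[OF lower_args(3) this] show ?thesis
    by (simp add: edge_map_def)
qed

lemma edge_map_root_subtrees: "edge_map p A p \<in> subtrees (target p A)"
  unfolding edge_map_root target_def plug_def
proof (rule subtrees_subst[OF lower_args(1)])
  fix j n assume "(j, n) \<in> set (vertices (A 0))"
  then have "j = 0 \<Longrightarrow> n = length (leaf_numbers p)"
    using arrow_vertices(2)[OF A, of 0 j n] by auto
  then show "{1..n} \<subseteq> set (leaf_numbers (if j = 0 then subst (\<lambda>j _. A j) p else corolla j n))"
    using proper_set[OF proper_source[OF arrow_pre]] by (auto simp: subset_iff)
qed

lemma edge_map_subtrees: "s \<in> subtrees p \<Longrightarrow> edge_map p A s \<in> subtrees (target p A)"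
proof -
  assume s: "s \<in> subtrees p"
  have "subst (\<lambda>j _. A j) s \<in> subtrees (subst (\<lambda>j _. A j) p)"
    by (rule subtrees_subst[OF s]) (use arrow_proper proper_set in blast)
  then have "edge_map p A s \<in> subtrees (edge_map p A p)"
    using s by (simp add: edge_map_def subtrees_graft)
  then show ?thesis
    using edge_map_root_subtrees subtrees_trans by blast
qed

text \<open>\<open>A j\<close> lies in the target between the image of the output edge of
  \<open>j\<close> and the images of its input edges. The cut condition and the recovery of
  \<open>A j\<close> both follow from this.\<close>

lemma edge_map_Node:
  assumes "Node j ts \<in> subtrees p"
  shows "edge_map p A (Node j ts) = graft (\<lambda>k. edge_map p A (ts ! (k - 1))) (A j)"
    and "proper (length ts) (A j)"
proof -
  show A: "proper (length ts) (A j)"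
    by (rule arrow_proper) (use assms in \<open>auto simp: vertices_subtrees\<close>)
  have "edge_map p A (Node j ts) = graft (\<lambda>k. graft (\<lambda>k. lower_args (A 0) ! (k - 1))
      (map (subst (\<lambda>j _. A j)) ts ! (k - 1))) (A j)"
    using assms by (simp add: edge_map_def graft_graft)
  also have "\<dots> = graft (\<lambda>k. edge_map p A (ts ! (k - 1))) (A j)"
  proof (rule graft_cong)
    fix k assume "k \<in> set (leaf_numbers (A j))"
    then have "k - 1 < length ts"
      using proper_set[OF A] by auto
    then show "graft (\<lambda>k. lower_args (A 0) ! (k - 1)) (map (subst (\<lambda>j _. A j)) ts ! (k - 1)) =
        edge_map p A (ts ! (k - 1))"
      using child_subtrees[OF assms, of "ts ! (k - 1)"] by (simp add: edge_map_def)
  qed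
  finally show "edge_map p A (Node j ts) = graft (\<lambda>k. edge_map p A (ts ! (k - 1))) (A j)" .
qed

lemma edge_map_edge_maps: "edge_map p A \<in> edge_maps p (target p A)"
  unfolding edge_maps_def
proof (intro CollectI conjI allI impI)
  show "edge_map p A \<in> subtrees p \<rightarrow>\<^sub>E subtrees (target p A)"
    using edge_map_subtrees by (auto simp: edge_map_def)
  fix v ts assume N: "Node v ts \<in> subtrees p"
  let ?h = "\<lambda>k. edge_map p A (ts ! (k - 1))"
  note eN = edge_map_Node[OF N]
  have separated: "separated (graft ?h (A v))"
    using separated_subtrees[OF Ops_sOp_separated[OF arrow_target] edge_map_subtrees[OF N]] eN(1) by simp
  have d: "distinct (leaf_numbers (A v))" "set (leaf_numbers (A v)) = {1..length ts}"
    using eN(2) by (auto simp: proper_iff)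
  show "planar_cut (edge_map p A (Node v ts)) (edge_map p A ` set ts)"
    using graft_pcut[OF separated d(1)] unfolding d(2) image_nth_pred eN(1) .
  have "inj_on ?h {1..length ts}"
    using graft_inj[OF separated d(1)] unfolding d(2) .
  then show "inj_on (edge_map p A) (set ts)"
  proof (intro inj_onI)
    fix x y assume inj: "inj_on ?h {1..length ts}" and "x \<in> set ts" "y \<in> set ts" and e: "edge_map p A x = edge_map p A y"
    then obtain i j where ij: "i < length ts" "x = ts ! i" "j < length ts" "y = ts ! j"
      by (auto simp: in_set_conv_nth)
    then have "Suc i = Suc j"
      using e by (intro inj_onD[OF inj]) auto
    then show "x = y"
      using ij by simp
  qed
qed

lemma edge_map_Leaf: "Leaf k \<in> subtrees p \<Longrightarrow> edge_map p A (Leaf k) = lower_args (A 0) ! (k - 1)"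
  by (simp add: edge_map_def)

end

text \<open>The upper trees agree by \<open>graft_unique\<close> at each vertex, the inputs of the
  mark agree as images of the leaves of \<open>p\<close>, and then the lower trees agree by
  \<open>plug_unique\<close>, since the plugged tree and the result are the same.\<close>

lemma edge_map_inj:
  assumes A: "arrow p A" and B: "arrow p B" and t: "target p A = target p B" and e: "edge_map p A = edge_map p B"
  shows "A = B"
proof -
  note p = arrow_source[OF A]
  have upper: "A j = B j" if j: "(j, n) \<in> set (vertices p)" for j n
  proof -
    obtain ts where N: "Node j ts \<in> subtrees p"
      using j unfolding vertices_subtrees by auto
    note eA = edge_map_Node[OF A N] and eB = edge_map_Node[OF B N, folded e]
    show ?thesis
    proof (rule graft_unique)
      show "graft (\<lambda>k. edge_map p A (ts ! (k - 1))) (A j) = graft (\<lambda>k. edge_map p A (ts ! (k - 1))) (B j)"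
        using eA(1) eB(1) by simp
      show "separated (graft (\<lambda>k. edge_map p A (ts ! (k - 1))) (A j))"
        using separated_subtrees[OF Ops_sOp_separated[OF arrow_target[OF A]] edge_map_subtrees[OF A N]] eA(1) by simp
    qed (use eA(2) eB(2) in \<open>auto simp: proper_iff\<close>)
  qed
  have P: "subst (\<lambda>j _. A j) p = subst (\<lambda>j _. B j) p"
    by (rule subst_cong) (rule upper)
  have us: "lower_args (A 0) = lower_args (B 0)"
  proof (rule nth_equalityI)
    show "length (lower_args (A 0)) = length (lower_args (B 0))"
      using lower_args(2)[OF A] lower_args(2)[OF B] by simp
    fix i assume "i < length (lower_args (A 0))"
    then have "Suc i \<in> set (leaf_numbers p)"
      using lower_args(2)[OF A] p proper_set[of "length (leaf_numbers p)" p] by (auto simp: Ops_sOp_iff)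
    then have "Leaf (Suc i) \<in> subtrees p"
      by (simp add: leaf_numbers_subtrees)
    from edge_map_Leaf[OF A this] edge_map_Leaf[OF B this] e
    show "lower_args (A 0) ! i = lower_args (B 0) ! i"
      by simp
  qed
  have "A 0 = B 0"
  proof (rule plug_unique)
    show "plug (subst (\<lambda>j _. A j) p) (A 0) = plug (subst (\<lambda>j _. A j) p) (B 0)"
      using t unfolding target_def P .
    show "separated (plug (subst (\<lambda>j _. A j) p) (A 0))"
      using Ops_sOp_separated[OF arrow_target[OF A]] by (simp add: target_def)
    show "Node 0 (lower_args (A 0)) \<in> subtrees (A 0)" "Node 0 (lower_args (A 0)) \<in> subtrees (B 0)"
      using lower_args(1)[OF A] lower_args(1)[OF B] us by auto
    show "proper (length (lower_args (A 0))) (subst (\<lambda>j _. A j) p)"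
      using proper_source[OF arrow_pre[OF A]] lower_args(2)[OF A] by simp
  qed (use arrow_vertices(1)[OF A, of 0] arrow_vertices(1)[OF B, of 0] in auto)
  moreover have "A j = B j" if "1 \<le> j" "j \<le> length (vertices p)" for j
    using upper Inp_sOp_vertex[OF p that] by blast
  ultimately have "A i = B i" if "i \<in> {0..length (vertices p)}" for i
    using that by (cases "i = 0") auto
  then show ?thesis
    using arrow_pre[OF A] arrow_pre[OF B] by (auto simp: pre_arrow_def intro: extensionalityI)
qed

lemma edge_map_comp:
  assumes A: "arrow p A" and B: "arrow (target p A) B" and s: "s \<in> subtrees p"
  shows "edge_map p (arrow_comp p B A) s = edge_map (target p A) B (edge_map p A s)"
proof -
  let ?t = "target p A" and ?C = "arrow_comp p B A" and ?E = "lower_id B"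
  note p = arrow_source[OF A] and t = arrow_target[OF A]
  note C = arrow_comp[OF A B]
  let ?k = "\<lambda>k. lower_args (A 0) ! (k - 1)" and ?k' = "\<lambda>k. lower_args (B 0) ! (k - 1)"
  let ?us = "lower_args (A 0)" and ?us' = "lower_args (B 0)"
  let ?B = "\<lambda>j (_::nat). B j" and ?A = "\<lambda>j (_::nat). A j"
  note vA = arrow_vertices(2)[OF A]
  have E: "proper n (?E j n)" if "i \<le> length (vertices p)" "(j, n) \<in> set (vertices (A i))" for i j n
    using vA[OF that] arrow_proper[OF B, of j n] by (auto simp: lower_id_def)
  have E_B: "subst ?E a = subst ?B a" if "0 \<notin> set (labels a)" for a
    by (rule subst_cong) (use that vertex_label in \<open>fastforce simp: lower_id_def\<close>)
  have "subst ?E (Node 0 ?us) \<in> subtrees (subst ?E (A 0))"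
    by (rule subtrees_subst[OF lower_args(1)[OF A]]) (use E[OF le0] proper_set in blast)
  moreover have "subst ?E (Node 0 ?us) = Node 0 (map (subst ?B) ?us)"
    using E_B lower_args(3)[OF A] by (auto simp: lower_id_def)
  ultimately have "Node 0 (map (subst ?B) ?us) \<in> subtrees (subst ?E (A 0))"
    by simp
  from subtrees_graft[OF this, of ?k']
  have 1: "Node 0 (map (\<lambda>u. graft ?k' (subst ?B u)) ?us) \<in> subtrees (graft ?k' (subst ?E (A 0)))"
    by (simp add: comp_def)
  have properE: "proper (length (leaf_numbers ?t)) (subst ?E (A 0))"
  proof -
    have "mset (leaf_numbers (subst ?E (A 0))) = mset (leaf_numbers (A 0))"
      by (rule mset_leaves_subst) (rule E[OF le0])
    then show ?thesis
      using t mset_leaves_tgt[OF arrow_pre[OF A]] by (simp add: Ops_sOp_iff proper_def)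
  qed
  have "plug (subst ?E (A 0)) (Node 0 ?us') \<in> subtrees (plug (subst ?E (A 0)) (B 0))"
    unfolding plug_def
  proof (rule subtrees_subst[OF lower_args(1)[OF B]])
    fix j n assume "(j, n) \<in> set (vertices (B 0))"
    then have "j = 0 \<Longrightarrow> n = length (leaf_numbers ?t)"
      using arrow_vertices(2)[OF B, of 0 j n] by auto
    then show "{1..n} \<subseteq> set (leaf_numbers (if j = 0 then subst ?E (A 0) else corolla j n))"
      using proper_set[OF properE] by (auto simp: subset_iff)
  qed
  moreover have "plug (subst ?E (A 0)) (Node 0 ?us') = graft ?k' (subst ?E (A 0))"
    by (rule plug_Node_0) (use lower_args[OF B] properE in auto)
  moreover have "?C 0 = plug (subst ?E (A 0)) (B 0)"
    by (simp add: arrow_comp_def)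
  ultimately have "Node 0 (map (\<lambda>u. graft ?k' (subst ?B u)) ?us) \<in> subtrees (?C 0)"
    using 1 subtrees_trans by metis
  \<comment> \<open>The inputs of the mark in the composite are those of the mark in
    \<open>A 0\<close>, carried into the final target by the second arrow.\<close>
  then have args: "lower_args (?C 0) = map (\<lambda>u. graft ?k' (subst ?B u)) ?us"
    by (rule lower_args_eq[OF separated_lower[OF C]])
  have vs: "(j, n) \<in> set (vertices p)" if "(j, n) \<in> set (vertices s)" for j n
    using subtrees_vertices[OF s] that by auto
  have vsA: "w \<noteq> 0 \<and> (w, m) \<in> set (vertices ?t)"
    if "(j, n) \<in> set (vertices s)" "(w, m) \<in> set (vertices (A j))" for j n w m
    using vA[of j w m] that Ops_sOp_vertex[OF p vs[OF that(1)]] by auto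
  have sC: "subst (\<lambda>j _. ?C j) s = subst ?B (subst ?A s)"
  proof -
    have "subst (\<lambda>j _. ?C j) s = subst (\<lambda>j _. subst ?B (A j)) s"
    proof (rule subst_cong)
      fix j n assume j: "(j, n) \<in> set (vertices s)"
      have "?C j = subst ?E (A j)"
        using Ops_sOp_vertex[OF p vs[OF j]] by (simp add: arrow_comp_def)
      also have "\<dots> = subst ?B (A j)"
        using vsA[OF j] by (intro E_B) force
      finally show "?C j = subst ?B (A j)" .
    qed
    also have "\<dots> = subst ?B (subst ?A s)"
    proof (rule subst_subst[symmetric])
      show "set (leaf_numbers (A v)) \<subseteq> {1..n}" if "(v, n) \<in> set (vertices s)" for v n
        using proper_set[OF arrow_proper[OF A vs[OF that]]] by simp
      show "set (leaf_numbers (B w)) \<subseteq> {1..m}"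
        if "(v, n) \<in> set (vertices s)" "(w, m) \<in> set (vertices (A v))" for v n w m
        using proper_set[OF arrow_proper[OF B]] vsA[OF that] by blast
    qed
    finally show ?thesis .
  qed
  have vsub: "(w, m) \<in> set (vertices ?t)" if "(w, m) \<in> set (vertices (subst ?A s))" for w m
  proof -
    have "mset (vertices (subst ?A s)) = (\<Sum>(j, n)\<in>#mset (vertices s). mset (vertices (A j)))"
      by (rule mset_vertices_subst) (rule arrow_proper[OF A vs])
    then have "(w, m) \<in># (\<Sum>(j, n)\<in>#mset (vertices s). mset (vertices (A j)))"
      using that by (metis set_mset_mset)
    then show ?thesis
      using vsA by auto
  qed
  have lB: "mset (leaf_numbers (subst ?B (subst ?A s))) = mset (leaf_numbers s)"
  proof -
    have "mset (leaf_numbers (subst ?B (subst ?A s))) = mset (leaf_numbers (subst ?A s))"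
      by (rule mset_leaves_subst) (rule arrow_proper[OF B vsub])
    also have "\<dots> = mset (leaf_numbers s)"
      by (rule mset_leaves_subst) (rule arrow_proper[OF A vs])
    finally show ?thesis .
  qed
  have "edge_map ?t B (edge_map p A s) = graft ?k' (subst ?B (graft ?k (subst ?A s)))"
    using edge_map_subtrees[OF A s] s by (simp add: edge_map_def)
  \<comment> \<open>Substitution into vertices passes through the grafting of the inputs of the mark
    at the leaves.\<close>
  also have "subst ?B (graft ?k (subst ?A s)) = graft (\<lambda>l. subst ?B (?k l)) (subst ?B (subst ?A s))"
    by (rule subst_graft) (use vsub proper_set[OF arrow_proper[OF B]] in blast)
  also have "graft ?k' \<dots> = graft (\<lambda>l. graft ?k' (subst ?B (?k l))) (subst ?B (subst ?A s))"
    by (rule graft_graft)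
  also have "\<dots> = graft (\<lambda>l. lower_args (?C 0) ! (l - 1)) (subst ?B (subst ?A s))"
  proof (rule graft_cong)
    fix l assume "l \<in> set (leaf_numbers (subst ?B (subst ?A s)))"
    then have "l \<in> set (leaf_numbers s)"
      using lB by (metis mset_eq_setD)
    then have "l \<in> set (leaf_numbers p)"
      using subtrees_leaf_numbers[OF s] by auto
    then have "l \<in> {1..length (leaf_numbers p)}"
      using p proper_set[of "length (leaf_numbers p)" p] by (simp add: Ops_sOp_iff)
    then have "l - 1 < length ?us"
      using lower_args(2)[OF A] by auto
    then show "graft ?k' (subst ?B (?k l)) = lower_args (?C 0) ! (l - 1)"
      by (simp add: args)
  qed
  also have "\<dots> = edge_map p ?C s"
    using s by (simp add: edge_map_def sC)
  finally show ?thesis ..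
qed

lemma edge_map_id:
  assumes p: "p \<in> Ops sOp"
  shows "edge_map p (arrow_id p) = restrict id (subtrees p)"
proof
  fix s
  show "edge_map p (arrow_id p) s = restrict id (subtrees p) s"
  proof (cases "s \<in> subtrees p")
    case True
    let ?m = "length (leaf_numbers p)"
    have "arrow_id p 0 = corolla 0 ?m"
      by (simp add: arrow_id_def)
    moreover have "Node 0 (map Leaf [1..<Suc ?m]) \<in> subtrees (corolla 0 ?m)"
      by (simp add: corolla_def del: upt_Suc)
    ultimately have args: "lower_args (arrow_id p 0) = map Leaf [1..<Suc ?m]"
      using separated_lower[OF arrow_arr_id[OF p]] lower_args_eq by metis
    have "subst (\<lambda>j _. arrow_id p j) s = s"
    proof (rule subst_id)
      fix j n assume "(j, n) \<in> set (vertices s)"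
      then have j: "(j, n) \<in> set (vertices p)"
        using subtrees_vertices[OF True] by auto
      show "arrow_id p j = corolla j n"
        using Ops_sOp_vertex[OF p j] Inp_sOp[OF p j] by (simp add: arrow_id_def)
    qed
    moreover have "graft (\<lambda>k. map Leaf [1..<Suc ?m] ! (k - 1)) s = s"
    proof (rule graft_id)
      fix k assume "k \<in> set (leaf_numbers s)"
      then have "k \<in> set (leaf_numbers p)"
        using subtrees_leaf_numbers[OF True] by auto
      then have "k \<in> {1..?m}"
        using p proper_set[of "length (leaf_numbers p)" p] by (simp add: Ops_sOp_iff)
      then show "map Leaf [1..<Suc ?m] ! (k - 1) = Leaf k"
        using map_upt_nth by auto
    qed
    ultimately show ?thesis
      using True by (simp only: edge_map_def args restrict_apply' id_apply)
  qed (simp add: edge_map_def)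
qed

lemma edge_map_full:
  assumes p: "p \<in> Ops sOp" and t: "t \<in> Ops sOp" and f: "f \<in> edge_maps p t"
  shows "\<exists>A. arrow p A \<and> target p A = t \<and> edge_map p A = f"
proof -
  let ?n = "length (vertices p)" and ?m = "length (leaf_numbers p)"
  have f_sub: "f s \<in> subtrees t" if "s \<in> subtrees p" for s
    using f that by (auto simp: edge_maps_def)
  have f_cut: "inj_on f (set ts)" "planar_cut (f (Node v ts)) (f ` set ts)"
    if "Node v ts \<in> subtrees p" for v ts
    using f that by (auto simp: edge_maps_def)
  \<comment> \<open>A label determines its vertex in \<open>p\<close>, so one tree per label
    suffices. It is the part of \<open>t\<close> below the cut at that vertex, with leaves numbered
    by the positions of the inputs.\<close>
  have "\<exists>a. \<forall>ts. Node j ts \<in> subtrees p \<longrightarrow> graft (\<lambda>k. f (ts ! (k - 1))) a = f (Node j ts) \<and> proper (length ts) a" for j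
  proof (cases "\<exists>ts. Node j ts \<in> subtrees p")
    case True
    then obtain ts where N: "Node j ts \<in> subtrees p"
      by auto
    let ?h = "\<lambda>k. f (ts ! (k - 1))"
    have dts: "distinct ts"
      using separated_distinct_children[OF separated_subtrees[OF Ops_sOp_separated[OF p] N]] .
    have "inj_on ?h {1..length ts}"
    proof (rule inj_onI)
      fix k l assume kl: "k \<in> {1..length ts}" "l \<in> {1..length ts}" "?h k = ?h l"
      then have "ts ! (k - 1) = ts ! (l - 1)"
        by (intro inj_onD[OF f_cut(1)[OF N], of "ts ! (k - 1)" "ts ! (l - 1)"]) auto
      moreover have "k - 1 < length ts" "l - 1 < length ts"
        using kl by auto
      ultimately have "k - 1 = l - 1"
        using nth_eq_iff_index_eq[OF dts] by blast
      then show "k = l"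
        using kl by auto
    qed
    then obtain a where "graft ?h a = f (Node j ts)" "distinct (leaf_numbers a)" "set (leaf_numbers a) = {1..length ts}"
      using planar_cut_graft_ex[OF f_cut(2)[OF N] separated_subtrees[OF Ops_sOp_separated[OF t] f_sub[OF N]] image_nth_pred] by blast
    then have "graft ?h a = f (Node j ts) \<and> proper (length ts) a"
      by (simp add: proper_iff)
    moreover have "ts' = ts" if "Node j ts' \<in> subtrees p" for ts'
      using separated_Node_unique[OF Ops_sOp_separated[OF p] that N] .
    ultimately show ?thesis
      by blast
  qed auto
  then obtain A1 where A1: "\<And>j ts. Node j ts \<in> subtrees p \<Longrightarrow>
      graft (\<lambda>k. f (ts ! (k - 1))) (A1 j) = f (Node j ts) \<and> proper (length ts) (A1 j)"
    by metis
  have proper1: "proper n (A1 j)" if "(j, n) \<in> set (vertices p)" for j n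
    using that A1 unfolding vertices_subtrees by auto
  \<comment> \<open>The chosen trees and the values on leaves determine \<open>f\<close>, so it has
    the shape of an edge map.\<close>
  have fs: "f s = graft (\<lambda>k. f (Leaf k)) (subst (\<lambda>j _. A1 j) s)" if "s \<in> subtrees p" for s
    using that
  proof (induction s)
    case (Node j ts)
    have "graft (\<lambda>k. f (Leaf k)) (subst (\<lambda>j _. A1 j) (Node j ts)) =
      graft (\<lambda>k. graft (\<lambda>k. f (Leaf k)) (map (subst (\<lambda>j _. A1 j)) ts ! (k - 1))) (A1 j)"
      by (simp add: graft_graft)
    also have "\<dots> = graft (\<lambda>k. f (ts ! (k - 1))) (A1 j)"
    proof (rule graft_cong)
      fix k assume "k \<in> set (leaf_numbers (A1 j))"
      then have "k - 1 < length ts"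
        using A1[OF Node.prems] proper_set[of "length ts" "A1 j"] by auto
      then show "graft (\<lambda>k. f (Leaf k)) (map (subst (\<lambda>j _. A1 j)) ts ! (k - 1)) = f (ts ! (k - 1))"
        using Node.IH[of "ts ! (k - 1)"] child_subtrees[OF Node.prems, of "ts ! (k - 1)"] by simp
    qed
    finally show ?case
      using A1[OF Node.prems] by simp
  qed simp
  \<comment> \<open>The future inputs of the mark are the images of the leaves of
    \<open>p\<close>.\<close>
  define us where "us = map (\<lambda>k. f (Leaf k)) [1..<Suc ?m]"
  have lus: "length us = ?m"
    by (simp add: us_def del: upt_Suc)
  let ?P = "subst (\<lambda>j _. A1 j) p"
  have properp: "proper ?m p"
    using p by (simp add: Ops_sOp_iff)
  have P: "proper ?m ?P"
    using proper_subst[of p "\<lambda>j _. A1 j"] proper1 properp by auto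
  have leafs: "graft (\<lambda>k. f (Leaf k)) (subst (\<lambda>j _. A1 j) s) = graft (\<lambda>k. us ! (k - 1)) (subst (\<lambda>j _. A1 j) s)"
    if s: "s \<in> subtrees p" for s
  proof (rule graft_cong)
    fix k assume "k \<in> set (leaf_numbers (subst (\<lambda>j _. A1 j) s))"
    moreover have "mset (leaf_numbers (subst (\<lambda>j _. A1 j) s)) = mset (leaf_numbers s)"
      by (rule mset_leaves_subst, rule proper1) (use subtrees_vertices[OF s] in blast)
    ultimately have "k \<in> set (leaf_numbers s)"
      by (metis mset_eq_setD)
    then have "k \<in> {1..?m}"
      using subtrees_leaf_numbers[OF s] proper_set[OF properp] by auto
    then show "f (Leaf k) = us ! (k - 1)"
      unfolding us_def by (subst map_upt_nth) auto
  qed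
  have R: "graft (\<lambda>k. us ! (k - 1)) ?P \<in> subtrees t"
    using f_sub[of p] fs[of p] leafs[of p] by simp
  have "0 \<notin> set (labels t)"
    using Ops_sOp_labels[OF t] by simp
  \<comment> \<open>The image of the root of \<open>p\<close> is the occurrence in \<open>t\<close>
    that the mark replaces.\<close>
  then obtain a where a: "plug ?P a = t" "Node 0 us \<in> subtrees a" "count (mset (labels a)) 0 = 1"
    using plug_ex[OF R] P lus by auto
  define A where "A = (\<lambda>i\<in>{0..?n}. if i = 0 then a else A1 i)"
  have A_A1: "A j = A1 j" if "(j, n) \<in> set (vertices p)" for j n
    using Ops_sOp_vertex[OF p that] by (simp add: A_def)
  have A0: "A 0 = a"
    by (simp add: A_def)
  have "(0, ?m) \<in> set (vertices a)"
    using a(2) lus by (auto simp: vertices_subtrees)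
  then have pre: "pre_arrow p A"
    unfolding pre_arrow_def A0 using p a(3) proper1 A_A1 by (auto simp: A_def)
  have "subst (\<lambda>j _. A j) p = ?P"
    by (rule subst_cong) (rule A_A1)
  then have target: "target p A = t"
    by (simp add: target_def A0 a(1))
  have arrow: "arrow p A"
    using pre target t by (simp add: arrow_def)
  have args: "lower_args (A 0) = us"
    unfolding A0 by (rule lower_args_eq[OF separated_lower[OF arrow, unfolded A0] a(2)])
  have "edge_map p A = f"
  proof
    fix s
    show "edge_map p A s = f s"
    proof (cases "s \<in> subtrees p")
      case True
      have "subst (\<lambda>j _. A j) s = subst (\<lambda>j _. A1 j) s"
        by (rule subst_cong, rule A_A1) (use subtrees_vertices[OF True] in blast)
      then show ?thesis
        using True fs[OF True] leafs[OF True] by (simp add: edge_map_def args)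
    next
      case False
      then have "f s = undefined"
        using f unfolding edge_maps_def by blast
      then show ?thesis
        using False by (simp add: edge_map_def)
    qed
  qed
  then show ?thesis
    using arrow target by blast
qed

section \<open>Cuts of rooted trees\<close>

text \<open>\<open>tree_cut T e X\<close> says that \<open>X\<close> is the set of leaves of a subtree of \<open>T\<close> with root edge \<open>e\<close>.\<close>

inductive tree_cut :: "('e, 'v) tree \<Rightarrow> 'e \<Rightarrow> 'e set \<Rightarrow> bool" for T where
  edge: "e \<in> Edges T \<Longrightarrow> tree_cut T e {e}"
| node: "v \<in> Verts T \<Longrightarrow> (\<And>d. d \<in> In T v \<Longrightarrow> tree_cut T d (X d)) \<Longrightarrow> tree_cut T (Outedge T v) (\<Union>d\<in>In T v. X d)"

definition below :: "('e, 'v) tree \<Rightarrow> ('e \<times> 'e) set" where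
  "below T = {(d, Outedge T v) | d v. v \<in> Verts T \<and> d \<in> In T v}"

locale rooted_tree =
  fixes T :: "('e, 'v) tree"
  assumes T: "finite_rooted_tree T"
begin

lemma
  shows finite_Edges: "finite (Edges T)" and finite_Verts: "finite (Verts T)"
    and Root_Edges: "Root T \<in> Edges T"
    and In_Edges: "v \<in> Verts T \<Longrightarrow> d \<in> In T v \<Longrightarrow> d \<in> Edges T"
    and Outedge_Edges: "v \<in> Verts T \<Longrightarrow> Outedge T v \<in> Edges T"
    and Outedge_inj: "v \<in> Verts T \<Longrightarrow> w \<in> Verts T \<Longrightarrow> Outedge T v = Outedge T w \<Longrightarrow> v = w"
    and Root_In: "v \<in> Verts T \<Longrightarrow> Root T \<notin> In T v"
    and In_unique: "v \<in> Verts T \<Longrightarrow> w \<in> Verts T \<Longrightarrow> d \<in> In T v \<Longrightarrow> d \<in> In T w \<Longrightarrow> v = w"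
    and reach_Root: "e \<in> Edges T \<Longrightarrow> (e, Root T) \<in> (below T)\<^sup>*"
proof -
  show "finite (Edges T)" "finite (Verts T)" "Root T \<in> Edges T"
    "v \<in> Verts T \<Longrightarrow> Outedge T v \<in> Edges T" "v \<in> Verts T \<Longrightarrow> Root T \<notin> In T v"
    "e \<in> Edges T \<Longrightarrow> (e, Root T) \<in> (below T)\<^sup>*"
    using T by (auto simp: finite_rooted_tree_def below_def)
  show in_edges: "d \<in> Edges T" if "v \<in> Verts T" "d \<in> In T v" for v d
    using T that by (auto simp: finite_rooted_tree_def)
  show "v \<in> Verts T \<Longrightarrow> w \<in> Verts T \<Longrightarrow> Outedge T v = Outedge T w \<Longrightarrow> v = w"
    using T by (auto simp: finite_rooted_tree_def inj_on_def)
  assume v: "v \<in> Verts T" "w \<in> Verts T" "d \<in> In T v" "d \<in> In T w"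
  then have "d \<noteq> Root T"
    using T by (auto simp: finite_rooted_tree_def)
  moreover have "d \<in> Edges T"
    by (rule in_edges[OF v(1,3)])
  ultimately have "\<exists>!v. v \<in> Verts T \<and> d \<in> In T v"
    using T by (auto simp: finite_rooted_tree_def)
  with v show "v = w"
    by blast
qed

lemma single_valued_below: "single_valued (below T)"
  by (auto simp: single_valued_def below_def dest: In_unique)

lemma Root_below: "(Root T, e) \<notin> below T"
  using Root_In by (auto simp: below_def)

text \<open>Paths towards the root are unique. A path on a cycle could never leave it, yet it has to
  reach the root, which has no successor.\<close>

lemma below_acyclic: "(e, e) \<notin> (below T)\<^sup>+" if "e \<in> Edges T"
proof
  assume cyc: "(e, e) \<in> (below T)\<^sup>+"
  have "(x, e) \<in> (below T)\<^sup>+" if "(e, x) \<in> (below T)\<^sup>*" for x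
    using that
  proof (induction rule: rtrancl_induct)
    case (step y z)
    from step.IH obtain w where w: "(y, w) \<in> below T" "(w, e) \<in> (below T)\<^sup>*"
      by (meson tranclD)
    then have "w = z"
      using step.hyps single_valued_below by (meson single_valuedD)
    then show ?case
      using w(2) cyc by (meson rtrancl_into_trancl1 rtrancl_trancl_trancl)
  qed (rule cyc)
  from this[OF reach_Root[OF that]] show False
    by (meson Root_below tranclD)
qed

lemma comparable:
  assumes "(e, x) \<in> (below T)\<^sup>*" "(e, y) \<in> (below T)\<^sup>*"
  shows "(x, y) \<in> (below T)\<^sup>* \<or> (y, x) \<in> (below T)\<^sup>*"
  using assms single_valued_below by (meson single_valued_confluent)

text \<open>Two different inputs of \<open>v\<close> with a common edge above them would be
  comparable, and the unique step from the upper one leads to the output of \<open>v\<close>, which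
  would close a cycle.\<close>

lemma siblings:
  assumes "v \<in> Verts T" "d \<in> In T v" "d' \<in> In T v" "(e, d) \<in> (below T)\<^sup>*" "(e, d') \<in> (below T)\<^sup>*"
  shows "d = d'"
proof -
  have False if "(x, y) \<in> (below T)\<^sup>*" "x \<noteq> y" "x \<in> In T v" "y \<in> In T v" for x y
  proof -
    from that obtain w where w: "(x, w) \<in> below T" "(w, y) \<in> (below T)\<^sup>*"
      by (meson converse_rtranclE)
    moreover have "(x, Outedge T v) \<in> below T" "(y, Outedge T v) \<in> below T"
      using assms(1) that by (auto simp: below_def)
    ultimately have "(Outedge T v, y) \<in> (below T)\<^sup>*"
      using single_valued_below by (metis single_valuedD)
    then have "(Outedge T v, Outedge T v) \<in> (below T)\<^sup>+"
      using \<open>(y, Outedge T v) \<in> below T\<close> by (rule rtrancl_into_trancl1)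
    then show False
      using below_acyclic Outedge_Edges[OF assms(1)] by blast
  qed
  then show ?thesis
    using comparable[OF assms(4,5)] assms(2,3) by metis
qed

lemma cut_Edges: "tree_cut T e X \<Longrightarrow> e \<in> Edges T \<and> X \<subseteq> Edges T"
  by (induction rule: tree_cut.induct) (auto simp: Outedge_Edges)

lemma cut_above: "tree_cut T e X \<Longrightarrow> x \<in> X \<Longrightarrow> (x, e) \<in> (below T)\<^sup>*"
proof (induction arbitrary: x rule: tree_cut.induct)
  case (node v X)
  then obtain d where d: "d \<in> In T v" "x \<in> X d"
    by auto
  then have "(x, d) \<in> (below T)\<^sup>*"
    using node by blast
  moreover have "(d, Outedge T v) \<in> below T"
    using d node.hyps by (auto simp: below_def)
  ultimately show ?case
    by (rule rtrancl_into_rtrancl)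
qed simp

lemma cut_siblings_disjoint:
  assumes "v \<in> Verts T" "d \<in> In T v" "d' \<in> In T v" "tree_cut T d X" "tree_cut T d' X'" "x \<in> X" "x \<in> X'"
  shows "d = d'"
  using siblings[OF assms(1-3)] cut_above assms by blast

text \<open>A path to the root enters each vertex through a single input, so no edge lies above two
  members of a cut. Injectivity of tree maps on cuts depends on this.\<close>

lemma cut_antichain:
  "tree_cut T e Y \<Longrightarrow> y \<in> Y \<Longrightarrow> y' \<in> Y \<Longrightarrow> (x, y) \<in> (below T)\<^sup>* \<Longrightarrow> (x, y') \<in> (below T)\<^sup>* \<Longrightarrow> y = y'"
proof (induction arbitrary: y y' rule: tree_cut.induct)
  case (node v X)
  then obtain d d' where d: "d \<in> In T v" "y \<in> X d" "d' \<in> In T v" "y' \<in> X d'"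
    by auto
  have "(x, d) \<in> (below T)\<^sup>*" "(x, d') \<in> (below T)\<^sup>*"
    using d node cut_above by (meson rtrancl_trans)+
  then have "d = d'"
    using siblings node.hyps d by blast
  then show ?case
    using d node by blast
qed simp

text \<open>Corresponds to grafting subtrees onto the leaves of a subtree.\<close>

lemma cut_trans: "tree_cut T e Y \<Longrightarrow> (\<And>y. y \<in> Y \<Longrightarrow> tree_cut T y (Z y)) \<Longrightarrow> tree_cut T e (\<Union>y\<in>Y. Z y)"
proof (induction rule: tree_cut.induct)
  case (node v X)
  have "tree_cut T (Outedge T v) (\<Union>d\<in>In T v. \<Union>y\<in>X d. Z y)"
    by (rule tree_cut.node) (use node in auto)
  then show ?case
    by (metis UN_UN_flatten)
qed auto

lemma cut_vertex: "v \<in> Verts T \<Longrightarrow> tree_cut T (Outedge T v) (In T v)"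
  using tree_cut.node[of v T "\<lambda>d. {d}"] tree_cut.edge In_Edges by (metis UN_singleton)


section \<open>Operations of the free operad on a tree\<close>

abbreviation "\<Sigma> \<equiv> tree_signature T"

lemma Ins_tree:
  assumes "v \<in> Verts T"
  shows "distinct (Ins \<Sigma> v)" "set (Ins \<Sigma> v) = In T v"
proof -
  have "finite (In T v)"
    using finite_Edges In_Edges[OF assms] by (meson finite_subset subsetI)
  then have "\<exists>es. distinct es \<and> set es = In T v"
    using finite_distinct_list by blast
  from someI_ex[OF this] show "distinct (Ins \<Sigma> v)" "set (Ins \<Sigma> v) = In T v"
    by (auto simp: tree_signature_def)
qed

lemma tree_signature_sel [simp]: "Colours \<Sigma> = Edges T" "Gens \<Sigma> = Verts T" "Outp \<Sigma> = Outedge T"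
  by (simp_all add: tree_signature_def)

text \<open>The statement also locates the vertices of \<open>t\<close>, as the induction requires:
  by \<open>siblings\<close> no leaf colour and no vertex occurs under two children, and by
  acyclicity the root vertex does not recur. Output edges being no leaf colours is what uniqueness
  of operations needs.\<close>

lemma well_coloured_cut:
  assumes "well_coloured \<Sigma> cs t" "root_colour \<Sigma> cs t \<in> Edges T" "distinct (leaf_numbers t)"
  shows "tree_cut T (root_colour \<Sigma> cs t) (set (map (\<lambda>k. cs ! (k - 1)) (leaf_numbers t))) \<and>
    distinct (map (\<lambda>k. cs ! (k - 1)) (leaf_numbers t)) \<and>
    (\<forall>v\<in>set (map fst (vertices t)). v \<in> Verts T \<and> (Outedge T v, root_colour \<Sigma> cs t) \<in> (below T)\<^sup>* \<and>
      Outedge T v \<notin> set (map (\<lambda>k. cs ! (k - 1)) (leaf_numbers t))) \<and>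
    distinct (map fst (vertices t))"
  using assms
proof (induction t)
  case (Leaf k)
  then show ?case
    by (auto intro: tree_cut.edge)
next
  case (Node v ts)
  let ?L = "\<lambda>t. map (\<lambda>k. cs ! (k - 1)) (leaf_numbers t)"
  let ?r = "root_colour \<Sigma> cs"
  have v: "v \<in> Verts T" and ins: "map ?r ts = Ins \<Sigma> v" and wc: "\<And>t. t \<in> set ts \<Longrightarrow> well_coloured \<Sigma> cs t"
    using Node.prems by auto
  have dr: "distinct (map ?r ts)" and sr: "set (map ?r ts) = In T v"
    using Ins_tree[OF v] ins by auto
  have rin: "?r t \<in> In T v" if "t \<in> set ts" for t
    using that sr by auto
  have rdisj: "t = t'" if "t \<in> set ts" "t' \<in> set ts" "?r t = ?r t'" for t t'
    using that dr by (auto simp: distinct_map inj_on_def)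
  have IH: "tree_cut T (?r t) (set (?L t))" "distinct (?L t)"
      "\<And>w. w \<in> set (map fst (vertices t)) \<Longrightarrow> w \<in> Verts T \<and> (Outedge T w, ?r t) \<in> (below T)\<^sup>* \<and> Outedge T w \<notin> set (?L t)"
      "distinct (map fst (vertices t))"
    if "t \<in> set ts" for t
    using Node.IH[OF that wc[OF that] In_Edges[OF v rin[OF that]]] Node.prems(3) that
    by (auto simp: distinct_concat_iff)
  have below_v: "(?r t, Outedge T v) \<in> below T" if "t \<in> set ts" for t
    using rin[OF that] v by (auto simp: below_def)
  \<comment> \<open>The children have distinct root colours, so their cuts can be indexed by the
    input edges of \<open>v\<close>, as the rule for cuts demands.\<close>
  define X where "X d = set (?L (THE t. t \<in> set ts \<and> ?r t = d))" for d
  have X: "X (?r t) = set (?L t)" if "t \<in> set ts" for t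
    unfolding X_def by (rule arg_cong[of _ _ "\<lambda>t. set (?L t)"], rule the_equality) (use that rdisj in auto)
  have "tree_cut T (Outedge T v) (\<Union>d\<in>In T v. X d)"
    by (rule tree_cut.node[OF v]) (use X IH(1) in \<open>auto simp flip: sr\<close>)
  moreover have "(\<Union>d\<in>In T v. X d) = set (?L (Node v ts))"
    using X by (auto simp flip: sr)
  ultimately have 1: "tree_cut T (Outedge T v) (set (?L (Node v ts)))"
    by simp
  have above: "(x, ?r t) \<in> (below T)\<^sup>*"
    if "t \<in> set ts" "x \<in> set (?L t) \<or> x \<in> Outedge T ` set (map fst (vertices t))" for t x
    using that IH(3)[OF that(1)] cut_above[OF IH(1)[OF that(1)]] by blast
  \<comment> \<open>An edge occurring in two children would lie above two inputs of
    \<open>v\<close>.\<close>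
  have disj: "t = t'"
    if "t \<in> set ts" "t' \<in> set ts" "x \<in> set (?L t) \<or> x \<in> Outedge T ` set (map fst (vertices t))"
     "x \<in> set (?L t') \<or> x \<in> Outedge T ` set (map fst (vertices t'))" for t t' x
    using siblings[OF v rin[OF that(1)] rin[OF that(2)] above[OF that(1,3)] above[OF that(2,4)]] rdisj that by blast
  have dts: "distinct ts"
    using dr by (simp add: distinct_map)
  have "distinct (concat (map ?L ts))"
    by (rule distinct_concat_map[OF dts]) (use IH(2) disj in blast)+
  then have 2: "distinct (?L (Node v ts))"
    by (simp add: map_concat comp_def)
  have 4: "distinct (map fst (vertices (Node v ts)))"
  proof -
    have "distinct (concat (map (\<lambda>t. map fst (vertices t)) ts))"
    proof (rule distinct_concat_map[OF dts])
      fix t t' x assume "t \<in> set ts" "t' \<in> set ts" "x \<in> set (map fst (vertices t))" "x \<in> set (map fst (vertices t'))"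
      then show "t = t'"
        using disj[of t t' "Outedge T x"] by blast
    qed (rule IH(4))
    moreover have "v \<notin> set (map fst (vertices t))" if "t \<in> set ts" for t
    proof
      assume "v \<in> set (map fst (vertices t))"
      then have "(Outedge T v, ?r t) \<in> (below T)\<^sup>*"
        using IH(3)[OF that] by blast
      then have "(Outedge T v, Outedge T v) \<in> (below T)\<^sup>+"
        using below_v[OF that] by (rule rtrancl_into_trancl1)
      then show False
        using below_acyclic Outedge_Edges[OF v] by blast
    qed
    ultimately show ?thesis
      by (auto simp: map_concat comp_def)
  qed
  have 3: "w \<in> Verts T \<and> (Outedge T w, Outedge T v) \<in> (below T)\<^sup>* \<and> Outedge T w \<notin> set (?L (Node v ts))"
    if w: "w \<in> set (map fst (vertices (Node v ts)))" for w
  proof -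
    consider "w = v" | t where "t \<in> set ts" "w \<in> set (map fst (vertices t))"
      using w by auto
    then show ?thesis
    proof cases
      case 1
      have "Outedge T v \<notin> set (?L t)" if t: "t \<in> set ts" for t
      proof
        assume "Outedge T v \<in> set (?L t)"
        then have "(Outedge T v, Outedge T v) \<in> (below T)\<^sup>+"
          using below_v[OF t] above[OF t] by (meson rtrancl_into_trancl1)
        then show False
          using below_acyclic Outedge_Edges[OF v] by blast
      qed
      then show ?thesis
        using 1 v by auto
    next
      case 2
      have "Outedge T w \<notin> set (?L t')" if "t' \<in> set ts" for t'
        using disj[OF 2(1) that, of "Outedge T w"] 2 IH(3)[OF 2(1)] by blast
      moreover have "(Outedge T w, Outedge T v) \<in> (below T)\<^sup>*"
        using IH(3)[OF 2] below_v[OF 2(1)] by (meson rtrancl.rtrancl_into_rtrancl)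
      ultimately show ?thesis
        using IH(3)[OF 2] by auto
    qed
  qed
  show ?case
    using 1 2 3 4 by (simp only: root_colour.simps tree_signature_sel) blast
qed

text \<open>\<open>cs\<close> may contain more than the cut, so that all branches of the induction
  share one list of variables; leaves are numbered by their positions in it.\<close>

lemma cut_well_coloured:
  assumes "tree_cut T e X" "distinct cs" "X \<subseteq> set cs"
  shows "\<exists>t. well_coloured \<Sigma> cs t \<and> root_colour \<Sigma> cs t = e \<and> distinct (leaf_numbers t) \<and>
    set (leaf_numbers t) = {k \<in> {1..length cs}. cs ! (k - 1) \<in> X}"
  using assms
proof (induction rule: tree_cut.induct)
  case (edge e)
  then obtain i where i: "i < length cs" "cs ! i = e"
    by (auto simp: in_set_conv_nth)
  have "k = Suc i" if "k \<in> {1..length cs}" "cs ! (k - 1) = e" for k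
    using that i edge.prems(1) nth_eq_iff_index_eq[of cs "k - 1" i] by auto
  then have "{k \<in> {1..length cs}. cs ! (k - 1) \<in> {e}} = {Suc i}"
    using i by auto
  then show ?case
    using i by (intro exI[of _ "Leaf (Suc i)"]) simp
next
  case (node v X)
  let ?K = "\<lambda>d. {k \<in> {1..length cs}. cs ! (k - 1) \<in> X d}"
  have "\<exists>t. well_coloured \<Sigma> cs t \<and> root_colour \<Sigma> cs t = d \<and> distinct (leaf_numbers t) \<and>
    set (leaf_numbers t) = ?K d" if "d \<in> In T v" for d
    using node.IH[OF that node.prems(1)] node.prems(2) that by blast
  then have "\<exists>t. \<forall>d\<in>In T v. well_coloured \<Sigma> cs (t d) \<and> root_colour \<Sigma> cs (t d) = d \<and>
      distinct (leaf_numbers (t d)) \<and> set (leaf_numbers (t d)) = ?K d"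
    by (intro bchoice ballI)
  then obtain t where t: "\<And>d. d \<in> In T v \<Longrightarrow> well_coloured \<Sigma> cs (t d) \<and> root_colour \<Sigma> cs (t d) = d \<and>
      distinct (leaf_numbers (t d)) \<and> set (leaf_numbers (t d)) = ?K d"
    by blast
  note I = Ins_tree[OF node.hyps(1)]
  have "distinct (concat (map (\<lambda>d. leaf_numbers (t d)) (Ins \<Sigma> v)))"
  proof (rule distinct_concat_map[OF I(1)])
    fix d d' k assume "d \<in> set (Ins \<Sigma> v)" "d' \<in> set (Ins \<Sigma> v)"
      and "k \<in> set (leaf_numbers (t d))" "k \<in> set (leaf_numbers (t d'))"
    then show "d = d'"
      using t[of d] t[of d'] I(2) node.hyps(2)[of d] node.hyps(2)[of d']
        cut_siblings_disjoint[OF node.hyps(1), of d d' "X d" "X d'" "cs ! (k - 1)"] by auto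
  qed (use t I(2) in blast)
  then have "distinct (leaf_numbers (Node v (map t (Ins \<Sigma> v))))"
    using I by (simp add: comp_def)
  moreover have "map (root_colour \<Sigma> cs) (map t (Ins \<Sigma> v)) = Ins \<Sigma> v"
    using t I by (auto intro: map_idI)
  moreover have "set (leaf_numbers (Node v (map t (Ins \<Sigma> v)))) = {k \<in> {1..length cs}. cs ! (k - 1) \<in> (\<Union>d\<in>In T v. X d)}"
    using t I by auto
  ultimately show ?case
    using t I node.hyps(1) by (intro exI[of _ "Node v (map t (Ins \<Sigma> v))"]) auto
qed

text \<open>Read from the root: the colour of an edge decides whether a variable or a vertex comes
  next, because output edges of the vertices that occur are not in \<open>cs\<close>. The output
  edge then determines the vertex, and distinctness of \<open>cs\<close> the variable.\<close>

lemma well_coloured_unique: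
  assumes "well_coloured \<Sigma> cs t" "well_coloured \<Sigma> cs t'" "root_colour \<Sigma> cs t = root_colour \<Sigma> cs t'"
    and "distinct cs" "set (leaf_numbers t) \<subseteq> {1..length cs}" "set (leaf_numbers t') \<subseteq> {1..length cs}"
    and "\<And>v. v \<in> set (map fst (vertices t)) \<union> set (map fst (vertices t')) \<Longrightarrow> Outedge T v \<notin> set cs"
  shows "t = t'"
  using assms
proof (induction t arbitrary: t')
  case (Leaf k)
  show ?case
  proof (cases t')
    case (Leaf k')
    then have "k - 1 = k' - 1" "1 \<le> k" "1 \<le> k'"
      using Leaf.prems nth_eq_iff_index_eq[of cs "k - 1" "k' - 1"] by auto
    then show ?thesis
      using Leaf by simp
  next
    case (Node v ts)
    then have "Outedge T v = cs ! (k - 1)"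
      using Leaf.prems by simp
    moreover have "cs ! (k - 1) \<in> set cs"
      using Leaf.prems(5) by (intro nth_mem) auto
    ultimately show ?thesis
      using Leaf.prems(7)[of v] Node by simp
  qed
next
  case (Node v ts)
  show ?case
  proof (cases t')
    case (Leaf k)
    then have "Outedge T v = cs ! (k - 1)"
      using Node.prems by simp
    moreover have "cs ! (k - 1) \<in> set cs"
      using Node.prems(6) Leaf by (intro nth_mem) auto
    ultimately show ?thesis
      using Node.prems(7)[of v] by simp
  next
    case t': (Node v' ts')
    then have v: "v' = v"
      using Node.prems Outedge_inj by simp
    then have roots: "map (root_colour \<Sigma> cs) ts = map (root_colour \<Sigma> cs) ts'"
      using Node.prems t' by simp
    then have len: "length ts = length ts'"
      by (metis length_map)
    have "ts = ts'"
    proof (rule nth_equalityI[OF len])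
      fix i assume i: "i < length ts"
      then have mem: "ts ! i \<in> set ts" "ts' ! i \<in> set ts'"
        using len by auto
      show "ts ! i = ts' ! i"
      proof (rule Node.IH[OF mem(1)])
        show "root_colour \<Sigma> cs (ts ! i) = root_colour \<Sigma> cs (ts' ! i)"
          using arg_cong[OF roots, of "\<lambda>xs. xs ! i"] i len by simp
        show "Outedge T w \<notin> set cs"
          if "w \<in> set (map fst (vertices (ts ! i))) \<union> set (map fst (vertices (ts' ! i)))" for w
          using Node.prems(7)[of w] mem that t' by auto
      qed (use Node.prems mem t' in auto)
    qed
    then show ?thesis
      using v t' by simp
  qed
qed

abbreviation "P \<equiv> Omega_operad T"

lemma Omega_sel [simp]:
  "Col P = Edges T" "Inp P (cs, t) = cs" "Out P (cs, t) = root_colour \<Sigma> cs t" "Unit P c = ([c], Leaf 1)"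
  "Perm P \<sigma> (cs, t) = ([cs ! (inv \<sigma> k - 1). k \<leftarrow> [1..<Suc (length cs)]], graft (\<lambda>k. Leaf (\<sigma> k)) t)"
  "Comp P (cs, t) i (ds, s) = (take (i - 1) cs @ ds @ drop i cs,
        graft (\<lambda>k. if k = i then graft (\<lambda>l. Leaf (i - 1 + l)) s
                   else Leaf (shift i (length ds) k)) t)"
  by (simp_all add: Omega_operad_def free_operad_def del: upt_Suc)

lemma Ops_Omega_iff:
  "(cs, t) \<in> Ops P \<longleftrightarrow> set cs \<subseteq> Edges T \<and> well_coloured \<Sigma> cs t \<and>
     distinct (leaf_numbers t) \<and> set (leaf_numbers t) = {1..length cs}"
  by (simp add: Omega_operad_def free_operad_def)

lemma root_colour_Edges:
  assumes "(cs, t) \<in> Ops P"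
  shows "root_colour \<Sigma> cs t \<in> Edges T"
proof (cases t)
  case (Leaf k)
  have "set (leaf_numbers t) = {1..length cs}"
    using assms by (simp add: Ops_Omega_iff)
  then have "k \<in> {1..length cs}"
    unfolding Leaf by auto
  then have "k - 1 < length cs"
    by auto
  then show ?thesis
    using assms Leaf by (auto simp: Ops_Omega_iff subset_iff)
next
  case (Node v ts)
  then show ?thesis
    using assms Outedge_Edges by (auto simp: Ops_Omega_iff)
qed

lemma Ops_OmegaD:
  assumes "(cs, t) \<in> Ops P"
  shows "distinct cs" "tree_cut T (root_colour \<Sigma> cs t) (set cs)"
    "\<And>v. v \<in> set (map fst (vertices t)) \<Longrightarrow> v \<in> Verts T \<and> Outedge T v \<notin> set cs"
    "distinct (map fst (vertices t))"
proof -
  let ?L = "map (\<lambda>k. cs ! (k - 1)) (leaf_numbers t)"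
  have t: "well_coloured \<Sigma> cs t" "distinct (leaf_numbers t)" "set (leaf_numbers t) = {1..length cs}"
    using assms by (auto simp: Ops_Omega_iff)
  have "set ?L = set (map (\<lambda>k. cs ! (k - 1)) [1..<Suc (length cs)])"
    by (simp only: set_map t(3) set_upt atLeastLessThanSuc_atLeastAtMost)
  then have L: "set ?L = set cs"
    by (simp only: map_nth_pred)
  note W = well_coloured_cut[OF t(1) root_colour_Edges[OF assms] t(2)]
  show "tree_cut T (root_colour \<Sigma> cs t) (set cs)" "distinct (map fst (vertices t))"
    "\<And>v. v \<in> set (map fst (vertices t)) \<Longrightarrow> v \<in> Verts T \<and> Outedge T v \<notin> set cs"
    using W L by auto
  \<comment> \<open>The distinct list of leaf colours has the same length and the same elements as
    \<open>cs\<close>, which forces \<open>cs\<close> to be distinct.\<close>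
  have "card (set (leaf_numbers t)) = length cs"
    using t(3) by simp
  then have "length (leaf_numbers t) = length cs"
    using t(2) distinct_card by fastforce
  moreover have "distinct ?L"
    using W by blast
  ultimately show "distinct cs"
    by (metis L card_distinct distinct_card length_map)
qed

lemma Ops_Omega_ex:
  assumes "tree_cut T e (set cs)" "distinct cs"
  shows "\<exists>t. (cs, t) \<in> Ops P \<and> root_colour \<Sigma> cs t = e"
proof -
  obtain t where t: "well_coloured \<Sigma> cs t" "root_colour \<Sigma> cs t = e" "distinct (leaf_numbers t)"
    "set (leaf_numbers t) = {k \<in> {1..length cs}. cs ! (k - 1) \<in> set cs}"
    using cut_well_coloured[OF assms] by blast
  have "cs ! (k - 1) \<in> set cs" if "k \<in> {1..length cs}" for k
    using that by auto
  then have "{k \<in> {1..length cs}. cs ! (k - 1) \<in> set cs} = {1..length cs}"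
    by auto
  then show ?thesis
    using t cut_Edges[OF assms(1)] by (auto simp: Ops_Omega_iff)
qed

text \<open>Reduces every equation between operations to one between inputs and outputs; the operad
  laws and the laws of morphisms are all obtained this way.\<close>

lemma Ops_Omega_unique:
  assumes "x \<in> Ops P" "y \<in> Ops P" "Inp P x = Inp P y" "Out P x = Out P y"
  shows "x = y"
proof -
  obtain cs t t' where xy: "x = (cs, t)" "y = (cs, t')"
    using assms(3) by (cases x, cases y) auto
  have "t = t'"
  proof (rule well_coloured_unique)
    show "Outedge T v \<notin> set cs"
      if "v \<in> set (map fst (vertices t)) \<union> set (map fst (vertices t'))" for v
      using that assms(1,2) Ops_OmegaD(3) xy by auto
  qed (use assms xy Ops_OmegaD(1) in \<open>auto simp: Ops_Omega_iff\<close>)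
  then show ?thesis
    using xy by simp
qed

end

section \<open>The free operad on a tree is a symmetric operad\<close>

text \<open>The effect of \<open>Comp\<close> on input lists, as \<open>renumber_list\<close> is
  that of \<open>Perm\<close>. By \<open>Ops_Omega_unique\<close> the operad laws amount to
  identities between these two list operations.\<close>

definition insert_list :: "nat \<Rightarrow> 'c list \<Rightarrow> 'c list \<Rightarrow> 'c list" where
  "insert_list i ds cs = take (i - 1) cs @ ds @ drop i cs"

definition renumber_list :: "(nat \<Rightarrow> nat) \<Rightarrow> 'c list \<Rightarrow> 'c list" where
  "renumber_list \<sigma> cs = [cs ! (inv \<sigma> k - 1). k \<leftarrow> [1..<Suc (length cs)]]"

lemma length_insert_list: "i \<in> {1..length cs} \<Longrightarrow> length (insert_list i ds cs) = length cs + length ds - 1"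
  by (auto simp: insert_list_def)

lemma insert_list_shift:
  assumes "i \<in> {1..length cs}" "k \<in> {1..length cs}" "k \<noteq> i"
  shows "insert_list i ds cs ! (shift i (length ds) k - 1) = cs ! (k - 1)"
proof (cases "k < i")
  case True
  then show ?thesis
    using assms by (auto simp: insert_list_def shift_def nth_append)
next
  case False
  then obtain l where "k = i + l + 1"
    using assms(3) by (metis Suc_eq_plus1 add_Suc_right less_imp_Suc_add linorder_neqE_nat)
  then show ?thesis
    using assms by (auto simp: insert_list_def shift_def nth_append add.commute)
qed

lemma insert_list_inner:
  assumes "i \<in> {1..length cs}" "l \<in> {1..length ds}"
  shows "insert_list i ds cs ! (i - 1 + l - 1) = ds ! (l - 1)"
  using assms by (auto simp: insert_list_def nth_append)

text \<open>Splits the positions of a composite by origin: outer inputs other than \<open>i\<close>,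
  or inner inputs.\<close>

lemma shift_cases:
  assumes "i \<in> {1..n}" "y \<in> {1..n + m - 1}"
  obtains k where "k \<in> {1..n}" "k \<noteq> i" "y = shift i m k" | l where "l \<in> {1..m}" "y = i - 1 + l"
proof -
  consider "y < i" | "i \<le> y" "y < i + m" | "i + m \<le> y"
    by linarith
  then show ?thesis
  proof cases
    case 1
    then show ?thesis
      using assms by (intro that(1)[of y]) (auto simp: shift_def)
  next
    case 2
    then show ?thesis
      using assms by (intro that(2)[of "y + 1 - i"]) auto
  next
    case 3
    then show ?thesis
      using assms by (intro that(1)[of "y + 1 - m"]) (auto simp: shift_def)
  qed
qed

lemma shift_bounds:
  assumes "i \<in> {1..n}" "k \<in> {1..n}" "k \<noteq> i"
  shows "shift i m k \<in> {1..n + m - 1}"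
  using assms by (auto simp: shift_def)

lemma outer_perm_shift: "1 \<le> i \<Longrightarrow> k \<noteq> i \<Longrightarrow> outer_perm i m \<sigma> (shift i m k) = shift (\<sigma> i) m (\<sigma> k)"
  by (auto simp: outer_perm_def shift_def)

lemma outer_perm_inner: "1 \<le> i \<Longrightarrow> 1 \<le> \<sigma> i \<Longrightarrow> l \<in> {1..m} \<Longrightarrow> outer_perm i m \<sigma> (i - 1 + l) = \<sigma> i - 1 + l"
  by (auto simp: outer_perm_def)

lemma permutesI_surj:
  assumes "finite S" "\<And>y. y \<in> S \<Longrightarrow> \<exists>x\<in>S. p x = y" "\<And>x. x \<in> S \<Longrightarrow> p x \<in> S" "\<And>x. x \<notin> S \<Longrightarrow> p x = x"
  shows "p permutes S"
proof (rule bij_imp_permutes)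
  have "p ` S = S"
    using assms(2,3) by (auto simp: image_iff)
  moreover from this have "inj_on p S"
    using assms(1) by (metis eq_card_imp_inj_on)
  ultimately show "bij_betw p S S"
    by (simp add: bij_betw_def)
qed (rule assms(4))

lemma outer_perm_permutes:
  assumes i: "i \<in> {1..n}" and \<sigma>: "\<sigma> permutes {1..n}"
  shows "outer_perm i m \<sigma> permutes {1..n + m - 1}"
proof (rule permutesI_surj)
  have \<sigma>i: "\<sigma> k \<in> {1..n} \<longleftrightarrow> k \<in> {1..n}" for k
    using permutes_in_image[OF \<sigma>] .
  have i1: "1 \<le> i" "1 \<le> \<sigma> i" "\<sigma> i \<in> {1..n}"
    using i \<sigma>i[of i] by auto
  show "\<exists>x\<in>{1..n + m - 1}. outer_perm i m \<sigma> x = y" if y: "y \<in> {1..n + m - 1}" for y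
    using i1(3) y
  proof (cases rule: shift_cases)
    case (1 k)
    obtain k' where "\<sigma> k' = k" "k' \<in> {1..n}"
      using 1(1) permutes_image[OF \<sigma>] by (metis imageE)
    then show ?thesis
      using 1 i1 shift_bounds[OF i, of k' m] outer_perm_shift[of i k' m \<sigma>]
      by (intro bexI[of _ "shift i m k'"]) auto
  next
    case (2 l)
    then show ?thesis
      using outer_perm_inner[where \<sigma> = \<sigma>, OF i1(1,2), of l m] i by (intro bexI[of _ "i - 1 + l"]) auto
  qed
  show "outer_perm i m \<sigma> x \<in> {1..n + m - 1}" if x: "x \<in> {1..n + m - 1}" for x
    using i x
  proof (cases rule: shift_cases)
    case (1 k)
    then show ?thesis
      using shift_bounds[OF i1(3), of "\<sigma> k" m] \<sigma>i[of k] outer_perm_shift[OF i1(1) 1(2), of m \<sigma>]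
        permutes_inj[OF \<sigma>] by (auto dest: injD)
  next
    case (2 l)
    then show ?thesis
      using outer_perm_inner[where \<sigma> = \<sigma>, OF i1(1,2), of l m] i1(3) by auto
  qed
  \<comment> \<open>Outside the range \<open>\<sigma>\<close> fixes the position from which
    \<open>x\<close> is shifted, both for \<open>x = 0\<close> and beyond the last input.\<close>
  show "outer_perm i m \<sigma> x = x" if x: "x \<notin> {1..n + m - 1}" for x
  proof (cases "x = 0")
    case True
    then show ?thesis
      using i \<sigma>i[of 0] permutes_not_in[OF \<sigma>, of 0] i1 by (simp add: outer_perm_def shift_def)
  next
    case False
    then have "x + 1 - m \<notin> {1..n}" "x + 1 - m > i" "x \<ge> i + m" "x \<ge> m"
      using x i by auto
    moreover from this have "\<sigma> (x + 1 - m) = x + 1 - m"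
      using permutes_not_in[OF \<sigma>] by blast
    moreover have "\<sigma> i < x + 1 - m"
      using i1(3) x i False by auto
    ultimately show ?thesis
      by (simp add: outer_perm_def shift_def)
  qed
qed simp

lemma inner_perm_inner: "1 \<le> i \<Longrightarrow> l \<in> {1..m} \<Longrightarrow> inner_perm i m \<tau> (i - 1 + l) = i - 1 + \<tau> l"
  by (auto simp: inner_perm_def)

lemma inner_perm_shift: "1 \<le> i \<Longrightarrow> k \<noteq> i \<Longrightarrow> inner_perm i m \<tau> (shift i m k) = shift i m k"
  by (auto simp: inner_perm_def shift_def)

lemma inner_perm_permutes:
  assumes i: "i \<in> {1..n}" and \<tau>: "\<tau> permutes {1..m}"
  shows "inner_perm i m \<tau> permutes {1..n + m - 1}"
proof (rule permutesI_surj)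
  have \<tau>i: "\<tau> k \<in> {1..m} \<longleftrightarrow> k \<in> {1..m}" for k
    using permutes_in_image[OF \<tau>] .
  have i1: "1 \<le> i"
    using i by auto
  show "\<exists>x\<in>{1..n + m - 1}. inner_perm i m \<tau> x = y" if y: "y \<in> {1..n + m - 1}" for y
    using i y
  proof (cases rule: shift_cases)
    case (1 k)
    then show ?thesis
      using y inner_perm_shift[OF i1 1(2), of m \<tau>] by (intro bexI[of _ y]) auto
  next
    case (2 l)
    obtain l' where "\<tau> l' = l" "l' \<in> {1..m}"
      using 2(1) permutes_image[OF \<tau>] by (metis imageE)
    then show ?thesis
      using 2 inner_perm_inner[OF i1, of l' m \<tau>] i by (intro bexI[of _ "i - 1 + l'"]) auto
  qed
  show "inner_perm i m \<tau> x \<in> {1..n + m - 1}" if x: "x \<in> {1..n + m - 1}" for x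
    using i x
  proof (cases rule: shift_cases)
    case (1 k)
    then show ?thesis
      using x inner_perm_shift[OF i1 1(2)] by auto
  next
    case (2 l)
    then show ?thesis
      using inner_perm_inner[OF i1, of l m \<tau>] \<tau>i[of l] i by auto
  qed
  show "inner_perm i m \<tau> x = x" if x: "x \<notin> {1..n + m - 1}" for x
    using x i by (auto simp: inner_perm_def)
qed simp

lemma length_renumber_list [simp]: "length (renumber_list \<sigma> cs) = length cs"
  by (simp add: renumber_list_def del: upt_Suc)

lemma renumber_list_nth:
  assumes "\<sigma> permutes {1..length cs}" "k \<in> {1..length cs}"
  shows "renumber_list \<sigma> cs ! (\<sigma> k - 1) = cs ! (k - 1)"
proof -
  have "\<sigma> k \<in> {1..length cs}"
    using assms(2) permutes_in_image[OF assms(1)] by blast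
  moreover have "inv \<sigma> (\<sigma> k) = k"
    using assms(1) permutes_inverses(2) by metis
  ultimately show ?thesis
    using nth_upt[of 1 "\<sigma> k - 1" "Suc (length cs)"] by (auto simp: renumber_list_def simp del: upt_Suc)
qed

text \<open>As \<open>\<sigma>\<close> permutes the positions, the entries at the places
  \<open>\<sigma> k\<close> determine the list; this avoids the inverse in the definition.\<close>

lemma renumber_listI:
  assumes "\<sigma> permutes {1..length cs}" "length L = length cs"
    and "\<And>k. k \<in> {1..length cs} \<Longrightarrow> L ! (\<sigma> k - 1) = cs ! (k - 1)"
  shows "L = renumber_list \<sigma> cs"
proof (rule nth_equalityI)
  fix i assume i: "i < length L"
  then have "Suc i \<in> {1..length cs}"
    using assms(2) by auto
  then obtain k where "\<sigma> k = Suc i" "k \<in> {1..length cs}"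
    using permutes_image[OF assms(1)] by (metis imageE)
  then show "L ! i = renumber_list \<sigma> cs ! i"
    using assms(3)[of k] renumber_list_nth[OF assms(1), of k] by simp
qed (simp add: assms)

lemma renumber_list_id: "renumber_list id cs = cs"
  by (rule renumber_listI[symmetric]) (auto simp: permutes_id)

lemma renumber_list_comp:
  assumes "\<sigma> permutes {1..length cs}" "\<tau> permutes {1..length cs}"
  shows "renumber_list \<sigma> (renumber_list \<tau> cs) = renumber_list (\<sigma> \<circ> \<tau>) cs"
proof (rule renumber_listI)
  show "\<sigma> \<circ> \<tau> permutes {1..length cs}"
    using assms permutes_compose by blast
  fix k assume k: "k \<in> {1..length cs}"
  then have "\<tau> k \<in> {1..length cs}"
    using permutes_in_image[OF assms(2)] by blast
  then show "renumber_list \<sigma> (renumber_list \<tau> cs) ! ((\<sigma> \<circ> \<tau>) k - 1) = cs ! (k - 1)"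
    using renumber_list_nth[of \<sigma> "renumber_list \<tau> cs" "\<tau> k"] renumber_list_nth[OF assms(2) k] assms(1) by simp
qed simp

lemma insert_list_outer:
  assumes i: "i \<in> {1..length cs}" and \<sigma>: "\<sigma> permutes {1..length cs}"
  shows "insert_list (\<sigma> i) ds (renumber_list \<sigma> cs) = renumber_list (outer_perm i (length ds) \<sigma>) (insert_list i ds cs)"
proof (rule renumber_listI)
  have \<sigma>i: "\<sigma> k \<in> {1..length (renumber_list \<sigma> cs)} \<longleftrightarrow> k \<in> {1..length cs}" for k
    using permutes_in_image[OF \<sigma>] by simp
  have i': "\<sigma> i \<in> {1..length (renumber_list \<sigma> cs)}" "1 \<le> i" "1 \<le> \<sigma> i"
    using \<sigma>i[of i] i by auto
  show "outer_perm i (length ds) \<sigma> permutes {1..length (insert_list i ds cs)}"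
    using outer_perm_permutes[OF i \<sigma>] by (simp only: length_insert_list[OF i])
  show "length (insert_list (\<sigma> i) ds (renumber_list \<sigma> cs)) = length (insert_list i ds cs)"
    by (simp only: length_insert_list[OF i] length_insert_list[OF i'(1)] length_renumber_list)
  fix l assume "l \<in> {1..length (insert_list i ds cs)}"
  then have "l \<in> {1..length cs + length ds - 1}"
    by (simp only: length_insert_list[OF i])
  with i show "insert_list (\<sigma> i) ds (renumber_list \<sigma> cs) ! (outer_perm i (length ds) \<sigma> l - 1) =
      insert_list i ds cs ! (l - 1)"
  proof (cases rule: shift_cases)
    case (1 k)
    have "\<sigma> k \<noteq> \<sigma> i"
      using 1(2) permutes_inj[OF \<sigma>] by (auto dest: injD)
    then show ?thesis
      using insert_list_shift[OF i'(1), of "\<sigma> k" ds] \<sigma>i[of k] 1 renumber_list_nth[OF \<sigma> 1(1)]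
        insert_list_shift[OF i 1(1,2), of ds] outer_perm_shift[OF i'(2) 1(2)] by simp
  next
    case (2 m)
    then show ?thesis
      using insert_list_inner[OF i'(1) 2(1)] insert_list_inner[OF i 2(1)] outer_perm_inner[where \<sigma> = \<sigma>, OF i'(2,3) 2(1)]
      by simp
  qed
qed

lemma insert_list_inner_perm:
  assumes i: "i \<in> {1..length cs}" and \<tau>: "\<tau> permutes {1..length ds}"
  shows "insert_list i (renumber_list \<tau> ds) cs = renumber_list (inner_perm i (length ds) \<tau>) (insert_list i ds cs)"
proof (rule renumber_listI)
  have i': "1 \<le> i"
    using i by auto
  show "inner_perm i (length ds) \<tau> permutes {1..length (insert_list i ds cs)}"
    using inner_perm_permutes[OF i \<tau>] by (simp only: length_insert_list[OF i])
  show "length (insert_list i (renumber_list \<tau> ds) cs) = length (insert_list i ds cs)"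
    by (simp only: length_insert_list[OF i] length_renumber_list)
  fix l assume "l \<in> {1..length (insert_list i ds cs)}"
  then have "l \<in> {1..length cs + length ds - 1}"
    by (simp only: length_insert_list[OF i])
  with i show "insert_list i (renumber_list \<tau> ds) cs ! (inner_perm i (length ds) \<tau> l - 1) =
      insert_list i ds cs ! (l - 1)"
  proof (cases rule: shift_cases)
    case (1 k)
    then show ?thesis
      using insert_list_shift[OF i 1(1,2), of ds] insert_list_shift[OF i 1(1,2), of "renumber_list \<tau> ds"]
        inner_perm_shift[OF i' 1(2)] by simp
  next
    case (2 m)
    have "\<tau> m \<in> {1..length (renumber_list \<tau> ds)}"
      using 2(1) permutes_in_image[OF \<tau>] by simp
    then show ?thesis
      using insert_list_inner[OF i 2(1)] insert_list_inner[OF i, of "\<tau> m" "renumber_list \<tau> ds"]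
       renumber_list_nth[OF \<tau> 2(1)] inner_perm_inner[OF i' 2(1)] 2(2) by simp
  qed
qed

lemma insert_list_append: "insert_list (Suc (length as)) ds (as @ x # bs) = as @ ds @ bs"
  by (simp add: insert_list_def)

lemma insert_list_split:
  assumes "i \<in> {1..length cs}"
  obtains as x bs where "cs = as @ x # bs" "i = Suc (length as)"
proof
  show "cs = take (i - 1) cs @ cs ! (i - 1) # drop i cs"
    using assms id_take_nth_drop[of "i - 1" cs] by auto
  show "i = Suc (length (take (i - 1) cs))"
    using assms by auto
qed

lemma insert_list_assoc:
  assumes "i \<in> {1..length cs}" "j \<in> {1..length ds}"
  shows "insert_list (i - 1 + j) es (insert_list i ds cs) = insert_list i (insert_list j es ds) cs"
proof -
  obtain as x bs where i: "cs = as @ x # bs" "i = Suc (length as)"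
    using insert_list_split[OF assms(1)] by metis
  obtain as' y bs' where j: "ds = as' @ y # bs'" "j = Suc (length as')"
    using insert_list_split[OF assms(2)] by metis
  have "insert_list (Suc (length (as @ as'))) es ((as @ as') @ y # (bs' @ bs)) = (as @ as') @ es @ bs' @ bs"
    by (rule insert_list_append)
  then show ?thesis
    by (simp add: i j insert_list_append)
qed

text \<open>With \<open>cs\<close> split around both positions, the two sides become the same
  concatenation.\<close>

lemma insert_list_commute:
  assumes "i \<in> {1..length cs}" "k \<in> {1..length cs}" "i < k"
  shows "insert_list (shift i (length ds) k) es (insert_list i ds cs) = insert_list i ds (insert_list k es cs)"
proof -
  define as where "as = take (i - 1) cs"
  define bs where "bs = take (k - i - 1) (drop i cs)"
  define es' where "es' = drop k cs"
  have i: "i = Suc (length as)"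
    using assms by (auto simp: as_def)
  have k: "k = Suc (length (as @ x # bs))" for x :: 'a
    using assms by (auto simp: as_def bs_def)
  have "drop i cs = bs @ cs ! (k - 1) # es'"
    using assms id_take_nth_drop[of "k - i - 1" "drop i cs"] by (auto simp: bs_def es'_def)
  moreover have "cs = as @ cs ! (i - 1) # drop i cs"
    using assms id_take_nth_drop[of "i - 1" cs] by (auto simp: as_def)
  ultimately obtain x y where cs: "cs = as @ x # bs @ y # es'"
    by metis
  have "shift i (length ds) k = Suc (length (as @ ds @ bs))"
    using i k by (simp add: shift_def)
  moreover have "insert_list i ds cs = (as @ ds @ bs) @ y # es'"
    unfolding cs i insert_list_append by simp
  ultimately have "insert_list (shift i (length ds) k) es (insert_list i ds cs) = as @ ds @ bs @ es @ es'"
    using insert_list_append[of "as @ ds @ bs" es y es'] by (simp only: append_assoc)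
  moreover have "insert_list k es cs = as @ x # bs @ es @ es'"
    using insert_list_append[of "as @ x # bs" es y es'] k[of x] by (simp add: cs)
  ultimately show ?thesis
    by (simp only: i insert_list_append append_assoc)
qed

lemma insert_list_unit: "insert_list 1 cs [c] = cs"
  by (simp add: insert_list_def)

lemma insert_list_unit_right:
  assumes "i \<in> {1..length cs}"
  shows "insert_list i [cs ! (i - 1)] cs = cs"
  using assms id_take_nth_drop[of "i - 1" cs] by (auto simp: insert_list_def)

lemma root_colour_corolla [simp]: "root_colour \<Sigma> cs (corolla v n) = Outp \<Sigma> v"
  by (simp add: corolla_def)

lemma root_colour_graft:
  "(\<And>k. k \<in> set (leaf_numbers t) \<Longrightarrow> root_colour \<Sigma> cs' (h k) = cs ! (k - 1)) \<Longrightarrow>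
    root_colour \<Sigma> cs' (graft h t) = root_colour \<Sigma> cs t"
  by (cases t) auto

lemma well_coloured_graft:
  assumes "\<And>k. k \<in> set (leaf_numbers t) \<Longrightarrow> root_colour \<Sigma> cs' (h k) = cs ! (k - 1) \<and> well_coloured \<Sigma> cs' (h k)"
    and "well_coloured \<Sigma> cs t"
  shows "well_coloured \<Sigma> cs' (graft h t)"
  using assms
proof (induction t)
  case (Node v ts)
  have "root_colour \<Sigma> cs' (graft h t) = root_colour \<Sigma> cs t" if "t \<in> set ts" for t
    by (rule root_colour_graft) (use Node.prems(1) that in auto)
  then have "map (root_colour \<Sigma> cs') (map (graft h) ts) = map (root_colour \<Sigma> cs) ts"
    by simp
  also have "\<dots> = Ins \<Sigma> v"
    using Node.prems(2) by simp
  finally have "map (root_colour \<Sigma> cs') (map (graft h) ts) = Ins \<Sigma> v" .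
  moreover have "well_coloured \<Sigma> cs' (graft h t)" if "t \<in> set ts" for t
    by (rule Node.IH[OF that]) (use Node.prems that in auto)
  ultimately show ?case
    using Node.prems(2) by auto
qed auto

context rooted_tree
begin

lemma Ops_Omega_colours:
  assumes "x \<in> Ops P"
  shows "set (Inp P x) \<subseteq> Edges T" "Out P x \<in> Edges T"
proof -
  obtain cs t where x: "x = (cs, t)"
    by fastforce
  show "set (Inp P x) \<subseteq> Edges T" "Out P x \<in> Edges T"
    using assms root_colour_Edges by (auto simp: x Ops_Omega_iff)
qed

lemma Comp_closed:
  assumes "composable P x i y"
  shows "Comp P x i y \<in> Ops P" "Out P (Comp P x i y) = Out P x"
    "Inp P (Comp P x i y) = insert_list i (Inp P y) (Inp P x)"
proof -
  obtain cs t ds s where xy: "x = (cs, t)" "y = (ds, s)"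
    by fastforce
  have x: "(cs, t) \<in> Ops P" and y: "(ds, s) \<in> Ops P" and i: "i \<in> {1..length cs}"
    and c: "cs ! (i - 1) = root_colour \<Sigma> ds s"
    using assms by (auto simp: composable_def xy)
  note X = x[unfolded Ops_Omega_iff] and Y = y[unfolded Ops_Omega_iff]
  let ?L = "insert_list i ds cs"
  let ?h = "\<lambda>k. if k = i then graft (\<lambda>l. Leaf (i - 1 + l)) s else Leaf (shift i (length ds) k)"
  have C: "Comp P x i y = (?L, graft ?h t)"
    by (simp add: xy insert_list_def)
  have inner: "root_colour \<Sigma> ?L (Leaf (i - 1 + l)) = ds ! (l - 1)"
    if "l \<in> set (leaf_numbers s)" for l
    using insert_list_inner[OF i, of l ds] that Y by simp
  have h: "root_colour \<Sigma> ?L (?h k) = cs ! (k - 1) \<and> well_coloured \<Sigma> ?L (?h k)"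
    if "k \<in> set (leaf_numbers t)" for k
  proof (cases "k = i")
    case True
    have "root_colour \<Sigma> ?L (graft (\<lambda>l. Leaf (i - 1 + l)) s) = root_colour \<Sigma> ds s"
      by (rule root_colour_graft) (rule inner)
    moreover have "well_coloured \<Sigma> ?L (graft (\<lambda>l. Leaf (i - 1 + l)) s)"
      by (rule well_coloured_graft[of s \<Sigma> ?L _ ds]) (use inner Y in auto)
    ultimately show ?thesis
      using True c by simp
  next
    case False
    then show ?thesis
      using insert_list_shift[OF i, of k ds] that X by simp
  qed
  have wc: "well_coloured \<Sigma> ?L (graft ?h t)"
    by (rule well_coloured_graft[OF h]) (use X in auto)
  have leaves_h: "leaf_numbers (?h k) = (if k = i then map (\<lambda>l. i - 1 + l) (leaf_numbers s) else [shift i (length ds) k])" for k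
    by (simp add: leaf_numbers_graft concat_map_singleton)
  have set: "set (leaf_numbers (graft ?h t)) = {1..length ?L}"
  proof -
    have "set (leaf_numbers (graft ?h t)) = (\<Union>k\<in>{1..length cs}. set (leaf_numbers (?h k)))"
      using X by (simp only: leaf_numbers_graft) simp
    also have "\<dots> = {1..length cs + length ds - 1}"
    proof (intro equalityI subsetI)
      fix y assume "y \<in> (\<Union>k\<in>{1..length cs}. set (leaf_numbers (?h k)))"
      then obtain k where k: "k \<in> {1..length cs}" "y \<in> set (leaf_numbers (?h k))"
        by blast
      then show "y \<in> {1..length cs + length ds - 1}"
        using shift_bounds[OF i k(1), of "length ds"] Y i unfolding leaves_h by (auto split: if_splits)
    next
      fix y assume "y \<in> {1..length cs + length ds - 1}"
      with i show "y \<in> (\<Union>k\<in>{1..length cs}. set (leaf_numbers (?h k)))"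
      proof (cases rule: shift_cases)
        case (1 k)
        then show ?thesis
          by (intro UN_I[of k]) auto
      next
        case (2 l)
        then show ?thesis
          using Y i by (intro UN_I[of i]) (auto simp: leaf_numbers_graft)
      qed
    qed
    finally show ?thesis
      by (simp only: length_insert_list[OF i])
  qed
  \<comment> \<open>Distinctness follows by counting: there are as many leaves as elements of
    \<open>{1..length ?L}\<close>.\<close>
  have "length (leaf_numbers (graft ?h t)) = sum_list (map (\<lambda>k. length (leaf_numbers (?h k))) (leaf_numbers t))"
    by (simp only: leaf_numbers_graft length_concat map_map comp_def)
  also have "\<dots> = (\<Sum>k\<in>{1..length cs}. length (leaf_numbers (?h k)))"
    using X by (simp only: sum_list_distinct_conv_sum_set)
  also have "\<dots> = length (leaf_numbers (?h i)) + (\<Sum>k\<in>{1..length cs} - {i}. length (leaf_numbers (?h k)))"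
    using i by (intro sum.remove) auto
  also have "length (leaf_numbers (?h i)) = length ds"
    using Y distinct_card[of "leaf_numbers s"] unfolding leaves_h by simp
  also have "(\<Sum>k\<in>{1..length cs} - {i}. length (leaf_numbers (?h k))) = (\<Sum>k\<in>{1..length cs} - {i}. 1)"
    by (rule sum.cong) (auto simp: leaves_h)
  also have "length ds + \<dots> = length ?L"
    using i by (simp add: length_insert_list)
  finally have "distinct (leaf_numbers (graft ?h t))"
    using set by (intro card_distinct) simp
  moreover have "set ?L \<subseteq> Edges T"
    using X Y by (auto simp: insert_list_def dest: in_set_takeD in_set_dropD)
  ultimately show "Comp P x i y \<in> Ops P"
    unfolding C Ops_Omega_iff using wc set by simp
  show "Out P (Comp P x i y) = Out P x"
    unfolding C unfolding xy Omega_sel by (rule root_colour_graft, rule conjunct1, rule h)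
  show "Inp P (Comp P x i y) = insert_list i (Inp P y) (Inp P x)"
    unfolding C unfolding xy Omega_sel ..
qed

lemma Perm_closed:
  assumes "x \<in> Ops P" "\<sigma> permutes {1..arity P x}"
  shows "Perm P \<sigma> x \<in> Ops P" "Out P (Perm P \<sigma> x) = Out P x" "Inp P (Perm P \<sigma> x) = renumber_list \<sigma> (Inp P x)"
proof -
  obtain cs t where x: "x = (cs, t)"
    by fastforce
  note X = assms(1)[unfolded x Ops_Omega_iff]
  have \<sigma>: "\<sigma> permutes {1..length cs}"
    using assms(2) by (simp add: x)
  let ?L = "renumber_list \<sigma> cs"
  have C: "Perm P \<sigma> x = (?L, graft (\<lambda>k. Leaf (\<sigma> k)) t)"
    by (simp add: x renumber_list_def)
  have h: "root_colour \<Sigma> ?L (Leaf (\<sigma> k)) = cs ! (k - 1)" if "k \<in> set (leaf_numbers t)" for k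
    using renumber_list_nth[OF \<sigma>] that X by simp
  have leaves: "leaf_numbers (graft (\<lambda>k. Leaf (\<sigma> k)) t) = map \<sigma> (leaf_numbers t)"
    by (simp add: leaf_numbers_graft)
  have "distinct (map \<sigma> (leaf_numbers t))"
    using X permutes_inj_on[OF \<sigma>] by (auto simp: distinct_map)
  moreover have "set (map \<sigma> (leaf_numbers t)) = {1..length ?L}"
    using X permutes_image[OF \<sigma>] by simp
  moreover have "well_coloured \<Sigma> ?L (graft (\<lambda>k. Leaf (\<sigma> k)) t)"
    by (rule well_coloured_graft[of t \<Sigma> ?L _ cs]) (use h X in auto)
  moreover have "set ?L \<subseteq> Edges T"
  proof
    fix e assume "e \<in> set ?L"
    then have "e \<in> (\<lambda>k. cs ! (inv \<sigma> k - 1)) ` {1..length cs}"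
      by (simp add: renumber_list_def atLeastLessThanSuc_atLeastAtMost del: upt_Suc)
    then obtain k where "k \<in> {1..length cs}" "e = cs ! (inv \<sigma> k - 1)"
      by blast
    moreover from this have "inv \<sigma> k \<in> {1..length cs}"
      using permutes_in_image[OF permutes_inv[OF \<sigma>]] by blast
    ultimately have "e \<in> set cs"
      by auto
    then show "e \<in> Edges T"
      using X by blast
  qed
  ultimately show "Perm P \<sigma> x \<in> Ops P"
    unfolding C Ops_Omega_iff leaves by blast
  show "Out P (Perm P \<sigma> x) = Out P x"
    unfolding C unfolding x Omega_sel by (rule root_colour_graft) (rule h)
  show "Inp P (Perm P \<sigma> x) = renumber_list \<sigma> (Inp P x)"
    unfolding C unfolding x Omega_sel ..
qed

lemma Unit_closed: "c \<in> Edges T \<Longrightarrow> Unit P c \<in> Ops P \<and> Inp P (Unit P c) = [c] \<and> Out P (Unit P c) = c"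
  by (simp add: Ops_Omega_iff)

lemma composable_iff:
  "composable P x i y \<longleftrightarrow> x \<in> Ops P \<and> y \<in> Ops P \<and> i \<in> {1..arity P x} \<and> Inp P x ! (i - 1) = Out P y"
  by (simp add: composable_def)

lemma symmetric_operad_Omega: "symmetric_operad P"
  unfolding symmetric_operad_def
proof (intro conjI ballI allI impI)
  fix p i q assume c: "composable P p i q"
  show "Inp P (Comp P p i q) = take (i - 1) (Inp P p) @ Inp P q @ drop i (Inp P p)"
    using Comp_closed(3)[OF c] by (simp add: insert_list_def)
next
  fix p \<sigma> k assume "p \<in> Ops P" "\<sigma> permutes {1..arity P p}" "k \<in> {1..arity P p}"
  then show "Inp P (Perm P \<sigma> p) ! (\<sigma> k - 1) = Inp P p ! (k - 1)"
    using Perm_closed(3) renumber_list_nth by metis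
next
  fix p assume p: "p \<in> Ops P"
  have c: "composable P (Unit P (Out P p)) 1 p"
    using p Ops_Omega_colours[OF p] Unit_closed by (simp add: composable_iff)
  note C = Comp_closed[OF c]
  show "Comp P (Unit P (Out P p)) 1 p = p"
    by (rule Ops_Omega_unique[OF C(1) p])
       (use C Ops_Omega_colours[OF p] Unit_closed[of "Out P p"] insert_list_unit in auto)
next
  fix p i assume p: "p \<in> Ops P" and i: "i \<in> {1..arity P p}"
  have e: "Inp P p ! (i - 1) \<in> Edges T"
    using Ops_Omega_colours(1)[OF p] i by (auto simp: subset_iff)
  have c: "composable P p i (Unit P (Inp P p ! (i - 1)))"
    using p i Unit_closed[OF e] by (auto simp: composable_iff simp del: Omega_sel)
  note C = Comp_closed[OF c]
  show "Comp P p i (Unit P (Inp P p ! (i - 1))) = p"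
    by (rule Ops_Omega_unique[OF C(1) p C(3)[THEN trans] C(2)])
       (use Unit_closed[OF e] insert_list_unit_right[OF i] in metis)
next
  fix p i q j r assume "composable P p i q \<and> composable P q j r"
  then have pq: "composable P p i q" and qr: "composable P q j r"
    by auto
  note PQ = Comp_closed[OF pq] and QR = Comp_closed[OF qr]
  have ij: "i \<in> {1..arity P p}" "j \<in> {1..arity P q}"
    using pq qr by (auto simp: composable_def)
  have "i - 1 + j \<in> {1..length (Inp P p) + length (Inp P q) - 1}"
    using ij by auto
  then have "composable P (Comp P p i q) (i - 1 + j) r"
    unfolding composable_iff PQ(3) length_insert_list[OF ij(1)] insert_list_inner[OF ij]
    using PQ qr by (auto simp: composable_def)
  note A = Comp_closed[OF this]
  have "composable P p i (Comp P q j r)"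
    using pq QR by (auto simp: composable_def)
  note B = Comp_closed[OF this]
  show "Comp P (Comp P p i q) (i - 1 + j) r = Comp P p i (Comp P q j r)"
    by (rule Ops_Omega_unique[OF A(1) B(1)]) (simp_all only: A B PQ QR insert_list_assoc[OF ij])
next
  fix p i q k r assume "composable P p i q \<and> composable P p k r \<and> i < k"
  then have pq: "composable P p i q" and pr: "composable P p k r" and "i < k"
    by auto
  note PQ = Comp_closed[OF pq] and PR = Comp_closed[OF pr]
  have ik: "i \<in> {1..arity P p}" "k \<in> {1..arity P p}" "k \<noteq> i" "i \<noteq> k"
    using pq pr \<open>i < k\<close> by (auto simp: composable_def)
  have "composable P (Comp P p i q) (shift i (arity P q) k) r"
    unfolding composable_iff PQ(3) length_insert_list[OF ik(1)] insert_list_shift[OF ik(1-3)]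
    using PQ pr shift_bounds[OF ik(1-3)] by (auto simp: composable_def)
  note A = Comp_closed[OF this]
  have "shift k (arity P r) i = i"
    using \<open>i < k\<close> by (simp add: shift_def)
  then have nth: "insert_list k (Inp P r) (Inp P p) ! (i - 1) = Inp P p ! (i - 1)"
    using insert_list_shift[OF ik(2,1,4), of "Inp P r"] by simp
  have "i \<in> {1..length (Inp P p) + length (Inp P r) - 1}"
    using ik \<open>i < k\<close> by auto
  then have "composable P (Comp P p k r) i q"
    unfolding composable_iff PR(3) length_insert_list[OF ik(2)] nth
    using PR pq by (auto simp: composable_def)
  note B = Comp_closed[OF this]
  show "Comp P (Comp P p i q) (shift i (arity P q) k) r = Comp P (Comp P p k r) i q"
    by (rule Ops_Omega_unique[OF A(1) B(1)]) (simp_all only: A B PQ PR insert_list_commute[OF ik(1,2) \<open>i < k\<close>])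
next
  fix p assume p: "p \<in> Ops P"
  note C = Perm_closed[OF p permutes_id]
  show "Perm P id p = p"
    by (rule Ops_Omega_unique[OF C(1) p]) (simp_all only: C renumber_list_id)
next
  fix p \<sigma> \<tau> assume p: "p \<in> Ops P" and "\<sigma> permutes {1..arity P p} \<and> \<tau> permutes {1..arity P p}"
  then have \<sigma>: "\<sigma> permutes {1..arity P p}" and \<tau>: "\<tau> permutes {1..arity P p}"
    by auto
  note A = Perm_closed[OF p \<tau>]
  have \<sigma>': "\<sigma> permutes {1..arity P (Perm P \<tau> p)}"
    using \<sigma> by (simp only: A length_renumber_list)
  note B = Perm_closed[OF A(1) \<sigma>'] and C = Perm_closed[OF p permutes_compose[OF \<tau> \<sigma>]]
  show "Perm P \<sigma> (Perm P \<tau> p) = Perm P (\<sigma> \<circ> \<tau>) p"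
    by (rule Ops_Omega_unique[OF B(1) C(1)]) (simp_all only: A B C renumber_list_comp[OF \<sigma> \<tau>])
next
  fix p i q \<sigma> assume "composable P p i q \<and> \<sigma> permutes {1..arity P p}"
  then have pq: "composable P p i q" and \<sigma>: "\<sigma> permutes {1..arity P p}"
    by auto
  then have p: "p \<in> Ops P" and i: "i \<in> {1..arity P p}"
    by (auto simp: composable_def)
  note PQ = Comp_closed[OF pq] and S = Perm_closed[OF p \<sigma>]
  have "\<sigma> i \<in> {1..arity P p}"
    using permutes_in_image[OF \<sigma>] i by blast
  then have "composable P (Perm P \<sigma> p) (\<sigma> i) q"
    unfolding composable_iff S(3) length_renumber_list renumber_list_nth[OF \<sigma> i]
    using S pq by (auto simp: composable_def)
  note A = Comp_closed[OF this]
  have "outer_perm i (arity P q) \<sigma> permutes {1..arity P (Comp P p i q)}"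
    unfolding PQ(3) length_insert_list[OF i] by (rule outer_perm_permutes[OF i \<sigma>])
  note B = Perm_closed[OF PQ(1) this]
  show "Comp P (Perm P \<sigma> p) (\<sigma> i) q = Perm P (outer_perm i (arity P q) \<sigma>) (Comp P p i q)"
    by (rule Ops_Omega_unique[OF A(1) B(1)]) (simp_all only: A B PQ S insert_list_outer[OF i \<sigma>])
next
  fix p i q \<tau> assume "composable P p i q \<and> \<tau> permutes {1..arity P q}"
  then have pq: "composable P p i q" and \<tau>: "\<tau> permutes {1..arity P q}"
    by auto
  then have q: "q \<in> Ops P" and i: "i \<in> {1..arity P p}"
    by (auto simp: composable_def)
  note PQ = Comp_closed[OF pq] and S = Perm_closed[OF q \<tau>]
  have "composable P p i (Perm P \<tau> q)"
    using pq S by (auto simp: composable_def)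
  note A = Comp_closed[OF this]
  have "inner_perm i (arity P q) \<tau> permutes {1..arity P (Comp P p i q)}"
    unfolding PQ(3) length_insert_list[OF i] by (rule inner_perm_permutes[OF i \<tau>])
  note B = Perm_closed[OF PQ(1) this]
  show "Comp P p i (Perm P \<tau> q) = Perm P (inner_perm i (arity P q) \<tau>) (Comp P p i q)"
    by (rule Ops_Omega_unique[OF A(1) B(1)]) (simp_all only: A B PQ S insert_list_inner_perm[OF i \<tau>])
qed (use Ops_Omega_colours Unit_closed Comp_closed Perm_closed in \<open>auto simp: composable_def\<close>)

end

section \<open>Morphisms between free operads on trees\<close>

text \<open>The analogue of \<open>edge_maps\<close> for rooted trees. The condition concerns
  vertices, that is, generators; \<open>tree_map_cut\<close> extends it to all operations.\<close>

definition tree_maps :: "('e, 'v) tree \<Rightarrow> ('f, 'w) tree \<Rightarrow> ('e \<Rightarrow> 'f) set" where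
  "tree_maps S T = {f. f \<in> Edges S \<rightarrow>\<^sub>E Edges T \<and>
     (\<forall>v\<in>Verts S. inj_on f (In S v) \<and> tree_cut T (f (Outedge S v)) (f ` In S v))}"

locale two_trees = S: rooted_tree S + T: rooted_tree T
  for S :: "('e, 'v) tree" and T :: "('f, 'w) tree"
begin

text \<open>The image of a generator is an operation of the target: its existence is the cut
  condition, and distinctness of its inputs is injectivity.\<close>

lemma morphism_tree_map:
  assumes "(f, g) \<in> operad_morphisms S.P T.P"
  shows "f \<in> tree_maps S T"
  unfolding tree_maps_def
proof (intro CollectI conjI ballI)
  show "f \<in> Edges S \<rightarrow>\<^sub>E Edges T"
    using assms by (auto simp: operad_morphisms_def)
  fix v assume v: "v \<in> Verts S"
  let ?x = "(Ins S.\<Sigma> v, corolla v (length (Ins S.\<Sigma> v)))"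
  note I = S.Ins_tree[OF v]
  have "map (root_colour S.\<Sigma> (Ins S.\<Sigma> v)) (map Leaf [1..<Suc (length (Ins S.\<Sigma> v))]) = Ins S.\<Sigma> v"
    using map_nth_pred[of "Ins S.\<Sigma> v"] by (simp add: comp_def del: upt_Suc)
  then have "well_coloured S.\<Sigma> (Ins S.\<Sigma> v) (corolla v (length (Ins S.\<Sigma> v)))"
    using v by (auto simp: corolla_def simp del: upt_Suc)
  then have x: "?x \<in> Ops S.P"
    using I S.In_Edges[OF v] by (auto simp: S.Ops_Omega_iff simp del: upt_Suc)
  obtain cs t where gx: "g ?x = (cs, t)"
    by fastforce
  have "g ?x \<in> Ops T.P" "Inp T.P (g ?x) = map f (Inp S.P ?x)" "Out T.P (g ?x) = f (Out S.P ?x)"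
    using assms x by (auto simp: operad_morphisms_def)
  then have g: "(cs, t) \<in> Ops T.P" "cs = map f (Ins S.\<Sigma> v)" "root_colour T.\<Sigma> cs t = f (Outedge S v)"
    by (simp_all add: gx)
  from T.Ops_OmegaD(1,2)[OF g(1)] show "inj_on f (In S v)" "tree_cut T (f (Outedge S v)) (f ` In S v)"
    using g I by (auto simp: distinct_map)
qed

lemma morphism_unique:
  assumes "(f, g) \<in> operad_morphisms S.P T.P" "(f, g') \<in> operad_morphisms S.P T.P"
  shows "g = g'"
proof (rule extensionalityI)
  show "g \<in> extensional (Ops S.P)" "g' \<in> extensional (Ops S.P)"
    using assms by (auto simp: operad_morphisms_def PiE_def)
  fix x assume "x \<in> Ops S.P"
  with assms show "g x = g' x"
    by (intro T.Ops_Omega_unique) (auto simp: operad_morphisms_def)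
qed

text \<open>Images of cuts compose by \<open>cut_trans\<close>. Different branches stay disjoint
  because their images lie above different members of a cut, and \<open>cut_antichain\<close>
  applies.\<close>

lemma tree_map_cut:
  assumes f: "f \<in> tree_maps S T"
  shows "tree_cut S e X \<Longrightarrow> inj_on f X \<and> tree_cut T (f e) (f ` X)"
proof (induction rule: tree_cut.induct)
  case (edge e)
  then show ?case
    using f by (auto simp: tree_maps_def intro: tree_cut.edge)
next
  case (node v X)
  have v: "inj_on f (In S v)" "tree_cut T (f (Outedge S v)) (f ` In S v)"
    using f node.hyps(1) by (auto simp: tree_maps_def)
  \<comment> \<open>\<open>cut_trans\<close> needs the partial cuts indexed by image edges, which is
    possible because \<open>f\<close> is injective on the inputs of \<open>v\<close>.\<close>
  define Z where "Z y = f ` X (the_inv_into (In S v) f y)" for y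
  have Z: "Z (f d) = f ` X d" if "d \<in> In S v" for d
    using the_inv_into_f_f[OF v(1) that] by (simp add: Z_def)
  have "tree_cut T (f (Outedge S v)) (\<Union>y\<in>f ` In S v. Z y)"
    by (rule T.cut_trans[OF v(2)]) (use Z node.IH in auto)
  moreover have "(\<Union>y\<in>f ` In S v. Z y) = f ` (\<Union>d\<in>In S v. X d)"
    using Z by auto
  moreover have "inj_on f (\<Union>d\<in>In S v. X d)"
  proof (rule inj_onI)
    fix x y assume "x \<in> (\<Union>d\<in>In S v. X d)" "y \<in> (\<Union>d\<in>In S v. X d)" and e: "f x = f y"
    then obtain d d' where d: "d \<in> In S v" "x \<in> X d" "d' \<in> In S v" "y \<in> X d'"
      by auto
    then have "(f x, f d) \<in> (below T)\<^sup>*" "(f x, f d') \<in> (below T)\<^sup>*"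
      using T.cut_above node.IH e by (metis image_eqI)+
    then have "f d = f d'"
      using T.cut_antichain[OF v(2)] d by blast
    then have "d = d'"
      using v(1) d by (auto dest: inj_onD)
    then show "x = y"
      using node.IH[OF d(1)] d e by (auto dest: inj_onD)
  qed
  ultimately show ?case
    by simp
qed

text \<open>Each operation has an image with the prescribed inputs and output by
  \<open>tree_map_cut\<close>, and this image is unique; compatibility with units, compositions and
  permutations is then automatic.\<close>

lemma tree_map_morphism:
  assumes f: "f \<in> tree_maps S T"
  shows "\<exists>g. (f, g) \<in> operad_morphisms S.P T.P"
proof -
  have fE: "f \<in> Edges S \<rightarrow>\<^sub>E Edges T"
    using f by (simp add: tree_maps_def)
  have ex: "\<exists>y. y \<in> Ops T.P \<and> Inp T.P y = map f (Inp S.P x) \<and> Out T.P y = f (Out S.P x)"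
    if x: "x \<in> Ops S.P" for x
  proof -
    obtain cs t where xx: "x = (cs, t)"
      by fastforce
    note D = S.Ops_OmegaD[OF x[unfolded xx]]
    note c = tree_map_cut[OF f D(2)]
    have "tree_cut T (f (root_colour S.\<Sigma> cs t)) (set (map f cs))" "distinct (map f cs)"
      using c D(1) by (auto simp: distinct_map)
    from T.Ops_Omega_ex[OF this] obtain t' where
      "(map f cs, t') \<in> Ops T.P" "root_colour T.\<Sigma> (map f cs) t' = f (root_colour S.\<Sigma> cs t)"
      by blast
    then show ?thesis
      using xx by (intro exI[of _ "(map f cs, t')"]) simp
  qed
  define g where "g = (\<lambda>x\<in>Ops S.P. SOME y. y \<in> Ops T.P \<and> Inp T.P y = map f (Inp S.P x) \<and> Out T.P y = f (Out S.P x))"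
  have g: "g x \<in> Ops T.P" "Inp T.P (g x) = map f (Inp S.P x)" "Out T.P (g x) = f (Out S.P x)"
    if "x \<in> Ops S.P" for x
    using someI_ex[OF ex[OF that]] that by (auto simp: g_def)
  have len: "arity T.P (g x) = arity S.P x" if "x \<in> Ops S.P" for x
    using g(2)[OF that] by simp
  have "(f, g) \<in> operad_morphisms S.P T.P"
    unfolding operad_morphisms_def
  proof (clarify, intro conjI ballI allI impI)
    show "f \<in> Col S.P \<rightarrow>\<^sub>E Col T.P"
      using fE by simp
    show "g \<in> Ops S.P \<rightarrow>\<^sub>E Ops T.P"
      using g(1) by (auto simp: g_def)
  next
    fix c assume "c \<in> Col S.P"
    then have c: "c \<in> Edges S" "f c \<in> Edges T"
      using fE by auto
    note US = S.Unit_closed[OF c(1)] and UT = T.Unit_closed[OF c(2)]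
    show "g (Unit S.P c) = Unit T.P (f c)"
      by (rule T.Ops_Omega_unique) (use US UT g[of "Unit S.P c"] in auto)
  next
    fix x i y assume c: "composable S.P x i y"
    then have xy: "x \<in> Ops S.P" "y \<in> Ops S.P" "i \<in> {1..arity S.P x}" "Inp S.P x ! (i - 1) = Out S.P y"
      by (auto simp: composable_def)
    have "map f (Inp S.P x) ! (i - 1) = f (Out S.P y)"
      using xy(3) by (subst nth_map) (auto simp flip: xy(4))
    then have "composable T.P (g x) i (g y)"
      unfolding composable_def using xy g len by metis
    note CT = T.Comp_closed[OF this] and CS = S.Comp_closed[OF c]
    show "g (Comp S.P x i y) = Comp T.P (g x) i (g y)"
      by (rule T.Ops_Omega_unique[OF g(1)[OF CS(1)] CT(1)])
        (simp_all only: g[OF CS(1)] CT CS g[OF xy(1)] g[OF xy(2)] insert_list_def take_map drop_map map_append)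
  next
    fix x \<sigma> assume x: "x \<in> Ops S.P" and \<sigma>: "\<sigma> permutes {1..arity S.P x}"
    then have "\<sigma> permutes {1..arity T.P (g x)}"
      by (simp only: len)
    note PT = T.Perm_closed[OF g(1)[OF x] this] and PS = S.Perm_closed[OF x \<sigma>]
    have "map f (renumber_list \<sigma> (Inp S.P x)) = renumber_list \<sigma> (map f (Inp S.P x))"
    proof (rule renumber_listI)
      show "\<sigma> permutes {1..length (map f (Inp S.P x))}"
        using \<sigma> by simp
      fix k assume k: "k \<in> {1..length (map f (Inp S.P x))}"
      then have k': "k \<in> {1..arity S.P x}" "\<sigma> k \<in> {1..arity S.P x}"
        using permutes_in_image[OF \<sigma>] by auto
      then show "map f (renumber_list \<sigma> (Inp S.P x)) ! (\<sigma> k - 1) = map f (Inp S.P x) ! (k - 1)"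
        using renumber_list_nth[OF \<sigma> k'(1)] by (subst (1 2) nth_map) auto
    qed simp
    then show "g (Perm S.P \<sigma> x) = Perm T.P \<sigma> (g x)"
      by (intro T.Ops_Omega_unique[OF g(1)[OF PS(1)] PT(1)]) (simp_all only: g[OF PS(1)] PT PS g[OF x])
  qed (use g in auto)
  then show ?thesis
    by blast
qed

end

section \<open>The category of operads and its subcategory of dendrices\<close>

lemma operad_morphisms_comp:
  assumes P: "symmetric_operad P" and f: "(f, g) \<in> operad_morphisms P Q" and f': "(f', g') \<in> operad_morphisms Q R"
  shows "(compose (Col P) f' f, compose (Ops P) g' g) \<in> operad_morphisms P R"
proof -
  have P1: "set (Inp P p) \<subseteq> Col P" "Out P p \<in> Col P" if "p \<in> Ops P" for p
    using P that by (auto simp: symmetric_operad_def)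
  have PU: "Unit P c \<in> Ops P" if "c \<in> Col P" for c
    using P that by (auto simp: symmetric_operad_def)
  have PC: "Comp P p i q \<in> Ops P" if "composable P p i q" for p i q
    using P that by (simp add: symmetric_operad_def)
  have PP: "Perm P \<sigma> p \<in> Ops P" if "p \<in> Ops P" "\<sigma> permutes {1..arity P p}" for p \<sigma>
    using P that by (simp add: symmetric_operad_def)
  have m: "f \<in> Col P \<rightarrow>\<^sub>E Col Q" "g \<in> Ops P \<rightarrow>\<^sub>E Ops Q" "f' \<in> Col Q \<rightarrow>\<^sub>E Col R" "g' \<in> Ops Q \<rightarrow>\<^sub>E Ops R"
    using f f' by (auto simp: operad_morphisms_def)
  have g: "g p \<in> Ops Q" "Inp Q (g p) = map f (Inp P p)" "Out Q (g p) = f (Out P p)"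
    if "p \<in> Ops P" for p
    using f that by (auto simp: operad_morphisms_def)
  have g': "Inp R (g' p) = map f' (Inp Q p)" "Out R (g' p) = f' (Out Q p)" if "p \<in> Ops Q" for p
    using f' that by (auto simp: operad_morphisms_def)
  have comp: "composable Q (g p) i (g q)" if c: "composable P p i q" for p i q
  proof -
    have pq: "p \<in> Ops P" "q \<in> Ops P" "i \<in> {1..arity P p}" "Inp P p ! (i - 1) = Out P q"
      using c by (auto simp: composable_def)
    have "map f (Inp P p) ! (i - 1) = f (Out P q)"
      using pq(3) by (subst nth_map) (auto simp flip: pq(4))
    then show ?thesis
      unfolding composable_def using g pq by simp
  qed
  show ?thesis
    unfolding operad_morphisms_def
  proof (clarify, intro conjI ballI allI impI)
    show "compose (Col P) f' f \<in> Col P \<rightarrow>\<^sub>E Col R" "compose (Ops P) g' g \<in> Ops P \<rightarrow>\<^sub>E Ops R"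
      using m by (auto simp: compose_def)
  next
    fix p assume p: "p \<in> Ops P"
    show "Inp R (compose (Ops P) g' g p) = map (compose (Col P) f' f) (Inp P p)"
      using p P1[OF p] by (auto simp: compose_eq g g' subset_iff)
    show "Out R (compose (Ops P) g' g p) = compose (Col P) f' f (Out P p)"
      using p P1[OF p] by (simp add: compose_eq g g')
  next
    fix c assume c: "c \<in> Col P"
    moreover from this have "f c \<in> Col Q"
      using m by auto
    ultimately show "compose (Ops P) g' g (Unit P c) = Unit R (compose (Col P) f' f c)"
      using f f' PU[OF c] by (simp add: compose_eq operad_morphisms_def)
  next
    fix p i q assume c: "composable P p i q"
    then have pq: "p \<in> Ops P" "q \<in> Ops P"
      by (auto simp: composable_def)
    have "g (Comp P p i q) = Comp Q (g p) i (g q)"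
      using f c by (simp add: operad_morphisms_def)
    moreover have "g' (Comp Q (g p) i (g q)) = Comp R (g' (g p)) i (g' (g q))"
      using f' comp[OF c] by (simp add: operad_morphisms_def)
    ultimately show "compose (Ops P) g' g (Comp P p i q) =
        Comp R (compose (Ops P) g' g p) i (compose (Ops P) g' g q)"
      using pq PC[OF c] by (simp add: compose_eq)
  next
    fix p \<sigma> assume p: "p \<in> Ops P" and \<sigma>: "\<sigma> permutes {1..arity P p}"
    have "g (Perm P \<sigma> p) = Perm Q \<sigma> (g p)"
      using f p \<sigma> by (simp add: operad_morphisms_def)
    moreover have "g' (Perm Q \<sigma> (g p)) = Perm R \<sigma> (g' (g p))"
      using f' g[OF p] \<sigma> by (simp add: operad_morphisms_def)
    ultimately show "compose (Ops P) g' g (Perm P \<sigma> p) = Perm R \<sigma> (compose (Ops P) g' g p)"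
      using p PP[OF p \<sigma>] by (simp add: compose_eq)
  qed
qed

lemma operad_morphisms_id:
  assumes P: "symmetric_operad P"
  shows "(restrict id (Col P), restrict id (Ops P)) \<in> operad_morphisms P P"
proof -
  have P1: "set (Inp P p) \<subseteq> Col P" "Out P p \<in> Col P" if "p \<in> Ops P" for p
    using P that by (auto simp: symmetric_operad_def)
  have PU: "Unit P c \<in> Ops P" if "c \<in> Col P" for c
    using P that by (auto simp: symmetric_operad_def)
  have PC: "Comp P p i q \<in> Ops P" if "composable P p i q" for p i q
    using P that by (simp add: symmetric_operad_def)
  have PP: "Perm P \<sigma> p \<in> Ops P" if "p \<in> Ops P" "\<sigma> permutes {1..arity P p}" for p \<sigma>
    using P that by (simp add: symmetric_operad_def)
  have "map (restrict id (Col P)) (Inp P p) = Inp P p" if "p \<in> Ops P" for p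
    using P1[OF that] by (auto intro!: map_idI)
  then show ?thesis
    unfolding operad_morphisms_def using P1 PU PC PP by (auto simp: composable_def)
qed

lemma is_category_Operads: "is_category Operads"
proof -
  have ext: "f \<in> extensional (Col P)" "g \<in> extensional (Ops P)" "f \<in> Col P \<rightarrow> Col Q" "g \<in> Ops P \<rightarrow> Ops Q"
    if "(f, g) \<in> operad_morphisms P Q" for f g and P Q :: "('c, 'o) operad"
    using that by (auto simp: operad_morphisms_def PiE_def)
  have unitl: "compose (Col P) f (restrict id (Col P)) = f" "compose (Ops P) g (restrict id (Ops P)) = g"
    "compose (Col P) (restrict id (Col Q)) f = f" "compose (Ops P) (restrict id (Ops Q)) g = g"
    if "(f, g) \<in> operad_morphisms P Q" for f g and P Q :: "('c, 'o) operad"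
    using ext[OF that] by (auto simp: compose_def restrict_def fun_eq_iff extensional_def Pi_def)
  have assoc: "compose (Col P) h (compose (Col P) f' f) = compose (Col P) (compose (Col Q) h f') f"
    "compose (Ops P) k (compose (Ops P) g' g) = compose (Ops P) (compose (Ops Q) k g') g"
    if "(f, g) \<in> operad_morphisms P Q" for f g h f' k g' and P Q :: "('c, 'o) operad"
    using ext[OF that] by (auto simp: compose_def restrict_def fun_eq_iff)
  show ?thesis
    unfolding is_category_def
    by (auto simp: Operads_def operad_morphisms_id operad_morphisms_comp unitl assoc)
qed

lemma is_category_full_subcategory:
  assumes "is_category C" "S \<subseteq> Ob C"
  shows "is_category (full_subcategory C S)"
  using assms unfolding is_category_def full_subcategory_def by (auto simp: subset_iff)

lemma symmetric_operad_Omega_operad: "finite_rooted_tree T \<Longrightarrow> symmetric_operad (Omega_operad T)"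
  by (rule rooted_tree.symmetric_operad_Omega) (rule rooted_tree.intro)

lemma is_category_Omega: "is_category Omega"
  unfolding Omega_def
  by (rule is_category_full_subcategory[OF is_category_Operads])
     (auto simp: Operads_def symmetric_operad_Omega_operad)

lemma Omega_sel:
  "Ob Omega = {Omega_operad T | T. finite_rooted_tree T}"
  "(P, h, Q) \<in> Ar Omega \<longleftrightarrow> P \<in> Ob Omega \<and> Q \<in> Ob Omega \<and> h \<in> operad_morphisms P Q"
  "Dom Omega (P, h, Q) = P" "Cod Omega (P, h, Q) = Q"
  "Ide Omega P = (P, (restrict id (Col P), restrict id (Ops P)), P)"
  "Cmp Omega (P', (f', g'), Q') (P, (f, g), Q) = (P, (compose (Col P) f' f, compose (Ops P) g' g), Q')"
  by (auto simp: Omega_def full_subcategory_def Operads_def symmetric_operad_Omega_operad)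

section \<open>Arrows of the dendroidal category from maps of trees\<close>

text \<open>On rooted trees the choice is no ambiguity: by \<open>morphism_unique\<close> at most
  one map of operations goes with \<open>f\<close>.\<close>

definition tree_arrow :: "('e, 'v) tree \<Rightarrow> ('e, 'v) tree \<Rightarrow> ('e \<Rightarrow> 'e) \<Rightarrow> ('e, 'e list \<times> 'v ptree) operad_arrow" where
  "tree_arrow S T f = (Omega_operad S,
     (f, SOME g. (f, g) \<in> operad_morphisms (Omega_operad S) (Omega_operad T)), Omega_operad T)"

lemma Col_Omega_operad: "Col (Omega_operad T) = Edges T"
  by (simp add: Omega_operad_def free_operad_def tree_signature_def)

context
  fixes S T :: "('e::infinite, 'v::infinite) tree"
  assumes S: "finite_rooted_tree S" and T: "finite_rooted_tree T"
begin

lemma two_trees: "two_trees S T"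
  using S T by (simp add: two_trees_def rooted_tree_def)

lemma tree_arrow_eq:
  assumes "(f, g) \<in> operad_morphisms (Omega_operad S) (Omega_operad T)"
  shows "tree_arrow S T f = (Omega_operad S, (f, g), Omega_operad T)"
proof -
  have "(SOME g. (f, g) \<in> operad_morphisms (Omega_operad S) (Omega_operad T)) = g"
    by (rule some_equality[where P = "\<lambda>g. (f, g) \<in> operad_morphisms (Omega_operad S) (Omega_operad T)"])
       (use assms two_trees.morphism_unique[OF two_trees] in auto)
  then show ?thesis
    by (simp add: tree_arrow_def)
qed

lemma tree_arrow_Ar:
  assumes "f \<in> tree_maps S T"
  obtains g where "(f, g) \<in> operad_morphisms (Omega_operad S) (Omega_operad T)"
    "tree_arrow S T f = (Omega_operad S, (f, g), Omega_operad T)"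
  using two_trees.tree_map_morphism[OF two_trees assms] tree_arrow_eq by blast

lemma morphism_tree_arrow:
  assumes "h \<in> operad_morphisms (Omega_operad S) (Omega_operad T)"
  shows "fst h \<in> tree_maps S T" "(Omega_operad S, h, Omega_operad T) = tree_arrow S T (fst h)"
proof -
  obtain f g where h: "h = (f, g)"
    by fastforce
  show "fst h \<in> tree_maps S T" "(Omega_operad S, h, Omega_operad T) = tree_arrow S T (fst h)"
    using assms two_trees.morphism_tree_map[OF two_trees] tree_arrow_eq unfolding h by auto
qed

lemma tree_arrow_in_Omega:
  assumes "f \<in> tree_maps S T"
  shows "tree_arrow S T f \<in> Ar Omega" "Dom Omega (tree_arrow S T f) = Omega_operad S"
    "Cod Omega (tree_arrow S T f) = Omega_operad T"
proof -
  obtain g where g: "(f, g) \<in> operad_morphisms (Omega_operad S) (Omega_operad T)"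
    "tree_arrow S T f = (Omega_operad S, (f, g), Omega_operad T)"
    using tree_arrow_Ar[OF assms] .
  show "tree_arrow S T f \<in> Ar Omega" "Dom Omega (tree_arrow S T f) = Omega_operad S"
    "Cod Omega (tree_arrow S T f) = Omega_operad T"
    using g(1) S T unfolding g(2) Omega_sel by auto
qed

end

lemma tree_arrow_comp:
  fixes S T U :: "('e::infinite, 'v::infinite) tree"
  assumes S: "finite_rooted_tree S" and T: "finite_rooted_tree T" and U: "finite_rooted_tree U"
    and f: "f \<in> tree_maps S T" and f': "f' \<in> tree_maps T U"
  shows "Cmp Omega (tree_arrow T U f') (tree_arrow S T f) = tree_arrow S U (compose (Edges S) f' f)"
proof -
  obtain g where g: "(f, g) \<in> operad_morphisms (Omega_operad S) (Omega_operad T)"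
    "tree_arrow S T f = (Omega_operad S, (f, g), Omega_operad T)"
    using tree_arrow_Ar[OF S T f] .
  obtain g' where g': "(f', g') \<in> operad_morphisms (Omega_operad T) (Omega_operad U)"
    "tree_arrow T U f' = (Omega_operad T, (f', g'), Omega_operad U)"
    using tree_arrow_Ar[OF T U f'] .
  have "(compose (Edges S) f' f, compose (Ops (Omega_operad S)) g' g) \<in> operad_morphisms (Omega_operad S) (Omega_operad U)"
    using operad_morphisms_comp[OF symmetric_operad_Omega_operad[OF S] g(1) g'(1)] by (simp add: Col_Omega_operad)
  from tree_arrow_eq[OF S U this] show ?thesis
    by (simp add: g g' Omega_sel Col_Omega_operad)
qed

lemma tree_arrow_id:
  fixes S :: "('e::infinite, 'v::infinite) tree"
  assumes S: "finite_rooted_tree S"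
  shows "Ide Omega (Omega_operad S) = tree_arrow S S (restrict id (Edges S))"
    and "restrict id (Edges S) \<in> tree_maps S S"
proof -
  note m = operad_morphisms_id[OF symmetric_operad_Omega_operad[OF S], unfolded Col_Omega_operad]
  show "Ide Omega (Omega_operad S) = tree_arrow S S (restrict id (Edges S))"
    using tree_arrow_eq[OF S S m] by (simp add: Omega_sel Col_Omega_operad)
  show "restrict id (Edges S) \<in> tree_maps S S"
    using morphism_tree_arrow(1)[OF S S m] by simp
qed

text \<open>When vertices go to vertices, the cut condition is met by the one-vertex cut of
  \<open>cut_vertex\<close>.\<close>

lemma tree_map_vertices:
  assumes S: "finite_rooted_tree S" and T: "finite_rooted_tree T"
    and f: "f \<in> Edges S \<rightarrow>\<^sub>E Edges T" "inj_on f (Edges S)"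
    and v: "\<And>v. v \<in> Verts S \<Longrightarrow> \<exists>w\<in>Verts T. Outedge T w = f (Outedge S v) \<and> In T w = f ` In S v"
  shows "f \<in> tree_maps S T"
proof -
  interpret S: rooted_tree S by (rule rooted_tree.intro) (rule S)
  interpret T: rooted_tree T by (rule rooted_tree.intro) (rule T)
  show ?thesis
    unfolding tree_maps_def
  proof (intro CollectI conjI ballI f(1))
    fix v assume "v \<in> Verts S"
    then show "inj_on f (In S v)" "tree_cut T (f (Outedge S v)) (f ` In S v)"
      using v[of v] T.cut_vertex f(2) S.In_Edges by (auto intro: inj_on_subset) metis
  qed
qed

lemma tree_iso:
  fixes S T :: "('e::infinite, 'v::infinite) tree"
  assumes S: "finite_rooted_tree S" and T: "finite_rooted_tree T"
    and f: "f \<in> extensional (Edges S)" "bij_betw f (Edges S) (Edges T)"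
    and v: "\<And>v. v \<in> Verts S \<Longrightarrow> \<exists>w\<in>Verts T. Outedge T w = f (Outedge S v) \<and> In T w = f ` In S v"
    and w: "\<And>w. w \<in> Verts T \<Longrightarrow> \<exists>v\<in>Verts S. Outedge T w = f (Outedge S v) \<and> In T w = f ` In S v"
  shows "is_iso Omega (tree_arrow S T f)"
proof -
  interpret S: rooted_tree S by (rule rooted_tree.intro) (rule S)
  let ?k = "restrict (inv_into (Edges S) f) (Edges T)"
  have inj: "inj_on f (Edges S)" and img: "f ` Edges S = Edges T"
    using f(2) by (auto simp: bij_betw_def)
  have fm: "f \<in> tree_maps S T"
    by (rule tree_map_vertices[OF S T _ inj v]) (use f(1) img in \<open>auto simp: PiE_def\<close>)
  have kf: "?k (f e) = e" if "e \<in> Edges S" for e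
    using that inj img by auto
  have fk: "f (?k e) = e" "?k e \<in> Edges S" if "e \<in> Edges T" for e
    using that img by (auto simp: f_inv_into_f inv_into_into)
  have km: "?k \<in> tree_maps T S"
  proof (rule tree_map_vertices[OF T S])
    show "?k \<in> Edges T \<rightarrow>\<^sub>E Edges S"
      using fk(2) by auto
    show "inj_on ?k (Edges T)"
      using fk(1) by (metis inj_onI)
    fix x assume "x \<in> Verts T"
    from w[OF this] obtain u where u: "u \<in> Verts S" "Outedge T x = f (Outedge S u)" "In T x = f ` In S u"
      by auto
    then have "Outedge S u = ?k (Outedge T x)"
      using kf S.Outedge_Edges by simp
    moreover have "In S u = ?k ` In T x"
      unfolding u(3) image_image using kf S.In_Edges[OF u(1)] by force
    ultimately show "\<exists>w\<in>Verts S. Outedge S w = ?k (Outedge T x) \<and> In S w = ?k ` In T x"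
      using u(1) by blast
  qed
  have "compose (Edges S) ?k f = restrict id (Edges S)" "compose (Edges T) f ?k = restrict id (Edges T)"
    using kf fk by (auto simp: compose_def restrict_def fun_eq_iff)
  then have "Cmp Omega (tree_arrow T S ?k) (tree_arrow S T f) = Ide Omega (Omega_operad S)"
    "Cmp Omega (tree_arrow S T f) (tree_arrow T S ?k) = Ide Omega (Omega_operad T)"
    using tree_arrow_comp[OF S T S fm km] tree_arrow_comp[OF T S T km fm] tree_arrow_id(1)[OF S] tree_arrow_id(1)[OF T]
    by simp_all
  then show ?thesis
    unfolding is_iso_def using tree_arrow_in_Omega[OF S T fm] tree_arrow_in_Omega[OF T S km] by auto
qed


section \<open>The rooted tree of a planar tree\<close>

instance ptree :: (countable) countable
  by countable_datatype

text \<open>Edges and vertices must be named in arbitrary infinite types. There are countably many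
  planar trees with numbered vertices, so they embed in any such type.\<close>

definition encode :: "nat ptree \<Rightarrow> 'a::infinite" where
  "encode = (SOME f. inj f)"

lemma inj_encode: "inj (encode :: nat ptree \<Rightarrow> 'a::infinite)"
  unfolding encode_def
proof (rule someI_ex[where P = inj])
  obtain f :: "nat \<Rightarrow> 'a" where "inj f"
    using infinite_countable_subset[OF infinite_UNIV] by blast
  then have "inj (f \<circ> (to_nat :: nat ptree \<Rightarrow> nat))"
    by (intro inj_compose inj_to_nat)
  then show "\<exists>f :: nat ptree \<Rightarrow> 'a. inj f"
    by (rule exI[where x = "f \<circ> to_nat"])
qed

lemma encode_eq [simp]: "encode s = encode t \<longleftrightarrow> s = t"
  using inj_encode by (auto dest: injD)

lemma encode_image [simp]: "encode s \<in> encode ` X \<longleftrightarrow> s \<in> X"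
  by auto

lemma inv_encode [simp]: "inv encode (encode s) = s"
  by (rule inv_f_f[OF inj_encode])

primrec children :: "'v ptree \<Rightarrow> 'v ptree set" where
  "children (Leaf k) = {}"
| "children (Node v ts) = set ts"

text \<open>The edges are the subtrees, an edge being the root of the part of the tree above it;
  a vertex is named by the subtree above its output edge.\<close>

definition tree_of :: "nat ptree \<Rightarrow> ('e::infinite, 'v::infinite) tree" where
  "tree_of p = \<lparr>
     Edges = encode ` subtrees p,
     Verts = encode ` {s \<in> subtrees p. \<exists>j ts. s = Node j ts},
     In = (\<lambda>v. encode ` children (inv encode v)),
     Outedge = (\<lambda>v. encode (inv encode v :: nat ptree)),
     Root = encode p\<rparr>"

lemma tree_of_sel [simp]:
  "Edges (tree_of p) = encode ` subtrees p" "Root (tree_of p) = encode p"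
  "In (tree_of p) (encode (Node j ts)) = encode ` set ts"
  "Outedge (tree_of p) (encode s) = encode s"
  by (simp_all add: tree_of_def)

lemma Verts_tree_of: "v \<in> Verts (tree_of p) \<longleftrightarrow> (\<exists>j ts. Node j ts \<in> subtrees p \<and> v = encode (Node j ts))"
  by (auto simp: tree_of_def)

lemma child_length: "s \<in> set ts \<Longrightarrow> length (vertices s) < length (vertices (Node j ts))"
  using split_list by fastforce

lemma subtrees_length_le: "s \<in> subtrees t \<Longrightarrow> length (vertices s) \<le> length (vertices t)"
  using subtrees_length[of s t] by auto

lemma parent_ex: "s \<in> subtrees p \<Longrightarrow> s \<noteq> p \<Longrightarrow> \<exists>j ts. Node j ts \<in> subtrees p \<and> s \<in> set ts"
proof (induction p)
  case (Node v us)
  then obtain u where u: "u \<in> set us" "s \<in> subtrees u"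
    by auto
  show ?case
  proof (cases "s = u")
    case True
    then show ?thesis
      using u by (intro exI[of _ v] exI[of _ us]) simp
  next
    case False
    then obtain j ts where "Node j ts \<in> subtrees u" "s \<in> set ts"
      using Node.IH u by blast
    then show ?thesis
      using u by auto
  qed
qed simp

text \<open>If \<open>s\<close> is an input of the root vertex, any other vertex with input
  \<open>s\<close> would have to lie within \<open>s\<close>, against the count of vertices.
  Otherwise both vertices lie in the same child, and induction applies.\<close>

lemma parent_unique:
  assumes "separated p" "Node j ts \<in> subtrees p" "Node k us \<in> subtrees p" "s \<in> set ts" "s \<in> set us"
  shows "Node j ts = Node k us"
  using assms
proof (induction p)
  case (Node v rs)
  have root: "x = Node v rs"
    if h: "s \<in> set rs" "x = Node i ws" "s \<in> set ws" "x \<in> subtrees (Node v rs)" for x i ws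
  proof (rule ccontr)
    assume "x \<noteq> Node v rs"
    then obtain l where l: "l < length rs" "x \<in> subtrees (rs ! l)"
      using h(4) by (auto simp: in_set_conv_nth)
    obtain m where m: "m < length rs" "s = rs ! m"
      using h(1) by (auto simp: in_set_conv_nth)
    have "s \<in> subtrees (rs ! l)"
      using child_subtrees[of i ws "rs ! l" s] l(2) h by simp
    then have "l = m"
      using separated_children[OF Node.prems(1), of l m s] l m by simp
    then have "length (vertices x) \<le> length (vertices s)"
      using l m subtrees_length_le[of x s] by simp
    then show False
      using child_length[OF h(3), of i] h(2) by simp
  qed
  show ?case
  proof (cases "Node j ts = Node v rs \<or> Node k us = Node v rs")
    case True
    then have "s \<in> set rs"
      using Node.prems by auto
    then have "Node j ts = Node v rs" "Node k us = Node v rs"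
      using root[OF _ refl Node.prems(4,2)] root[OF _ refl Node.prems(5,3)] by blast+
    then show ?thesis
      by (simp only:)
  next
    case False
    then obtain l m where lm: "l < length rs" "Node j ts \<in> subtrees (rs ! l)" "m < length rs" "Node k us \<in> subtrees (rs ! m)"
      using Node.prems by (auto simp: in_set_conv_nth)
    have "s \<in> subtrees (rs ! l)" "s \<in> subtrees (rs ! m)"
      using child_subtrees[OF lm(2)] child_subtrees[OF lm(4)] Node.prems by auto
    then have "l = m"
      using separated_children[OF Node.prems(1), of l m s] lm by simp
    then show ?thesis
      using Node.IH[of "rs ! l"] lm Node.prems separated_child[OF Node.prems(1), of "rs ! l"] by auto
  qed
qed simp

lemma finite_rooted_tree_of:
  assumes p: "separated p"
  shows "finite_rooted_tree (tree_of p :: ('e::infinite, 'v::infinite) tree)"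
proof -
  let ?T = "tree_of p :: ('e, 'v) tree"
  have reach: "(encode s, encode r) \<in> (below ?T)\<^sup>*" if "s \<in> subtrees r" "r \<in> subtrees p" for s r
    using that
  proof (induction r)
    case (Node j ts)
    show ?case
    proof (cases "s = Node j ts")
      case False
      then obtain u where u: "u \<in> set ts" "s \<in> subtrees u"
        using Node.prems(1) by auto
      then have "(encode s, encode u) \<in> (below ?T)\<^sup>*"
        using Node.IH[OF u] child_subtrees[OF Node.prems(2) u(1)] by blast
      moreover have "(encode u, Outedge ?T (encode (Node j ts))) \<in> below ?T"
        using u(1) Node.prems(2) unfolding below_def
        by (intro CollectI exI[of _ "encode u"] exI[of _ "encode (Node j ts) :: 'v"]) (auto simp: Verts_tree_of)
      ultimately show ?thesis
        by simp
    qed simp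
  qed simp
  have root: "p \<notin> set ts" if "Node j ts \<in> subtrees p" for j ts
    using child_length[of p ts j] subtrees_length_le[OF that] by auto
  have uniq: "\<exists>!v. v \<in> Verts ?T \<and> encode s \<in> In ?T v" if s: "s \<in> subtrees p" "s \<noteq> p" for s
  proof -
    obtain j ts where j: "Node j ts \<in> subtrees p" "s \<in> set ts"
      using parent_ex[OF s] by blast
    show ?thesis
    proof (rule ex1I[of _ "encode (Node j ts)"])
      show "encode (Node j ts) \<in> Verts ?T \<and> encode s \<in> In ?T (encode (Node j ts))"
        using j by (auto simp: Verts_tree_of)
      fix v assume "v \<in> Verts ?T \<and> encode s \<in> In ?T v"
      then obtain k us where "Node k us \<in> subtrees p" "v = encode (Node k us)" "s \<in> set us"
        by (auto simp: Verts_tree_of)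
      then show "v = encode (Node j ts)"
        using parent_unique[OF p _ j(1) _ j(2)] by blast
    qed
  qed
  have fin: "finite (Verts ?T)"
    by (simp add: tree_of_def)
  have io: "In ?T v \<subseteq> Edges ?T \<and> Outedge ?T v \<in> Edges ?T" "Root ?T \<notin> In ?T v"
    if v: "v \<in> Verts ?T" for v
  proof -
    obtain j ts where j: "Node j ts \<in> subtrees p" "v = encode (Node j ts)"
      using v by (auto simp: Verts_tree_of)
    then show "In ?T v \<subseteq> Edges ?T \<and> Outedge ?T v \<in> Edges ?T" "Root ?T \<notin> In ?T v"
      using child_subtrees[OF j(1)] root[OF j(1)] by auto
  qed
  have inj: "inj_on (Outedge ?T) (Verts ?T)"
    by (rule inj_onI) (auto simp: Verts_tree_of)
  have "(e, Root ?T) \<in> {(d, Outedge ?T v) | d v. v \<in> Verts ?T \<and> d \<in> In ?T v}\<^sup>*"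
    if "e \<in> Edges ?T" for e
    using reach[of _ p] that by (auto simp: below_def)
  moreover have "\<exists>!v. v \<in> Verts ?T \<and> e \<in> In ?T v" if e: "e \<in> Edges ?T" "e \<noteq> Root ?T" for e
  proof -
    obtain s where s: "s \<in> subtrees p" "e = encode s"
      using e(1) by auto
    then have "s \<noteq> p"
      using e(2) by auto
    from uniq[OF s(1) this] show ?thesis
      unfolding s(2) .
  qed
  ultimately show ?thesis
    unfolding finite_rooted_tree_def using fin io inj by auto
qed

lemma cut_pcut:
  assumes "tree_cut (tree_of p) e Y"
  shows "\<exists>s X. s \<in> subtrees p \<and> e = encode s \<and> Y = encode ` X \<and> planar_cut s X"
  using assms
proof (induction rule: tree_cut.induct)
  case (edge e)
  then obtain s where "s \<in> subtrees p" "e = encode s"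
    by auto
  then show ?case
    using planar_cut.edge[of s] by (intro exI[of _ s] exI[of _ "{s}"]) simp
next
  case (node v Y)
  then obtain j ts where v: "Node j ts \<in> subtrees p" "v = encode (Node j ts)"
    by (auto simp: Verts_tree_of)
  have "\<exists>X. Y (encode (ts ! i)) = encode ` X \<and> planar_cut (ts ! i) X" if "i \<in> {..<length ts}" for i
    using node.IH[of "encode (ts ! i)"] that v by auto
  then have "\<exists>X. \<forall>i\<in>{..<length ts}. Y (encode (ts ! i)) = encode ` X i \<and> planar_cut (ts ! i) (X i)"
    by (intro bchoice ballI)
  then obtain X where X: "\<And>i. i < length ts \<Longrightarrow> Y (encode (ts ! i)) = encode ` X i \<and> planar_cut (ts ! i) (X i)"
    by auto
  have "planar_cut (Node j ts) (\<Union>i<length ts. X i)"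
    by (rule planar_cut.node) (use X in blast)
  moreover have "(\<Union>d\<in>In (tree_of p) v. Y d) = encode ` (\<Union>i<length ts. X i)"
  proof -
    have "set ts = (\<lambda>i. ts ! i) ` {..<length ts}"
      by (auto simp: in_set_conv_nth)
    then show ?thesis
      using X by (simp add: v(2) image_UN)
  qed
  ultimately show ?case
    using v by (intro exI[of _ "Node j ts"] exI[of _ "\<Union>i<length ts. X i"]) (simp only: tree_of_sel simp_thms)
qed

lemma planar_cut_cut:
  "planar_cut s X \<Longrightarrow> separated p \<Longrightarrow> s \<in> subtrees p \<Longrightarrow>
    tree_cut (tree_of p :: ('e::infinite, 'v::infinite) tree) (encode s) (encode ` X)"
proof (induction rule: planar_cut.induct)
  case (edge t)
  then show ?case
    by (auto intro: tree_cut.edge)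
next
  case (node ts X j)
  have d: "distinct ts"
    using separated_distinct_children[OF separated_subtrees[OF node.prems]] .
  \<comment> \<open>Encoded edges are translated back into child indices, which are unique because
    the children are distinct.\<close>
  define Y :: "'e \<Rightarrow> 'e set" where "Y e = encode ` X (THE i. i < length ts \<and> encode (ts ! i) = e)" for e
  have Y: "Y (encode (ts ! i)) = encode ` X i" if "i < length ts" for i
  proof -
    have "(THE k. k < length ts \<and> encode (ts ! k) = (encode (ts ! i) :: 'e)) = i"
      by (rule the_equality) (use that d in \<open>auto simp: nth_eq_iff_index_eq\<close>)
    then show ?thesis
      by (simp add: Y_def)
  qed
  have set: "set ts = (\<lambda>i. ts ! i) ` {..<length ts}"
    by (auto simp: in_set_conv_nth)
  let ?T = "tree_of p :: ('e, 'v) tree"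
  have "tree_cut ?T (Outedge ?T (encode (Node j ts))) (\<Union>e\<in>In ?T (encode (Node j ts)). Y e)"
  proof (rule tree_cut.node)
    show "encode (Node j ts) \<in> Verts ?T"
      using node.prems by (auto simp: Verts_tree_of)
    fix d assume "d \<in> In ?T (encode (Node j ts))"
    then obtain i where "i < length ts" "d = encode (ts ! i)"
      by (auto simp: in_set_conv_nth)
    then show "tree_cut ?T d (Y d)"
      using node.IH[of i] node.prems(1) child_subtrees[OF node.prems(2), of "ts ! i"] Y by simp
  qed
  moreover have "(\<Union>e\<in>In ?T (encode (Node j ts)). Y e) = encode ` (\<Union>i<length ts. X i)"
    using Y by (simp add: set image_UN)
  ultimately show ?case
    by simp
qed

lemma cut_tree_of_iff:
  assumes "separated p" "s \<in> subtrees p"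
  shows "tree_cut (tree_of p :: ('e::infinite, 'v::infinite) tree) (encode s) (encode ` X) \<longleftrightarrow> planar_cut s X"
proof
  assume "tree_cut (tree_of p :: ('e, 'v) tree) (encode s) (encode ` X)"
  from cut_pcut[OF this] obtain s' X' where
    "encode s = (encode s' :: 'e)" "encode ` X = (encode ` X' :: 'e set)" "planar_cut s' X'"
    by (elim exE conjE)
  then show "planar_cut s X"
    by (simp add: inj_image_eq_iff[OF inj_encode])
qed (rule planar_cut_cut[OF _ assms])

definition encode_map :: "nat ptree \<Rightarrow> (nat ptree \<Rightarrow> nat ptree) \<Rightarrow> 'e::infinite \<Rightarrow> 'e" where
  "encode_map p f = (\<lambda>e\<in>encode ` subtrees p. encode (f (inv encode e)))"

lemma encode_map_encode [simp]: "s \<in> subtrees p \<Longrightarrow> encode_map p f (encode s) = encode (f s)"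
  by (simp add: encode_map_def)

lemma encode_map_image: "X \<subseteq> subtrees p \<Longrightarrow> encode_map p f ` encode ` X = encode ` f ` X"
  by (force simp: image_image subset_iff)

lemma encode_map_inj_on: "X \<subseteq> subtrees p \<Longrightarrow> inj_on (encode_map p f) (encode ` X) \<longleftrightarrow> inj_on f X"
  by (auto simp: inj_on_def subset_iff)

lemma encode_map_tree_maps:
  assumes t: "separated t" and f: "f \<in> subtrees p \<rightarrow>\<^sub>E subtrees t"
  shows "encode_map p f \<in> tree_maps (tree_of p :: ('e::infinite, 'v::infinite) tree) (tree_of t :: ('e, 'v) tree) \<longleftrightarrow> f \<in> edge_maps p t"
proof -
  let ?S = "tree_of p :: ('e, 'v) tree" and ?T = "tree_of t :: ('e, 'v) tree"
  have "encode_map p f \<in> Edges ?S \<rightarrow>\<^sub>E Edges ?T"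
    using f by (auto simp: encode_map_def)
  moreover have "inj_on (encode_map p f) (In ?S (encode (Node j ts))) \<longleftrightarrow> inj_on f (set ts)"
    "tree_cut ?T (encode_map p f (Outedge ?S (encode (Node j ts)))) (encode_map p f ` In ?S (encode (Node j ts))) \<longleftrightarrow>
      planar_cut (f (Node j ts)) (f ` set ts)" if "Node j ts \<in> subtrees p" for j ts
  proof -
    have sub: "set ts \<subseteq> subtrees p"
      using child_subtrees[OF that] by auto
    show "inj_on (encode_map p f) (In ?S (encode (Node j ts))) \<longleftrightarrow> inj_on f (set ts)"
      by (simp add: encode_map_inj_on[OF sub])
    have "f (Node j ts) \<in> subtrees t"
      using f that by auto
    then show "tree_cut ?T (encode_map p f (Outedge ?S (encode (Node j ts)))) (encode_map p f ` In ?S (encode (Node j ts))) \<longleftrightarrow>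
      planar_cut (f (Node j ts)) (f ` set ts)"
      using that by (simp add: cut_tree_of_iff[OF t] encode_map_image[OF sub])
  qed
  moreover have "(\<forall>v\<in>Verts ?S. Q v) \<longleftrightarrow> (\<forall>j ts. Node j ts \<in> subtrees p \<longrightarrow> Q (encode (Node j ts)))" for Q
    by (auto simp: Verts_tree_of)
  ultimately show ?thesis
    unfolding tree_maps_def edge_maps_def using f by (simp only: mem_Collect_eq simp_thms) blast
qed

lemma encode_map_surj:
  assumes t: "separated t" and F: "F \<in> tree_maps (tree_of p :: ('e::infinite, 'v::infinite) tree) (tree_of t :: ('e, 'v) tree)"
  shows "\<exists>f\<in>edge_maps p t. F = encode_map p f"
proof -
  define f where "f = (\<lambda>s\<in>subtrees p. inv encode (F (encode s)))"
  have F1: "F \<in> encode ` subtrees p \<rightarrow>\<^sub>E encode ` subtrees t"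
    using F by (simp add: tree_maps_def)
  then have Fs: "\<exists>u\<in>subtrees t. F (encode s) = encode u" if "s \<in> subtrees p" for s
    using that by auto
  have f1: "f \<in> subtrees p \<rightarrow>\<^sub>E subtrees t"
    using Fs by (fastforce simp: f_def)
  have "F = encode_map p f"
  proof (rule extensionalityI)
    show "F \<in> extensional (encode ` subtrees p)"
      using F1 by (simp add: PiE_def)
    fix e :: 'e assume "e \<in> encode ` subtrees p"
    then obtain s where s: "s \<in> subtrees p" "e = encode s"
      by auto
    then show "F e = encode_map p f e"
      using Fs[OF s(1)] by (auto simp: f_def)
  qed (simp add: encode_map_def)
  then show ?thesis
    using encode_map_tree_maps[OF t f1] F by blast
qed

lemma encode_map_eq:
  assumes "f \<in> extensional (subtrees p)" "g \<in> extensional (subtrees p)" "encode_map p f = (encode_map p g :: 'e::infinite \<Rightarrow> 'e)"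
  shows "f = g"
proof (rule extensionalityI[OF assms(1,2)])
  fix s assume "s \<in> subtrees p"
  then show "f s = g s"
    using fun_cong[OF assms(3), of "encode s"] by simp
qed


section \<open>Every rooted tree has a planar representative\<close>

context rooted_tree
begin

text \<open>The largest cut stops only at leaves. It is built by well-founded induction, as
  \<open>below T\<close> is finite and acyclic.\<close>

lemma leaves_cut: "\<exists>X. tree_cut T (Root T) X \<and> (\<forall>v\<in>Verts T. Outedge T v \<notin> X)"
proof -
  have "below T \<subseteq> Edges T \<times> Edges T"
    using In_Edges Outedge_Edges by (auto simp: below_def)
  then have "finite (below T)"
    using finite_Edges finite_subset by blast
  moreover have "acyclic (below T)"
  proof (rule acyclicI, rule allI)
    fix e show "(e, e) \<notin> (below T)\<^sup>+"
    proof (cases "e \<in> Edges T")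
      case False
      then show ?thesis
        using \<open>below T \<subseteq> _\<close> by (meson SigmaD1 subsetD tranclD)
    qed (rule below_acyclic)
  qed
  ultimately have "wf (below T)"
    by (rule finite_acyclic_wf)
  then have "e \<in> Edges T \<longrightarrow> (\<exists>X. tree_cut T e X \<and> (\<forall>v\<in>Verts T. Outedge T v \<notin> X))" for e
  proof (induction e rule: wf_induct_rule)
    case (less e)
    show ?case
    proof (cases "\<exists>v\<in>Verts T. Outedge T v = e")
      case True
      then obtain v where v: "v \<in> Verts T" "Outedge T v = e"
        by auto
      have "\<exists>X. tree_cut T d X \<and> (\<forall>v\<in>Verts T. Outedge T v \<notin> X)" if "d \<in> In T v" for d
        using less[of d] that v In_Edges by (auto simp: below_def)
      then have "\<exists>X. \<forall>d\<in>In T v. tree_cut T d (X d) \<and> (\<forall>v\<in>Verts T. Outedge T v \<notin> X d)"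
        by (intro bchoice ballI)
      then obtain X where X: "\<And>d. d \<in> In T v \<Longrightarrow> tree_cut T d (X d) \<and> (\<forall>v\<in>Verts T. Outedge T v \<notin> X d)"
        by blast
      then have "tree_cut T e (\<Union>d\<in>In T v. X d)"
        using tree_cut.node[OF v(1), of X] v(2) by blast
      then show ?thesis
        using X by blast
    next
      case False
      then show ?thesis
        by (auto intro!: exI[of _ "{e}"] tree_cut.edge)
    qed
  qed
  then show ?thesis
    using Root_Edges by blast
qed

text \<open>The formal tree of the operation from all leaves of \<open>T\<close> to its root is a
  planar form of \<open>T\<close>: sending a subtree to its root colour identifies subtrees with
  edges.\<close>

lemma planar_representative:
  "\<exists>cs t. (cs, t) \<in> Ops P \<and> bij_betw (root_colour \<Sigma> cs) (subtrees t) (Edges T) \<and>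
    (\<forall>v\<in>Verts T. Outedge T v \<notin> set cs)"
proof -
  obtain X where X: "tree_cut T (Root T) X" "\<And>v. v \<in> Verts T \<Longrightarrow> Outedge T v \<notin> X"
    using leaves_cut by blast
  have "finite X"
    using cut_Edges[OF X(1)] finite_Edges finite_subset by blast
  then obtain cs where cs: "set cs = X" "distinct cs"
    using finite_distinct_list by blast
  then obtain t where t: "(cs, t) \<in> Ops P" "root_colour \<Sigma> cs t = Root T"
    using Ops_Omega_ex[of "Root T" cs] X(1) by blast
  let ?r = "root_colour \<Sigma> cs"
  note O = t(1)[unfolded Ops_Omega_iff]
  have wc: "well_coloured \<Sigma> cs s" if "s \<in> subtrees t" "well_coloured \<Sigma> cs t" for s t
    using that by (induction t) auto
  have leaf: "cs ! (k - 1) \<in> set cs" if "Leaf k \<in> subtrees t" for k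
  proof -
    have "k \<in> {1..length cs}"
      using that O leaf_numbers_subtrees[of k t] by simp
    then show ?thesis
      by auto
  qed
  \<comment> \<open>Each subtree is itself well coloured over \<open>cs\<close>, hence determined by
    its root colour.\<close>
  have "inj_on ?r (subtrees t)"
  proof (rule inj_onI)
    fix s s' assume s: "s \<in> subtrees t" "s' \<in> subtrees t" "?r s = ?r s'"
    show "s = s'"
    proof (rule well_coloured_unique[OF _ _ s(3) cs(2)])
      show "well_coloured \<Sigma> cs s" "well_coloured \<Sigma> cs s'"
        using wc s O by auto
      show "set (leaf_numbers s) \<subseteq> {1..length cs}" "set (leaf_numbers s') \<subseteq> {1..length cs}"
        using subtrees_leaf_numbers[OF s(1)] subtrees_leaf_numbers[OF s(2)] O by auto
      show "Outedge T v \<notin> set cs" if "v \<in> set (labels s) \<union> set (labels s')" for v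
        using that subtrees_vertices[OF s(1)] subtrees_vertices[OF s(2)] Ops_OmegaD(3)[OF t(1), of v] by auto
    qed
  qed
  moreover have "?r s \<in> Edges T" if "s \<in> subtrees t" for s
  proof (cases s)
    case (Leaf k)
    then show ?thesis
      using leaf that O by auto
  next
    case (Node v ts)
    then show ?thesis
      using wc[OF that] O Outedge_Edges by auto
  qed
  \<comment> \<open>Induction from the root upwards: a subtree whose colour is the output of a
    vertex cannot be a leaf, so the inputs of that vertex are the colours of its children.\<close>
  moreover have "e \<in> ?r ` subtrees t" if "e \<in> Edges T" for e
    using reach_Root[OF that]
  proof (induction rule: converse_rtrancl_induct)
    case base
    show ?case
      using t(2) by (metis image_eqI subtrees_refl)
  next
    case (step e e')
    then obtain v where v: "v \<in> Verts T" "e' = Outedge T v" "e \<in> In T v"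
      by (auto simp: below_def)
    obtain s where s: "s \<in> subtrees t" "e' = ?r s"
      using step.IH by blast
    show ?case
    proof (cases s)
      case (Leaf k)
      then show ?thesis
        using leaf s v X(2)[OF v(1)] cs by auto
    next
      case (Node w ts)
      then have "w \<in> Verts T" "map ?r ts = Ins \<Sigma> w"
        using wc[OF s(1)] O by auto
      moreover have "w = v"
        using Outedge_inj[OF \<open>w \<in> Verts T\<close> v(1)] s v(2) Node by simp
      ultimately have "e \<in> set (map ?r ts)"
        using Ins_tree(2)[OF v(1)] v(3) by simp
      then show ?thesis
        using child_subtrees[OF s(1)[unfolded Node]] by auto
    qed
  qed
  ultimately have "bij_betw ?r (subtrees t) (Edges T)"
    by (auto simp: bij_betw_def)
  then show ?thesis
    using t(1) X(2) cs by blast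
qed

end

lemma well_coloured_subtrees: "well_coloured \<Sigma> cs t \<Longrightarrow> s \<in> subtrees t \<Longrightarrow> well_coloured \<Sigma> cs s"
  by (induction t) auto

lemma subtrees_map_ptree: "subtrees (map_ptree f t) = map_ptree f ` subtrees t"
  by (induction t) auto

lemma tree_of_ess_surj:
  fixes T :: "('e::infinite, 'v::infinite) tree"
  assumes T: "finite_rooted_tree T"
  shows "\<exists>p\<in>Ops sOp. \<exists>i. is_iso Omega i \<and> Dom Omega i = Omega_operad (tree_of p :: ('e, 'v) tree) \<and>
    Cod Omega i = Omega_operad T"
proof -
  interpret rooted_tree T by (rule rooted_tree.intro) (rule T)
  obtain cs t where t: "(cs, t) \<in> Ops P" and bij: "bij_betw (root_colour \<Sigma> cs) (subtrees t) (Edges T)"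
    and cs: "\<And>v. v \<in> Verts T \<Longrightarrow> Outedge T v \<notin> set cs"
    using planar_representative by blast
  note O = t[unfolded Ops_Omega_iff] and D = Ops_OmegaD[OF t]
  let ?r = "root_colour \<Sigma> cs"
  let ?N = "length (vertices t)"
  have "card (set (labels t)) = ?N"
    using distinct_card[OF D(4)] by simp
  \<comment> \<open>Operations of \<open>sOp\<close> have numbered vertices, so the vertices of
    \<open>t\<close> are numbered by \<open>k\<close>; \<open>h\<close> restores their
    names.\<close>
  then obtain h where h: "bij_betw h {1..?N} (set (labels t))"
    using ex_bij_betw_nat_finite_1[of "set (labels t)"] by auto
  define k where "k = inv_into {1..?N} h"
  have k: "bij_betw k (set (labels t)) {1..?N}"
    unfolding k_def by (rule bij_betw_inv_into[OF h])
  have hk: "h (k v) = v" if "v \<in> set (labels t)" for v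
    unfolding k_def using bij_betw_inv_into_right[OF h that] .
  define p where "p = map_ptree k t"
  have p: "p \<in> Ops sOp"
  proof -
    have "distinct (map k (labels t))" "set (map k (labels t)) = {1..?N}"
      using k D(4) by (simp_all only: bij_betw_def distinct_map[of k "labels t"] set_map[of k "labels t"] simp_thms)
    moreover have "length (leaf_numbers t) = length cs"
      using O distinct_card[of "leaf_numbers t"] by simp
    ultimately show ?thesis
      unfolding Ops_sOp_iff mset_eq_upt_iff p_def labels_map_ptree proper_iff leaf_numbers_map_ptree
      using O by (simp add: vertices_map_ptree)
  qed
  have hp: "map_ptree h (map_ptree k s) = s" if "s \<in> subtrees t" for s
    unfolding map_ptree_comp by (rule map_ptree_idI, rule hk) (use subtrees_vertices[OF that] in auto)
  have sub: "subtrees p = map_ptree k ` subtrees t"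
    by (simp add: p_def subtrees_map_ptree)
  then have sub': "subtrees t = map_ptree h ` subtrees p"
    using hp by (force simp: image_image)
  have inj: "inj_on (map_ptree h) (subtrees p)"
    unfolding sub by (rule inj_onI) (auto simp: hp)
  have bijh: "bij_betw (\<lambda>s. ?r (map_ptree h s)) (subtrees p) (Edges T)"
    using bij_betw_trans[OF bij_betw_imageI[OF inj sub'[symmetric]] bij] by (simp add: comp_def)
  let ?S = "tree_of p :: ('e, 'v) tree"
  have S: "finite_rooted_tree ?S"
    by (rule finite_rooted_tree_of[OF Ops_sOp_separated[OF p]])
  \<comment> \<open>An edge of the tree of \<open>p\<close> goes to the edge of \<open>T\<close>
    that colours the root of the corresponding subtree of \<open>t\<close>.\<close>
  define f where "f = (\<lambda>e\<in>Edges ?S. ?r (map_ptree h (inv encode e)))"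
  have f: "f (encode s) = ?r (map_ptree h s)" if "s \<in> subtrees p" for s
    using that by (simp add: f_def)
  have fbij: "bij_betw f (Edges ?S) (Edges T)"
  proof (rule bij_betw_imageI)
    show "inj_on f (Edges ?S)"
      using bijh by (auto simp: inj_on_def f bij_betw_def)
    have "f ` Edges ?S = (\<lambda>s. ?r (map_ptree h s)) ` subtrees p"
      by (force simp: image_image f)
    then show "f ` Edges ?S = Edges T"
      using bijh by (simp add: bij_betw_def)
  qed
  have vertex: "h j \<in> Verts T" "Outedge T (h j) = f (Outedge ?S (encode (Node j ts)))"
    "In T (h j) = f ` In ?S (encode (Node j ts))" if N: "Node j ts \<in> subtrees p" for j ts
  proof -
    have "map_ptree h (Node j ts) \<in> subtrees t"
      using N sub' by blast
    then have "well_coloured \<Sigma> cs (map_ptree h (Node j ts))"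
      using O well_coloured_subtrees[of \<Sigma> cs t] by blast
    then have w: "h j \<in> Verts T" "map ?r (map (map_ptree h) ts) = Ins \<Sigma> (h j)"
      by auto
    show "h j \<in> Verts T"
      by (rule w)
    show "Outedge T (h j) = f (Outedge ?S (encode (Node j ts)))"
      using f[OF N] by simp
    have "set (map ?r (map (map_ptree h) ts)) = f ` encode ` set ts"
      using f child_subtrees[OF N] by (auto simp: image_image)
    then have "set (Ins \<Sigma> (h j)) = f ` encode ` set ts"
      unfolding w(2) .
    then show "In T (h j) = f ` In ?S (encode (Node j ts))"
      using Ins_tree(2)[OF w(1)] by simp
  qed
  have vertex_image: "\<exists>w\<in>Verts T. Outedge T w = f (Outedge ?S v) \<and> In T w = f ` In ?S v"
    if v: "v \<in> Verts ?S" for v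
  proof -
    obtain j ts where "Node j ts \<in> subtrees p" "v = encode (Node j ts)"
      using v by (auto simp: Verts_tree_of)
    then show ?thesis
      using vertex by blast
  qed
  have "is_iso Omega (tree_arrow ?S T f)"
  proof (rule tree_iso[OF S T _ fbij])
    show "f \<in> extensional (Edges ?S)"
      by (simp add: f_def)
    show "\<exists>w\<in>Verts T. Outedge T w = f (Outedge ?S v) \<and> In T w = f ` In ?S v" if "v \<in> Verts ?S" for v
      by (rule vertex_image[OF that])
    fix w assume w: "w \<in> Verts T"
    then obtain e where e: "e \<in> subtrees p" "Outedge T w = ?r (map_ptree h e)"
      using bijh Outedge_Edges[OF w] by (auto simp: bij_betw_def)
    show "\<exists>v\<in>Verts ?S. Outedge T w = f (Outedge ?S v) \<and> In T w = f ` In ?S v"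
    proof (cases e)
      \<comment> \<open>Impossible, since output edges of vertices are not leaf colours.\<close>
      case (Leaf n)
      then have "Leaf n \<in> subtrees t"
        using e(1) sub' by force
      then have "n \<in> {1..length cs}"
        using O leaf_numbers_subtrees[of n t] by simp
      then have "cs ! (n - 1) \<in> set cs"
        by auto
      then show ?thesis
        using e(2) Leaf cs[OF w] by simp
    next
      case (Node j ts)
      note v = vertex[OF e(1)[unfolded Node]]
      have "h j = w"
        using Outedge_inj[OF v(1) w] e(2) Node by simp
      then show ?thesis
        using v e(1) Node by (intro bexI[of _ "encode (Node j ts)"]) (auto simp: Verts_tree_of)
    qed
  qed
  moreover have "f \<in> tree_maps ?S T"
  proof (rule tree_map_vertices[OF S T])
    show "f \<in> Edges ?S \<rightarrow>\<^sub>E Edges T" "inj_on f (Edges ?S)"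
      using fbij by (auto simp: bij_betw_def f_def)
    show "\<exists>w\<in>Verts T. Outedge T w = f (Outedge ?S v) \<and> In T w = f ` In ?S v" if "v \<in> Verts ?S" for v
      by (rule vertex_image[OF that])
  qed
  ultimately show ?thesis
    using p tree_arrow_in_Omega[OF S T] by blast
qed


section \<open>The equivalence\<close>

definition dendrex :: "nat ptree \<Rightarrow> ('e::infinite, 'e list \<times> 'v::infinite ptree) operad" where
  "dendrex p = Omega_operad (tree_of p)"

definition dendrex_map :: "nat ptree tw_arrow \<Rightarrow> ('e::infinite, 'e list \<times> 'v::infinite ptree) operad_arrow" where
  "dendrex_map a = tree_arrow (tree_of (fst a)) (tree_of (tw_target sOp a))
     (encode_map (fst a) (edge_map (fst a) (labelling a)))"

text \<open>Allows a twisted arrow to be replaced by its family of labelled trees, for which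
  \<open>edge_map\<close> is understood.\<close>

lemma tw_arrows_cases:
  assumes "a \<in> tw_arrows sOp"
  obtains A where "arrow (fst a) A" "a = standard (fst a) A" "labelling a = A" "tw_target sOp a = target (fst a) A"
proof -
  obtain p vs lam where a: "a = (p, vs, lam)"
    by (cases a)
  show thesis
    using that[of "labelling a"] arrow_lab std_lab tw_target_lab assms unfolding a by simp
qed

lemma Tw_sel [simp]: "Ob (Tw P) = Ops P" "Ar (Tw P) = tw_arrows P" "Dom (Tw P) = fst" "Cod (Tw P) = tw_target P"
  "Ide (Tw P) = tw_identity P" "Cmp (Tw P) = tw_composite P"
  by (simp_all add: Tw_def)

lemma dendrex_map_std:
  "arrow p A \<Longrightarrow> dendrex_map (standard p A) = tree_arrow (tree_of p) (tree_of (target p A)) (encode_map p (edge_map p A))"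
  by (simp add: dendrex_map_def lab_std tw_target_std)

lemma tree_of_Ops: "p \<in> Ops sOp \<Longrightarrow> finite_rooted_tree (tree_of p)"
  by (rule finite_rooted_tree_of[OF Ops_sOp_separated])

lemma encode_edge_map:
  assumes "arrow p A"
  shows "encode_map p (edge_map p A) \<in>
    tree_maps (tree_of p :: ('e::infinite, 'v::infinite) tree) (tree_of (target p A) :: ('e, 'v) tree)"
proof -
  have "edge_map p A \<in> subtrees p \<rightarrow>\<^sub>E subtrees (target p A)"
    using edge_map_edge_maps[OF assms] by (simp add: edge_maps_def)
  then show ?thesis
    by (rule iffD2[OF encode_map_tree_maps[OF Ops_sOp_separated[OF arrow_target[OF assms]]] edge_map_edge_maps[OF assms]])
qed

theorem proposition3p54:
  shows "equivalent_categories (Tw sOp) (Omega :: ('e::infinite, 'v::infinite) dendroidal_category)"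
proof (rule equivalent_categoriesI[where Fo = dendrex and Fa = dendrex_map])
  show "is_category (Omega :: ('e, 'v) dendroidal_category)"
    by (rule is_category_Omega)
next
  fix p assume "p \<in> Ob (Tw sOp)"
  then have p: "p \<in> Ops sOp"
    by simp
  note I = arrow_arr_id[OF p] tgt_arr_id[OF p] std_arr_id[OF p]
  have "dendrex_map (tw_identity sOp p) = Ide (Omega :: ('e, 'v) dendroidal_category) (dendrex p)"
  proof -
    have "encode_map p (restrict id (subtrees p)) = restrict id (Edges (tree_of p :: ('e, 'v) tree))"
      by (auto simp: encode_map_def restrict_def fun_eq_iff)
    moreover have "(dendrex_map (tw_identity sOp p) :: ('e, 'e list \<times> 'v ptree) operad_arrow) =
        tree_arrow (tree_of p) (tree_of p) (encode_map p (restrict id (subtrees p)))"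
      using dendrex_map_std[OF I(1)] by (simp add: I edge_map_id[OF p])
    ultimately show ?thesis
      unfolding dendrex_def tree_arrow_id(1)[OF tree_of_Ops[OF p]] by (simp only:)
  qed
  moreover have "(dendrex p :: ('e, 'e list \<times> 'v ptree) operad) \<in> Ob Omega"
    using tree_of_Ops[OF p] by (auto simp: Omega_sel dendrex_def)
  ultimately show "dendrex p \<in> Ob (Omega :: ('e, 'v) dendroidal_category) \<and> Ide (Tw sOp) p \<in> Ar (Tw sOp) \<and>
      Dom (Tw sOp) (Ide (Tw sOp) p) = p \<and> Cod (Tw sOp) (Ide (Tw sOp) p) = p \<and>
      dendrex_map (Ide (Tw sOp) p) = Ide (Omega :: ('e, 'v) dendroidal_category) (dendrex p)"
    using std_tw_arrows[OF I(1)] tw_target_std[OF I(1)] by (simp add: I tw_identity_def)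
next
  fix a assume "a \<in> Ar (Tw sOp)"
  then obtain A where A: "arrow (fst a) A" "a = standard (fst a) A" "tw_target sOp a = target (fst a) A"
    using tw_arrows_cases[of a] by auto
  note st = tree_of_Ops[OF arrow_source[OF A(1)]] tree_of_Ops[OF arrow_target[OF A(1)]]
  have "(dendrex_map a :: ('e, 'e list \<times> 'v ptree) operad_arrow) =
      tree_arrow (tree_of (fst a)) (tree_of (target (fst a) A)) (encode_map (fst a) (edge_map (fst a) A))"
    using dendrex_map_std[OF A(1)] A(2) by simp
  then show "Dom (Tw sOp) a \<in> Ob (Tw sOp) \<and> Cod (Tw sOp) a \<in> Ob (Tw sOp) \<and>
      dendrex_map a \<in> Ar (Omega :: ('e, 'v) dendroidal_category) \<and>
      Dom Omega (dendrex_map a) = (dendrex (Dom (Tw sOp) a) :: ('e, 'e list \<times> 'v ptree) operad) \<and>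
      Cod Omega (dendrex_map a) = (dendrex (Cod (Tw sOp) a) :: ('e, 'e list \<times> 'v ptree) operad)"
    using arrow_source[OF A(1)] arrow_target[OF A(1)] A(3) tree_arrow_in_Omega[OF st encode_edge_map[OF A(1)]]
    by (simp add: dendrex_def)
next
  fix a b assume a: "a \<in> Ar (Tw sOp)" and b: "b \<in> Ar (Tw sOp)" and ab: "Cod (Tw sOp) a = Dom (Tw sOp) b"
  obtain p vs lam t ws mu where ab': "a = (p, vs, lam)" "b = (t, ws, mu)"
    by (cases a, cases b)
  have f: "(p, vs, lam) \<in> tw_arrows sOp" and g: "(t, ws, mu) \<in> tw_arrows sOp" and t: "tw_target sOp (p, vs, lam) = t"
    using a b ab by (auto simp: ab')
  let ?A = "labelling a" and ?B = "labelling b"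
  have tA: "target p ?A = t"
    using tw_target_lab[OF f] t by (simp add: ab')
  have A: "arrow p ?A" and B: "arrow (target p ?A) ?B"
    using arrow_lab[OF f] arrow_lab[OF g] tA by (auto simp: ab')
  have sa: "a = standard p ?A" and sb: "b = standard (target p ?A) ?B"
    using std_lab[OF f] std_lab[OF g] tA by (auto simp: ab')
  let ?C = "arrow_comp p ?B ?A"
  have c: "tw_composite sOp b a = standard p ?C"
    using tw_composite_lab[OF f g t] by (simp add: ab')
  note C = arrow_comp[OF A B] and tC = tgt_arr_comp[OF A B]
  note tr = tree_of_Ops[OF arrow_source[OF A]] tree_of_Ops[OF arrow_target[OF A]] tree_of_Ops[OF arrow_target[OF B]]
  \<comment> \<open>On colours the composite is a composite of edge maps, by
    \<open>edge_map_comp\<close>; \<open>tree_arrow_comp\<close> then gives it for the whole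
    arrows.\<close>
  have "compose (Edges (tree_of p :: ('e, 'v) tree)) (encode_map (target p ?A) (edge_map (target p ?A) ?B)) (encode_map p (edge_map p ?A))
      = encode_map p (edge_map p ?C)"
  proof (rule extensionalityI)
    fix e assume "e \<in> Edges (tree_of p :: ('e, 'v) tree)"
    then obtain s where s: "s \<in> subtrees p" "e = encode s"
      by auto
    then show "compose (Edges (tree_of p :: ('e, 'v) tree)) (encode_map (target p ?A) (edge_map (target p ?A) ?B))
        (encode_map p (edge_map p ?A)) e = encode_map p (edge_map p ?C) e"
      using edge_map_subtrees[OF A s(1)] edge_map_comp[OF A B s(1)] by (simp add: compose_eq)
  qed (simp_all add: compose_def encode_map_def)
  moreover have "(dendrex_map a :: ('e, 'e list \<times> 'v ptree) operad_arrow) =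
      tree_arrow (tree_of p) (tree_of (target p ?A)) (encode_map p (edge_map p ?A))"
    using arg_cong[OF sa, of dendrex_map] dendrex_map_std[OF A] by (rule trans)
  moreover have "(dendrex_map b :: ('e, 'e list \<times> 'v ptree) operad_arrow) =
      tree_arrow (tree_of (target p ?A)) (tree_of (target (target p ?A) ?B)) (encode_map (target p ?A) (edge_map (target p ?A) ?B))"
    using arg_cong[OF sb, of dendrex_map] dendrex_map_std[OF B] by (rule trans)
  moreover have "Cmp (Omega :: ('e, 'v) dendroidal_category)
      (tree_arrow (tree_of (target p ?A)) (tree_of (target (target p ?A) ?B)) (encode_map (target p ?A) (edge_map (target p ?A) ?B)))
      (tree_arrow (tree_of p) (tree_of (target p ?A)) (encode_map p (edge_map p ?A))) =
      tree_arrow (tree_of p) (tree_of (target (target p ?A) ?B)) (compose (Edges (tree_of p :: ('e, 'v) tree))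
        (encode_map (target p ?A) (edge_map (target p ?A) ?B)) (encode_map p (edge_map p ?A)))"
    by (rule tree_arrow_comp[OF tr encode_edge_map[OF A] encode_edge_map[OF B]])
  ultimately have "dendrex_map (tw_composite sOp b a) =
      Cmp (Omega :: ('e, 'v) dendroidal_category) (dendrex_map b) (dendrex_map a)"
    unfolding c dendrex_map_std[OF C] tC by (simp only:)
  moreover have "fst a = p"
    by (simp add: ab')
  moreover have "tw_target sOp b = target (target p ?A) ?B"
    using arg_cong[OF sb, of "tw_target sOp"] tw_target_std[OF B] by (rule trans)
  ultimately show "Cmp (Tw sOp) b a \<in> Ar (Tw sOp) \<and> Dom (Tw sOp) (Cmp (Tw sOp) b a) = Dom (Tw sOp) a \<and>
      Cod (Tw sOp) (Cmp (Tw sOp) b a) = Cod (Tw sOp) b \<and>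
      dendrex_map (Cmp (Tw sOp) b a) = Cmp (Omega :: ('e, 'v) dendroidal_category) (dendrex_map b) (dendrex_map a)"
    using std_tw_arrows[OF C] tw_target_std[OF C] by (simp only: Tw_sel c tC fst_std simp_thms)
next
  fix a b assume a: "a \<in> Ar (Tw sOp)" and b: "b \<in> Ar (Tw sOp)" and D: "Dom (Tw sOp) a = Dom (Tw sOp) b"
    and C: "Cod (Tw sOp) a = Cod (Tw sOp) b"
    and e: "dendrex_map a = (dendrex_map b :: ('e, 'e list \<times> 'v ptree) operad_arrow)"
  obtain A where A: "arrow (fst a) A" "a = standard (fst a) A" "tw_target sOp a = target (fst a) A"
    using tw_arrows_cases[of a] a by auto
  obtain B where B: "arrow (fst b) B" "b = standard (fst b) B" "tw_target sOp b = target (fst b) B"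
    using tw_arrows_cases[of b] b by auto
  have p: "fst b = fst a"
    using D by simp
  note B = B[unfolded p]
  have "(dendrex_map a :: ('e, 'e list \<times> 'v ptree) operad_arrow) =
      tree_arrow (tree_of (fst a)) (tree_of (target (fst a) A)) (encode_map (fst a) (edge_map (fst a) A))"
    using arg_cong[OF A(2), of dendrex_map] dendrex_map_std[OF A(1)] by (rule trans)
  moreover have "(dendrex_map b :: ('e, 'e list \<times> 'v ptree) operad_arrow) =
      tree_arrow (tree_of (fst a)) (tree_of (target (fst a) B)) (encode_map (fst a) (edge_map (fst a) B))"
    using arg_cong[OF B(2), of dendrex_map] dendrex_map_std[OF B(1)] by (rule trans)
  \<comment> \<open>An arrow of \<open>Omega\<close> contains its colour map, so equal arrows have
    equal edge maps.\<close>
  ultimately have "encode_map (fst a) (edge_map (fst a) A) = (encode_map (fst a) (edge_map (fst a) B) :: 'e \<Rightarrow> 'e)"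
    using e by (simp add: tree_arrow_def)
  then have "edge_map (fst a) A = edge_map (fst a) B"
    by (rule encode_map_eq[rotated 2]) (simp_all add: edge_map_def)
  moreover have "target (fst a) A = target (fst a) B"
    using A(3) B(3) C by simp
  ultimately have "A = B"
    using edge_map_inj[OF A(1) B(1)] by blast
  then show "a = b"
    using A(2) B(2) by simp
next
  fix p t h assume p: "p \<in> Ob (Tw sOp)" and t: "t \<in> Ob (Tw sOp)"
    and h: "h \<in> Ar (Omega :: ('e, 'v) dendroidal_category)" "Dom Omega h = dendrex p" "Cod Omega h = dendrex t"
  have p: "p \<in> Ops sOp" and t: "t \<in> Ops sOp"
    using p t by auto
  note tr = tree_of_Ops[OF p] tree_of_Ops[OF t]
  obtain k where k: "h = (dendrex p, k, dendrex t)"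
    using h(2,3) by (cases h) (auto simp: Omega_sel)
  then have "k \<in> operad_morphisms (Omega_operad (tree_of p)) (Omega_operad (tree_of t))"
    using h(1) by (simp add: Omega_sel dendrex_def)
  note m = morphism_tree_arrow[OF tr this]
  \<comment> \<open>The colour map of a morphism of dendrices translates back into an edge map of
    planar trees, which \<open>edge_map_full\<close> realises by an arrow.\<close>
  obtain f where f: "f \<in> edge_maps p t" "fst k = encode_map p f"
    using encode_map_surj[OF Ops_sOp_separated[OF t] m(1)] by blast
  obtain A where A: "arrow p A" "target p A = t" "edge_map p A = f"
    using edge_map_full[OF p t f(1)] by blast
  have "dendrex_map (standard p A) = h"
    using dendrex_map_std[OF A(1)] m(2) by (simp add: A f(2) k dendrex_def)
  then show "\<exists>a\<in>Ar (Tw sOp). Dom (Tw sOp) a = p \<and> Cod (Tw sOp) a = t \<and> dendrex_map a = h"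
    using std_tw_arrows[OF A(1)] tw_target_std[OF A(1)] A(2) by (intro bexI[of _ "standard p A"]) auto
next
  fix P assume "P \<in> Ob (Omega :: ('e, 'v) dendroidal_category)"
  then obtain T :: "('e, 'v) tree" where "P = Omega_operad T" "finite_rooted_tree T"
    by (auto simp: Omega_sel)
  then show "\<exists>p\<in>Ob (Tw sOp). \<exists>i. is_iso Omega i \<and> Dom Omega i = dendrex p \<and> Cod Omega i = P"
    using tree_of_ess_surj[of T] by (simp add: dendrex_def)
qed

end
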